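(* Let $n\ge 2$ and let $(A_0,v_0)\in GL(n,\mathbb{R})\times\mathbb{R}^n$ be a regular drift pair. Let $s$ be the total algebraic multiplicity of the eigenvalues of $A_0$, different from $1$, which lie inside the (open) unit disk. Then there exist a neighborhood $\mathcal{U}$ of $(A_0,v_0)$ in $GL(n,\mathbb{R})\times\mathbb{R}^n$, contained in $\mathcal{A}_n$, and a smooth real eigenvalue branch $A\mapsto\lambda(A)$ with $\lambda(A_0)=1$ (a smooth real-valued function, defined for all $A$ occurring in pairs $(A,v)\in\mathcal{U}$, with $\lambda(A)$ an eigenvalue of $A$), such that for every $(A,v)\in\mathcal{U}$ $$\operatorname{Ind}(f_{A,v})=\begin{cases}\{s+1\},&\lambda(A)<1,\\ \{1,\dots,n-1\},&\lambda(A)=1,\\ \{s\},&\lambda(A)>1.\end{cases}$$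
   Context: $f_{A,v}(x)=Ax+v$ on $\mathbb{R}^n$. $(A,v)\in GL(n,\mathbb{R})\times\mathbb{R}^n$ is a regular drift pair if (1) $1$ is the only eigenvalue of $A$ on the unit circle, $\operatorname{Spec}(A)\cap\mathbb{S}^1=\{1\}$; (2) the eigenvalue $1$ is algebraically simple; (3) $v\notin\operatorname{Im}(I-A)$. A diffeomorphism $f$ of a smooth manifold $M$ is Anosov with respect to a Riemannian metric $\rho$ if there are a continuous $Df$-invariant splitting $TM=E^s\oplus E^u$ (an Anosov splitting; possibly trivial: $E^s=\{0\}$ or $E^u=\{0\}$ allowed) and constants $C\ge 1$, $\lambda\in(0,1)$ such that for all integers $m\ge 0$: $\|Df^m(w)\|_\rho\le C\lambda^m\|w\|_\rho$ for $w\in E^s$ and $\|Df^{-m}(w)\|_\rho\le C\lambda^m\|w\|_\rho$ for $w\in E^u$. $\mathcal{A}_n$ is the set of $(A,v)\in GL(n,\mathbb{R})\times\mathbb{R}^n$ such that $f_{A,v}$ is Anosov with respect to some complete Riemannian metric on $\mathbb{R}^n$. The index spectrum $\operatorname{Ind}(f_{A,v})$ is the set of all numbers $\dim E^s_g$, where $g$ ranges over all complete Riemannian metrics on $\mathbb{R}^n$ with respect to which $f_{A,v}$ is Anosov, and $E^s_g$ over the stable bundles of Anosov splittings associated with $g$. *)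

theory Defs
  imports "HOL-Analysis.Analysis" "HOL-Computational_Algebra.Polynomial"
begin

definition complex_matrix :: "real^'n^'n \<Rightarrow> complex^'n^'n" where
  "complex_matrix A = map_matrix complex_of_real A"

definition spectrum :: "real^'n^'n \<Rightarrow> complex set" where
  "spectrum A = {c. \<exists>x. x \<noteq> 0 \<and> complex_matrix A *v x = c *s x}"

definition charpoly :: "'a::comm_ring_1^'n^'n \<Rightarrow> 'a poly" where
  "charpoly A = det (mat [:0, 1:] - map_matrix (\<lambda>a. [:a:]) A)"

definition alg_mult :: "real^'n^'n \<Rightarrow> complex \<Rightarrow> nat" where
  "alg_mult A c = order c (charpoly (complex_matrix A))"

text \<open>\<open>C_k_on k S f\<close> and \<open>smooth_on S f\<close> are meant for open \<open>S\<close> only.\<close>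

fun C_k_on :: "nat \<Rightarrow> 'a::real_normed_vector set \<Rightarrow> ('a \<Rightarrow> 'b::real_normed_vector) \<Rightarrow> bool" where
  "C_k_on 0 S f \<longleftrightarrow> continuous_on S f"
| "C_k_on (Suc k) S f \<longleftrightarrow>
     (\<forall>x\<in>S. f differentiable (at x)) \<and>
     (\<forall>w. C_k_on k S (\<lambda>x. frechet_derivative f (at x) w))"

definition smooth_on :: "'a::real_normed_vector set \<Rightarrow> ('a \<Rightarrow> 'b::real_normed_vector) \<Rightarrow> bool" where
  "smooth_on S f \<longleftrightarrow> (\<forall>k. C_k_on k S f)"

definition diffeomorphism :: "('a::real_normed_vector \<Rightarrow> 'a) \<Rightarrow> bool" where
  "diffeomorphism f \<longleftrightarrow> bij f \<and> smooth_on UNIV f \<and> smooth_on UNIV (inv f)"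

text \<open>A Riemannian metric is given by its Gram matrix \<open>g x\<close> at each point \<open>x\<close>, with respect to
  the standard trivialisation of the tangent bundle.\<close>

definition riemannian_metric :: "(real^'n \<Rightarrow> real^'n^'n) \<Rightarrow> bool" where
  "riemannian_metric g \<longleftrightarrow> smooth_on UNIV g \<and>
     (\<forall>x. transpose (g x) = g x \<and> (\<forall>w. w \<noteq> 0 \<longrightarrow> w \<bullet> (g x *v w) > 0))"

definition rnorm :: "(real^'n \<Rightarrow> real^'n^'n) \<Rightarrow> real^'n \<Rightarrow> real^'n \<Rightarrow> real" where
  "rnorm g x w = sqrt (w \<bullet> (g x *v w))"

definition speed :: "(real^'n \<Rightarrow> real^'n^'n) \<Rightarrow> (real \<Rightarrow> real^'n) \<Rightarrow> real \<Rightarrow> real" where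
  "speed g \<gamma> t = rnorm g (\<gamma> t) (vector_derivative \<gamma> (at t))"

text \<open>A \<^const>\<open>valid_path\<close> may have an unbounded derivative near one of its finitely many
  exceptional parameters, and hence infinite length, while \<^const>\<open>integral\<close> is \<open>0\<close> on
  non-integrable functions. Paths of infinite length are therefore excluded explicitly.\<close>

definition rdist :: "(real^'n \<Rightarrow> real^'n^'n) \<Rightarrow> real^'n \<Rightarrow> real^'n \<Rightarrow> real" where
  "rdist g x y = Inf {integral {0..1} (speed g \<gamma>) | \<gamma>.
     valid_path \<gamma> \<and> pathstart \<gamma> = x \<and> pathfinish \<gamma> = y \<and> speed g \<gamma> integrable_on {0..1}}"

definition complete_riemannian_metric :: "(real^'n \<Rightarrow> real^'n^'n) \<Rightarrow> bool" where
  "complete_riemannian_metric g \<longleftrightarrow>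
     riemannian_metric g \<and> Metric_space.mcomplete UNIV (rdist g)"

text \<open>A continuous subbundle of the tangent bundle: a family of subspaces which locally has a
  continuous frame \<open>X 0, \<dots>, X (k - 1)\<close>.\<close>

definition continuous_subbundle :: "(real^'n \<Rightarrow> (real^'n) set) \<Rightarrow> bool" where
  "continuous_subbundle E \<longleftrightarrow>
     (\<forall>p. \<exists>U k (X :: nat \<Rightarrow> real^'n \<Rightarrow> real^'n). open U \<and> p \<in> U \<and>
        (\<forall>i<k. continuous_on U (X i)) \<and>
        (\<forall>x\<in>U. inj_on (\<lambda>i. X i x) {..<k} \<and> independent ((\<lambda>i. X i x) ` {..<k}) \<and>
                span ((\<lambda>i. X i x) ` {..<k}) = E x))"

definition anosov_splitting ::
  "(real^'n \<Rightarrow> real^'n^'n) \<Rightarrow> (real^'n \<Rightarrow> real^'n) \<Rightarrow>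
   (real^'n \<Rightarrow> (real^'n) set) \<Rightarrow> (real^'n \<Rightarrow> (real^'n) set) \<Rightarrow> bool" where
  "anosov_splitting g f Es Eu \<longleftrightarrow>
     continuous_subbundle Es \<and> continuous_subbundle Eu \<and>
     (\<forall>x. Es x \<inter> Eu x = {0} \<and> {a + b | a b. a \<in> Es x \<and> b \<in> Eu x} = UNIV) \<and>
     (\<forall>x. frechet_derivative f (at x) ` Es x = Es (f x) \<and>
          frechet_derivative f (at x) ` Eu x = Eu (f x)) \<and>
     (\<exists>C \<mu>. C \<ge> 1 \<and> 0 < \<mu> \<and> \<mu> < 1 \<and>
        (\<forall>m x. \<forall>w\<in>Es x.
           rnorm g ((f ^^ m) x) (frechet_derivative (f ^^ m) (at x) w) \<le> C * \<mu> ^ m * rnorm g x w) \<and>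
        (\<forall>m x. \<forall>w\<in>Eu x.
           rnorm g ((inv f ^^ m) x) (frechet_derivative (inv f ^^ m) (at x) w)
             \<le> C * \<mu> ^ m * rnorm g x w))"

definition anosov :: "(real^'n \<Rightarrow> real^'n^'n) \<Rightarrow> (real^'n \<Rightarrow> real^'n) \<Rightarrow> bool" where
  "anosov g f \<longleftrightarrow> diffeomorphism f \<and> (\<exists>Es Eu. anosov_splitting g f Es Eu)"

text \<open>The dimension of a continuous subbundle over the connected space \<open>real^'n\<close> is constant.\<close>

definition index_spectrum :: "(real^'n \<Rightarrow> real^'n) \<Rightarrow> nat set" where
  "index_spectrum f = {k. \<exists>g Es Eu. complete_riemannian_metric g \<and> anosov g f \<and>
     anosov_splitting g f Es Eu \<and> (\<forall>x. dim (Es x) = k)}"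

definition affine_map :: "real^'n^'n \<Rightarrow> real^'n \<Rightarrow> real^'n \<Rightarrow> real^'n" where
  "affine_map A v x = A *v x + v"

definition anosov_pairs :: "((real^'n^'n) \<times> (real^'n)) set" where
  "anosov_pairs = {(A, v). invertible A \<and>
     (\<exists>g. complete_riemannian_metric g \<and> anosov g (affine_map A v))}"

definition regular_drift_pair :: "real^'n^'n \<Rightarrow> real^'n \<Rightarrow> bool" where
  "regular_drift_pair A v \<longleftrightarrow> invertible A \<and>
     spectrum A \<inter> sphere 0 1 = {1} \<and>
     alg_mult A 1 = 1 \<and>
     v \<notin> range (\<lambda>x. (mat 1 - A) *v x)"

end

(*
  Near A0 the eigenvalue 1 continues to a smooth simple real eigenvalue ev A, by the implicit function
  theorem applied to det (lambda - A), and the other roots of the characteristic polynomial stay off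
  the unit circle, s of them inside.

  If ev A differs from 1, then A is hyperbolic. The map has a fixed point, where every Anosov
  splitting must coincide with the linear splitting of A, and the Euclidean metric realises it.

  If ev A = 1, the map has no fixed point. For a complete metric an Anosov splitting with a trivial
  summand would make an iterate of the map, or of its inverse, a contraction of a complete metric
  space, so the index lies strictly between 0 and n. Conversely let l be the left eigenvector with
  l(v) = 1, so that height := l(x - y0) increases by one under the map. Joining matrices by smooth
  paths yields a periodic moving frame, hence coordinates in which the map is a translation by one
  in the height, up to signs. Any covector of the invariant coframe can be made contracting or
  expanding by weighting it with exp (-2 height) or exp (2 height). Keeping the height covector
  expanding, and one other covector contracting, leaves free every index from 1 to n - 1.
  Completeness is endangered only at height minus infinity, which has finite distance in the height
  direction; it is restored by twisting one contracting covector so that descending forces an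
  oscillation whose cost grows.
*)

theory Submission
  imports Defs "HOL-Computational_Algebra.Fundamental_Theorem_Algebra"
begin

section \<open>Smooth maps\<close>

text \<open>The obstacle is the lower end of the height. Weight exp(2 height) on d height gives that
  end finite length, and the opposite exponent would only move the defect to the upper end. A
  contracting covector is very expensive down there, so a cheap descent must keep it nearly zero.
  Replacing d xi by theta = d xi - pi om cos(om height) (1 + xi^2) d height turns the curves with
  theta = 0 into arctan xi = pi sin(om height) + const, and such a curve cannot run through a full
  period: the sine term swings by 2 pi, the arctangent by less than pi. The factor 1 + xi^2 is paid
  for in the weight of d height. Signs occur because GL(n,R) is disconnected; a metric made of
  squares of covectors does not see them, and om is adapted to the sign of xi. Near A0 the condition
  that v is not in Im(I - A) is not open, but it matters only where 1 is an eigenvalue; there it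
  follows from det(I - A + v l^T) being nonzero for a fixed l, which is open. Stable spaces are
  defined by decay of orbits, so no Jordan form enters.\<close>

lemma C_k_on_cong:
  assumes "open S" "\<And>x. x \<in> S \<Longrightarrow> f x = g x" "C_k_on k S f"
  shows "C_k_on k S g"
  using assms(2,3)
proof (induction k arbitrary: f g)
  case 0
  then show ?case by (auto cong: continuous_on_cong)
next
  case (Suc k)
  have der: "(g has_derivative frechet_derivative f (at x)) (at x)" if "x \<in> S" for x
  proof (rule has_derivative_transform_within_open[OF _ assms(1) that])
    show "(f has_derivative frechet_derivative f (at x)) (at x)"
      using Suc.prems(2) that by (simp add: frechet_derivative_works)
  qed (use Suc.prems(1) in blast)
  have "C_k_on k S (\<lambda>x. frechet_derivative g (at x) w)" for w
  proof (rule Suc.IH)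
    show "frechet_derivative f (at x) w = frechet_derivative g (at x) w" if "x \<in> S" for x
      using frechet_derivative_at[OF der[OF that]] by simp
    show "C_k_on k S (\<lambda>x. frechet_derivative f (at x) w)"
      using Suc.prems(2) by simp
  qed
  then show ?case using der by (auto simp: differentiable_def)
qed

text \<open>\<open>C_k_on\<close> is phrased with \<open>frechet_derivative\<close>; uniqueness of
  the derivative lets any explicit formula \<open>D\<close> take its place. Most inductions on the
  order of differentiability run through this rule.\<close>

lemma C_k_on_SucI:
  assumes "open S" "\<And>x. x \<in> S \<Longrightarrow> (f has_derivative D x) (at x)"
    and "\<And>w. C_k_on k S (\<lambda>x. D x w)"
  shows "C_k_on (Suc k) S f"
proof -
  have "D x = frechet_derivative f (at x)" if "x \<in> S" for x
    using frechet_derivative_at[OF assms(2)[OF that]] by simp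
  then have "C_k_on k S (\<lambda>x. frechet_derivative f (at x) w)" for w
    by (intro C_k_on_cong[OF assms(1) _ assms(3)[of w]]) auto
  then show ?thesis using assms(2) by (auto simp: differentiable_def)
qed

lemma C_k_on_SucD:
  assumes "C_k_on (Suc k) S f"
  shows "x \<in> S \<Longrightarrow> (f has_derivative frechet_derivative f (at x)) (at x)"
    and "C_k_on k S (\<lambda>x. frechet_derivative f (at x) w)"
  using assms by (auto simp: frechet_derivative_works)

lemma C_k_on_Suc_imp: "C_k_on (Suc k) S f \<Longrightarrow> C_k_on k S f"
proof (induction k arbitrary: f)
  case 0
  then show ?case
    by (auto intro!: continuous_at_imp_continuous_on differentiable_imp_continuous_within)
next
  case (Suc k)
  then show ?case by (subst C_k_on.simps) (auto simp del: C_k_on.simps dest: C_k_on_SucD simp: differentiable_def)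
qed

lemma C_k_on_subset: "C_k_on k S f \<Longrightarrow> T \<subseteq> S \<Longrightarrow> C_k_on k T f"
  by (induction k arbitrary: f) (auto intro: continuous_on_subset)

lemma C_k_on_locally:
  assumes "\<And>x. x \<in> S \<Longrightarrow> \<exists>T. open T \<and> x \<in> T \<and> C_k_on k T f"
  shows "C_k_on k S f"
  using assms
proof (induction k arbitrary: f)
  case 0
  then show ?case
    by (auto intro!: continuous_at_imp_continuous_on simp: continuous_on_eq_continuous_at) 
      (metis continuous_on_eq_continuous_at)
next
  case (Suc k)
  have "f differentiable at x" if "x \<in> S" for x
    using Suc.prems[OF that] by auto
  moreover have "C_k_on k S (\<lambda>x. frechet_derivative f (at x) w)" for w
  proof (rule Suc.IH)
    fix x assume "x \<in> S"
    from Suc.prems[OF this] show "\<exists>T. open T \<and> x \<in> T \<and> C_k_on k T (\<lambda>x. frechet_derivative f (at x) w)"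
      by auto
  qed
  ultimately show ?case by auto
qed

lemma C_k_on_const: "open S \<Longrightarrow> C_k_on k S (\<lambda>x. c)"
  by (induction k arbitrary: c) (auto simp: continuous_on_const)

lemma C_k_on_bounded_linear_comp:
  assumes "open S" "bounded_linear h"
  shows "C_k_on k S f \<Longrightarrow> C_k_on k S (\<lambda>x. h (f x))"
proof (induction k arbitrary: f)
  case 0
  then show ?case using assms(2)
    by (auto intro: continuous_on_compose2 linear_continuous_on)
next
  case (Suc k)
  show ?case
    by (rule C_k_on_SucI[OF assms(1), of _ "\<lambda>x w. h (frechet_derivative f (at x) w)"])
      (use Suc assms(2) in \<open>auto intro!: bounded_linear.has_derivative[OF assms(2)] simp: frechet_derivative_works\<close>)
qed

lemma C_k_on_ident: "open S \<Longrightarrow> C_k_on k S (\<lambda>x. x)"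
proof (cases k)
  case (Suc j)
  assume "open S"
  then show ?thesis unfolding Suc
    by (intro C_k_on_SucI[of _ _ "\<lambda>x w. w"]) (auto intro: C_k_on_const has_derivative_ident)
qed (auto simp: continuous_on_id)

lemma C_k_on_bounded_linear: "open S \<Longrightarrow> bounded_linear h \<Longrightarrow> C_k_on k S h"
  using C_k_on_bounded_linear_comp[OF _ _ C_k_on_ident] by blast

lemma C_k_on_add:
  assumes "open S"
  shows "C_k_on k S f \<Longrightarrow> C_k_on k S g \<Longrightarrow> C_k_on k S (\<lambda>x. f x + g x)"
proof (induction k arbitrary: f g)
  case 0
  then show ?case by (auto intro: continuous_on_add)
next
  case (Suc k)
  show ?case
    by (rule C_k_on_SucI[OF assms(1), of _ "\<lambda>x w. frechet_derivative f (at x) w + frechet_derivative g (at x) w"])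
      (use Suc in \<open>auto intro!: has_derivative_add simp: frechet_derivative_works\<close>)
qed

lemma C_k_on_bilinear:
  assumes "open S" "bounded_bilinear h"
  shows "C_k_on k S f \<Longrightarrow> C_k_on k S g \<Longrightarrow> C_k_on k S (\<lambda>x. h (f x) (g x))"
proof (induction k arbitrary: f g)
  case 0
  then show ?case using bounded_bilinear.continuous_on[OF assms(2)] by auto
next
  case (Suc k)
  have k: "C_k_on k S f" "C_k_on k S g" using Suc.prems C_k_on_Suc_imp by blast+
  show ?case
  proof (rule C_k_on_SucI[OF assms(1)])
    fix x assume "x \<in> S"
    from bounded_bilinear.FDERIV[OF assms(2) Suc.prems[THEN C_k_on_SucD(1), OF this]]
    show "((\<lambda>x. h (f x) (g x)) has_derivative
      (\<lambda>w. h (f x) (frechet_derivative g (at x) w) + h (frechet_derivative f (at x) w) (g x))) (at x)" .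
  next
    show "C_k_on k S (\<lambda>x. h (f x) (frechet_derivative g (at x) w) + h (frechet_derivative f (at x) w) (g x))" for w
      by (intro C_k_on_add[OF assms(1)] Suc.IH k Suc.prems[THEN C_k_on_SucD(2)])
  qed
qed

lemma C_k_on_sum:
  assumes "open S" "\<And>i. i \<in> I \<Longrightarrow> C_k_on k S (f i)"
  shows "C_k_on k S (\<lambda>x. \<Sum>i\<in>I. f i x)"
  using assms(2)
  by (induction I rule: infinite_finite_induct) (auto intro!: C_k_on_const C_k_on_add assms(1))

lemma C_k_on_prod:
  fixes f :: "'i \<Rightarrow> 'a::real_normed_vector \<Rightarrow> real"
  assumes "open S" "\<And>i. i \<in> I \<Longrightarrow> C_k_on k S (f i)"
  shows "C_k_on k S (\<lambda>x. \<Prod>i\<in>I. f i x)"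
  using assms(2)
  by (induction I rule: infinite_finite_induct)
    (auto intro!: C_k_on_const C_k_on_bilinear[OF assms(1) bounded_bilinear_mult] assms(1))

text \<open>In the chain rule the derivative of \<open>g\<close> is evaluated in a direction that
  depends on the point, whereas \<open>C_k_on\<close> speaks of fixed directions only. Expanding
  that direction in the basis of the middle space gives a finite sum of products, to which the
  induction hypothesis applies; hence the Euclidean middle space.\<close>

lemma C_k_on_compose:
  fixes f :: "'a::real_normed_vector \<Rightarrow> 'b::euclidean_space" and g :: "'b \<Rightarrow> 'c::real_normed_vector"
  assumes "open S" "open T" "f ` S \<subseteq> T"
  shows "C_k_on k S f \<Longrightarrow> C_k_on k T g \<Longrightarrow> C_k_on k S (\<lambda>x. g (f x))"
  using assms(3)
proof (induction k arbitrary: g)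
  case 0
  then show ?case by (auto intro: continuous_on_compose2)
next
  case (Suc k)
  let ?D = "\<lambda>x w. \<Sum>b\<in>Basis. (frechet_derivative f (at x) w \<bullet> b) *\<^sub>R frechet_derivative g (at (f x)) b"
  show ?case
  proof (rule C_k_on_SucI[OF assms(1), of _ ?D])
    fix x assume "x \<in> S"
    then have f': "(f has_derivative frechet_derivative f (at x)) (at x)"
      and g': "(g has_derivative frechet_derivative g (at (f x))) (at (f x))"
      using Suc.prems by (auto simp: frechet_derivative_works)
    have lin: "linear (frechet_derivative g (at (f x)))"
      using g' has_derivative_linear by blast
    have "?D x w = frechet_derivative g (at (f x)) (frechet_derivative f (at x) w)" for w
      by (subst (3) euclidean_representation[symmetric]) (simp add: linear_sum[OF lin] linear_cmul[OF lin])
    then show "((\<lambda>x. g (f x)) has_derivative ?D x) (at x)"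
      using has_derivative_compose[OF f' g'] by presburger
  next
    fix w
    have fk: "C_k_on k S f" using Suc.prems C_k_on_Suc_imp by blast
    show "C_k_on k S (\<lambda>x. ?D x w)"
    proof (intro C_k_on_sum assms(1) C_k_on_bilinear[OF assms(1) bounded_bilinear_scaleR])
      fix b :: 'b assume "b \<in> Basis"
      show "C_k_on k S (\<lambda>x. frechet_derivative f (at x) w \<bullet> b)"
        using Suc.prems(1) C_k_on_bounded_linear_comp[OF assms(1) bounded_linear_inner_left] C_k_on_SucD(2) by blast
      show "C_k_on k S (\<lambda>x. frechet_derivative g (at (f x)) b)"
        using Suc.IH[OF fk, of "\<lambda>y. frechet_derivative g (at y) b"] Suc.prems C_k_on_SucD(2) by blast
    qed
  qed
qed

lemma smooth_onI: "(\<And>k. C_k_on k S f) \<Longrightarrow> smooth_on S f"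
  and smooth_onD: "smooth_on S f \<Longrightarrow> C_k_on k S f"
  by (auto simp: smooth_on_def)

lemma smooth_on_cong: "open S \<Longrightarrow> smooth_on S f \<Longrightarrow> (\<And>x. x \<in> S \<Longrightarrow> f x = g x) \<Longrightarrow> smooth_on S g"
  unfolding smooth_on_def using C_k_on_cong by blast

lemma smooth_on_subset: "smooth_on S f \<Longrightarrow> T \<subseteq> S \<Longrightarrow> smooth_on T f"
  unfolding smooth_on_def using C_k_on_subset by blast

lemma smooth_on_locally:
  assumes "\<And>x. x \<in> S \<Longrightarrow> \<exists>T. open T \<and> x \<in> T \<and> smooth_on T f"
  shows "smooth_on S f"
  unfolding smooth_on_def by (intro allI C_k_on_locally) (use assms in \<open>auto simp: smooth_on_def\<close>)

lemma smooth_on_imp_has_derivative: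
  "smooth_on S f \<Longrightarrow> x \<in> S \<Longrightarrow> (f has_derivative frechet_derivative f (at x)) (at x)"
  using C_k_on_SucD(1) smooth_onD by blast

lemma smooth_on_frechet_derivative:
  "smooth_on S f \<Longrightarrow> smooth_on S (\<lambda>x. frechet_derivative f (at x) w)"
  using C_k_on_SucD(2) by (metis smooth_on_def)

lemma smooth_on_imp_continuous_on: "smooth_on S f \<Longrightarrow> continuous_on S f"
  using smooth_onD[of S f 0] by simp

lemma smooth_on_const: "open S \<Longrightarrow> smooth_on S (\<lambda>x. c)"
  by (simp add: smooth_on_def C_k_on_const)

lemma smooth_on_ident: "open S \<Longrightarrow> smooth_on S (\<lambda>x. x)"
  by (simp add: smooth_on_def C_k_on_ident)

lemma smooth_on_bounded_linear: "open S \<Longrightarrow> bounded_linear h \<Longrightarrow> smooth_on S h"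
  by (simp add: smooth_on_def C_k_on_bounded_linear)

lemma smooth_on_bounded_linear_comp:
  "open S \<Longrightarrow> bounded_linear h \<Longrightarrow> smooth_on S f \<Longrightarrow> smooth_on S (\<lambda>x. h (f x))"
  by (simp add: smooth_on_def C_k_on_bounded_linear_comp)

lemma smooth_on_add: "open S \<Longrightarrow> smooth_on S f \<Longrightarrow> smooth_on S g \<Longrightarrow> smooth_on S (\<lambda>x. f x + g x)"
  by (simp add: smooth_on_def C_k_on_add)

lemma smooth_on_sum:
  "open S \<Longrightarrow> (\<And>i. i \<in> I \<Longrightarrow> smooth_on S (f i)) \<Longrightarrow> smooth_on S (\<lambda>x. \<Sum>i\<in>I. f i x)"
  by (simp add: smooth_on_def C_k_on_sum)

lemma smooth_on_bilinear:
  "open S \<Longrightarrow> bounded_bilinear h \<Longrightarrow> smooth_on S f \<Longrightarrow> smooth_on S g \<Longrightarrow> smooth_on S (\<lambda>x. h (f x) (g x))"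
  by (auto simp: smooth_on_def intro: C_k_on_bilinear)

lemma smooth_on_compose:
  fixes f :: "'a::real_normed_vector \<Rightarrow> 'b::euclidean_space" and g :: "'b \<Rightarrow> 'c::real_normed_vector"
  shows "open S \<Longrightarrow> open T \<Longrightarrow> f ` S \<subseteq> T \<Longrightarrow> smooth_on S f \<Longrightarrow> smooth_on T g \<Longrightarrow> smooth_on S (\<lambda>x. g (f x))"
  by (auto simp: smooth_on_def intro: C_k_on_compose)

lemma smooth_on_compose_UNIV:
  fixes f :: "'a::real_normed_vector \<Rightarrow> 'b::euclidean_space" and g :: "'b \<Rightarrow> 'c::real_normed_vector"
  shows "open S \<Longrightarrow> smooth_on UNIV g \<Longrightarrow> smooth_on S f \<Longrightarrow> smooth_on S (\<lambda>x. g (f x))"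
  by (rule smooth_on_compose[of S UNIV]) auto

lemma smooth_on_mult:
  fixes f g :: "'a::real_normed_vector \<Rightarrow> 'b::real_normed_algebra"
  shows "open S \<Longrightarrow> smooth_on S f \<Longrightarrow> smooth_on S g \<Longrightarrow> smooth_on S (\<lambda>x. f x * g x)"
  by (rule smooth_on_bilinear[OF _ bounded_bilinear_mult])

lemma smooth_on_prod:
  fixes f :: "'i \<Rightarrow> 'a::real_normed_vector \<Rightarrow> real"
  shows "open S \<Longrightarrow> (\<And>i. i \<in> I \<Longrightarrow> smooth_on S (f i)) \<Longrightarrow> smooth_on S (\<lambda>x. \<Prod>i\<in>I. f i x)"
  by (auto simp: smooth_on_def intro: C_k_on_prod)

lemma smooth_on_minus: "open S \<Longrightarrow> smooth_on S f \<Longrightarrow> smooth_on S (\<lambda>x. - f x)"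
  by (rule smooth_on_bounded_linear_comp) (auto intro: bounded_linear_minus bounded_linear_ident)

lemma smooth_on_diff: "open S \<Longrightarrow> smooth_on S f \<Longrightarrow> smooth_on S g \<Longrightarrow> smooth_on S (\<lambda>x. f x - g x)"
  using smooth_on_add[of S f "\<lambda>x. - g x"] smooth_on_minus[of S g] by simp

lemma smooth_on_power:
  fixes f :: "'a::real_normed_vector \<Rightarrow> real"
  shows "open S \<Longrightarrow> smooth_on S f \<Longrightarrow> smooth_on S (\<lambda>x. f x ^ k)"
  by (induction k) (auto intro!: smooth_on_const smooth_on_mult)

lemma smooth_on_vec_nth: "open S \<Longrightarrow> smooth_on S f \<Longrightarrow> smooth_on S (\<lambda>x. f x $ i)"
  by (rule smooth_on_bounded_linear_comp[OF _ bounded_linear_vec_nth])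

lemma smooth_on_vec:
  fixes f :: "'a::real_normed_vector \<Rightarrow> 'b::euclidean_space^'n"
  assumes "open S" "\<And>i. smooth_on S (\<lambda>x. f x $ i)"
  shows "smooth_on S f"
proof -
  have lin: "bounded_linear (axis i :: 'b \<Rightarrow> 'b^'n)" for i
    by (intro linear_conv_bounded_linear[THEN iffD1] linearI) (auto simp: axis_def vec_eq_iff)
  have "smooth_on S (\<lambda>x. \<Sum>i\<in>UNIV. axis i (f x $ i))"
    by (intro smooth_on_sum smooth_on_bounded_linear_comp[OF _ lin] assms)
  moreover have "(\<Sum>i\<in>UNIV. axis i (f x $ i)) = f x" for x
    by (simp add: vec_eq_iff axis_def)
  ultimately show ?thesis by simp
qed

lemma smooth_on_matrix:
  fixes f :: "'a::real_normed_vector \<Rightarrow> real^'n^'m"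
  assumes "open S" "\<And>i j. smooth_on S (\<lambda>x. f x $ i $ j)"
  shows "smooth_on S f"
  by (intro smooth_on_vec assms)

lemma smooth_on_det:
  fixes f :: "'a::real_normed_vector \<Rightarrow> real^'n^'n"
  assumes "open S" "smooth_on S f"
  shows "smooth_on S (\<lambda>x. det (f x))"
  unfolding det_def
  by (intro smooth_on_sum smooth_on_mult smooth_on_const smooth_on_prod smooth_on_vec_nth assms)

lemma bounded_bilinear_matrix_matrix_mult:
  "bounded_bilinear ((**) :: real^'n^'m \<Rightarrow> real^'p^'n \<Rightarrow> real^'p^'m)"
  by (intro bilinear_conv_bounded_bilinear[THEN iffD1])
    (auto simp: bilinear_def linear_iff matrix_matrix_mult_def vec_eq_iff sum.distrib algebra_simps sum_distrib_left)

lemma bounded_bilinear_matrix_vector_mult: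
  "bounded_bilinear ((*v) :: real^'n^'m \<Rightarrow> real^'n \<Rightarrow> real^'m)"
  by (intro bilinear_conv_bounded_bilinear[THEN iffD1])
    (auto simp: bilinear_def linear_iff matrix_vector_mult_def vec_eq_iff sum.distrib algebra_simps sum_distrib_left)

lemmas smooth_on_matrix_mult = smooth_on_bilinear[OF _ bounded_bilinear_matrix_matrix_mult]
lemmas smooth_on_matrix_vector_mult = smooth_on_bilinear[OF _ bounded_bilinear_matrix_vector_mult]

section \<open>Elementary functions and a smooth step\<close>

lemma smooth_on_exp: "smooth_on UNIV (exp :: real \<Rightarrow> real)"
proof (rule smooth_onI)
  show "C_k_on k UNIV (exp :: real \<Rightarrow> real)" for k
  proof (induction k)
    case (Suc k)
    show ?case
      by (rule C_k_on_SucI[of _ _ "\<lambda>x w. exp x * w"])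
        (auto intro!: C_k_on_bilinear[OF _ bounded_bilinear_mult] Suc C_k_on_const derivative_eq_intros)
  qed (auto intro: continuous_intros)
qed

lemma smooth_on_cos: "smooth_on UNIV (cos :: real \<Rightarrow> real)"
proof -
  have "C_k_on k UNIV (sin :: real \<Rightarrow> real) \<and> C_k_on k UNIV (cos :: real \<Rightarrow> real)" for k
  proof (induction k)
    case (Suc k)
    have "C_k_on k UNIV (\<lambda>x::real. - sin x)"
      using Suc C_k_on_bounded_linear_comp[OF _ bounded_linear_minus[OF bounded_linear_ident]] by blast
    note neg = this
    have "C_k_on (Suc k) UNIV (sin :: real \<Rightarrow> real)"
      by (rule C_k_on_SucI[of _ _ "\<lambda>x w. cos x * w"])
        (use Suc in \<open>auto intro!: C_k_on_bilinear[OF _ bounded_bilinear_mult] C_k_on_const derivative_eq_intros\<close>)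
    moreover have "C_k_on (Suc k) UNIV (cos :: real \<Rightarrow> real)"
    proof (rule C_k_on_SucI[of _ _ "\<lambda>x w. (- sin x) * w"])
      show "C_k_on k UNIV (\<lambda>x::real. (- sin x) * w)" for w
        by (intro C_k_on_bilinear[OF _ bounded_bilinear_mult] C_k_on_const neg open_UNIV)
    qed (auto intro!: derivative_eq_intros)
    ultimately have "C_k_on (Suc k) UNIV (sin :: real \<Rightarrow> real) \<and> C_k_on (Suc k) UNIV (cos :: real \<Rightarrow> real)" ..
    then show ?case .
  qed (auto intro: continuous_intros)
  then show ?thesis by (auto intro: smooth_onI)
qed

lemma smooth_on_inverse:
  fixes f :: "'a::real_normed_vector \<Rightarrow> real"
  assumes "open S" "smooth_on S f" "\<And>x. x \<in> S \<Longrightarrow> f x \<noteq> 0"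
  shows "smooth_on S (\<lambda>x. inverse (f x))"
proof -
  have "C_k_on k (-{0}) (inverse :: real \<Rightarrow> real)" for k
  proof (induction k)
    case (Suc k)
    have *: "C_k_on k (-{0::real}) (\<lambda>x. (- w) * (inverse x * inverse x))" for w
      by (intro C_k_on_bilinear[OF _ bounded_bilinear_mult] C_k_on_const Suc) auto
    show ?case
      by (rule C_k_on_SucI[of _ _ "\<lambda>x w. (- w) * (inverse x * inverse x)"]; (rule *)?)
        (auto intro!: derivative_eq_intros simp: algebra_simps power2_eq_square)
  qed (auto intro!: continuous_intros)
  then have "smooth_on (-{0}) (inverse :: real \<Rightarrow> real)" by (rule smooth_onI)
  then show ?thesis
    by (rule smooth_on_compose[OF assms(1) _ _ assms(2), rotated 2]) (use assms(3) in \<open>auto simp: open_Compl\<close>)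
qed

lemma smooth_on_divide:
  fixes f g :: "'a::real_normed_vector \<Rightarrow> real"
  assumes "open S" "smooth_on S f" "smooth_on S g" "\<And>x. x \<in> S \<Longrightarrow> g x \<noteq> 0"
  shows "smooth_on S (\<lambda>x. f x / g x)"
  unfolding divide_inverse by (intro smooth_on_mult smooth_on_inverse assms)

text \<open>The flat functions p(1/t) exp(-1/t), extended by zero. Carrying a polynomial along makes
  the family closed under differentiation, so that one induction proves all members smooth at
  once.\<close>

definition exp_tail :: "real poly \<Rightarrow> real \<Rightarrow> real" where
  "exp_tail p t = (if t \<le> 0 then 0 else poly p (1/t) * exp (- (1/t)))"

lemma tendsto_poly_exp_neg: "((\<lambda>u. poly p u * exp (- u)) \<longlongrightarrow> 0) (at_top :: real filter)"
proof -
  have "((\<lambda>u. \<Sum>i\<le>degree p. coeff p i * (u ^ i / exp u)) \<longlongrightarrow> (\<Sum>i\<le>degree p. coeff p i * 0)) (at_top :: real filter)"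
    by (intro tendsto_sum tendsto_mult tendsto_const tendsto_power_div_exp_0)
  then show ?thesis
    by (simp add: poly_altdef exp_minus divide_inverse sum_distrib_right mult.assoc)
qed

text \<open>With u = 1/t one has d/dt = - u^2 d/du, whence the new polynomial u^2 (p - p'). At
  \<open>t = 0\<close> the difference quotient from the right is u p(u) exp(-u), which tends to
  zero.\<close>

lemma has_derivative_exp_tail:
  "(exp_tail p has_real_derivative exp_tail ([:0,0,1:] * (p - pderiv p)) t) (at t)"
proof -
  consider "t < 0" | "t > 0" | "t = 0" by linarith
  then show ?thesis
  proof cases
    case 1
    have "((\<lambda>_. 0) has_real_derivative 0) (at t)" by simp
    then have "(exp_tail p has_real_derivative 0) (at t)"
      by (rule DERIV_cong_ev[OF refl _ refl, THEN iffD1, rotated])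
        (use 1 in \<open>auto simp: exp_tail_def eventually_nhds intro!: exI[of _ "{..<0}"]\<close>)
    then show ?thesis using 1 by (simp add: exp_tail_def)
  next
    case 2
    have "((\<lambda>t. poly p (1/t) * exp (- (1/t))) has_real_derivative
        exp_tail ([:0,0,1:] * (p - pderiv p)) t) (at t)"
      using 2
      by (auto intro!: derivative_eq_intros DERIV_chain'[OF _ poly_DERIV, of "\<lambda>t. 1/t"] simp: exp_tail_def field_simps power2_eq_square)
    then show ?thesis
      by (rule DERIV_cong_ev[OF refl _ refl, THEN iffD1, rotated])
        (use 2 in \<open>auto simp: exp_tail_def eventually_nhds intro!: exI[of _ "{0<..}"]\<close>)
  next
    case 3
    have "((\<lambda>h. poly ([:0,1:] * p) (inverse h) * exp (- inverse h)) \<longlongrightarrow> 0) (at_right 0)"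
      using filterlim_compose[OF tendsto_poly_exp_neg filterlim_inverse_at_top_right] .
    then have r: "((\<lambda>h. exp_tail p h / h) \<longlongrightarrow> 0) (at_right 0)"
      by (rule Lim_transform_eventually)
        (auto simp: eventually_at_right_field exp_tail_def field_simps intro!: exI[of _ 1])
    have "((\<lambda>h::real. 0) \<longlongrightarrow> 0) (at_left 0)" by simp
    then have "((\<lambda>h. exp_tail p h / h) \<longlongrightarrow> 0) (at_left 0)"
      by (rule Lim_transform_eventually)
        (auto simp: eventually_at_left_field exp_tail_def intro!: exI[of _ "-1"])
    with r have "((\<lambda>h. exp_tail p h / h) \<longlongrightarrow> 0) (at 0)" by (simp add: filterlim_split_at_real)
    then show ?thesis using 3 by (simp add: DERIV_def exp_tail_def)
  qed
qed

lemma smooth_on_exp_tail: "smooth_on UNIV (exp_tail p)"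
proof (rule smooth_onI)
  show "C_k_on k UNIV (exp_tail p)" for k
  proof (induction k arbitrary: p)
    case 0
    show ?case using has_derivative_exp_tail
      by (auto intro!: continuous_at_imp_continuous_on intro: DERIV_isCont)
  next
    case (Suc k)
    show ?case
      by (rule C_k_on_SucI[of _ _ "\<lambda>t w. exp_tail ([:0,0,1:] * (p - pderiv p)) t * w"])
        (use has_derivative_exp_tail in \<open>auto intro!: C_k_on_bilinear[OF _ bounded_bilinear_mult] C_k_on_const Suc
          simp: has_field_derivative_def mult_commute_abs simp del: mult_pCons_left\<close>)
  qed
qed

text \<open>The plateaus up to 1/3 and from 2/3 on, rather than mere values 0 and 1 at the ends, let
  paths built from this function be glued at integer times without loss of smoothness.\<close>

lemma smooth_step_exists:
  obtains \<sigma> :: "real \<Rightarrow> real" where "smooth_on UNIV \<sigma>" "\<And>t. t \<le> 1/3 \<Longrightarrow> \<sigma> t = 0" "\<And>t. t \<ge> 2/3 \<Longrightarrow> \<sigma> t = 1"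
proof
  define F where "F = exp_tail 1"
  have F: "smooth_on UNIV F" by (simp add: F_def smooth_on_exp_tail)
  have F0: "F t \<ge> 0" "t \<le> 0 \<Longrightarrow> F t = 0" "t > 0 \<Longrightarrow> F t > 0" for t by (auto simp: F_def exp_tail_def)
  let ?\<sigma> = "\<lambda>t. F (3*t-1) / (F (3*t-1) + F (2-3*t))"
  \<comment> \<open>The two arguments add up to 1, so at least one of them is positive and the
    denominator cannot vanish.\<close>
  have pos: "F (3*t-1) + F (2-3*t) \<noteq> 0" for t
    using F0(1)[of "3*t-1"] F0(1)[of "2-3*t"] F0(3)[of "3*t-1"] F0(3)[of "2-3*t"] by (cases "t > 1/3") auto
  show "smooth_on UNIV ?\<sigma>"
    by (intro smooth_on_divide smooth_on_add smooth_on_compose_UNIV[OF _ F] smooth_on_diff smooth_on_mult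
        smooth_on_const smooth_on_ident open_UNIV pos)
  show "?\<sigma> t = 0" if "t \<le> 1/3" for t using that F0(2)[of "3*t-1"] by simp
  show "?\<sigma> t = 1" if "t \<ge> 2/3" for t using that F0(2)[of "2-3*t"] F0(3)[of "3*t-1"] by simp
qed

section \<open>Length, distance and completeness\<close>

lemma riemannian_metric_continuous_on: "riemannian_metric g \<Longrightarrow> continuous_on S g"
  unfolding riemannian_metric_def using smooth_on_imp_continuous_on continuous_on_subset by blast

lemma rnorm_scaleR: "rnorm g x (c *\<^sub>R w) = \<bar>c\<bar> * rnorm g x w"
proof -
  have "(c *\<^sub>R w) \<bullet> (g x *v (c *\<^sub>R w)) = c\<^sup>2 * (w \<bullet> (g x *v w))"
    by (simp add: power2_eq_square matrix_vector_mult_scaleR)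
  then show ?thesis by (simp add: rnorm_def real_sqrt_mult)
qed

lemma rnorm_pos: "riemannian_metric g \<Longrightarrow> w \<noteq> 0 \<Longrightarrow> rnorm g x w > 0"
  by (simp add: riemannian_metric_def rnorm_def)

lemma rnorm_nonneg: "riemannian_metric g \<Longrightarrow> rnorm g x w \<ge> 0"
  using rnorm_pos[of g w x] by (cases "w = 0") (auto simp: rnorm_def)

lemma speed_nonneg: "riemannian_metric g \<Longrightarrow> speed g \<gamma> t \<ge> 0"
  by (simp add: speed_def rnorm_nonneg)

lemma continuous_on_rnorm:
  assumes "riemannian_metric g" "continuous_on S f" "continuous_on S h"
  shows "continuous_on S (\<lambda>x. rnorm g (f x) (h x))"
proof -
  have "continuous_on S (\<lambda>x. g (f x))"
    using riemannian_metric_continuous_on[OF assms(1), of UNIV] assms(2)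
    by (auto intro: continuous_on_compose2)
  then show ?thesis unfolding rnorm_def
    by (intro continuous_intros assms bounded_bilinear.continuous_on[OF bounded_bilinear_matrix_vector_mult])
qed

lemmas continuous_on_matrix_vector_mult = bounded_bilinear.continuous_on[OF bounded_bilinear_matrix_vector_mult]

text \<open>Homogeneity reduces the comparison with the Euclidean norm to the product of
  \<open>K\<close> with the unit sphere, where a positive continuous function attains its
  extrema.\<close>

lemma rnorm_compact_bounds:
  fixes K :: "(real^'n) set"
  assumes g: "riemannian_metric g" and K: "compact K"
  obtains m M where "m > 0" "M > 0" "\<And>x w. x \<in> K \<Longrightarrow> m * norm w \<le> rnorm g x w"
    "\<And>x w. x \<in> K \<Longrightarrow> rnorm g x w \<le> M * norm w"
proof (cases "K = {}")
  case True
  then show ?thesis using that[of 1 1] by auto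
next
  case False
  let ?S = "K \<times> sphere (0::real^'n) 1" and ?q = "\<lambda>z. rnorm g (fst z) (snd z)"
  have S: "compact ?S" by (intro compact_Times K compact_sphere)
  have ne: "?S \<noteq> {}" using False by auto
  have cont: "continuous_on ?S ?q" by (intro continuous_on_rnorm g continuous_intros)
  obtain a where a: "a \<in> ?S" "\<And>z. z \<in> ?S \<Longrightarrow> ?q a \<le> ?q z"
    using continuous_attains_inf[OF S ne cont] by auto
  obtain b where b: "b \<in> ?S" "\<And>z. z \<in> ?S \<Longrightarrow> ?q z \<le> ?q b"
    using continuous_attains_sup[OF S ne cont] by auto
  have pos: "?q a > 0" using a(1) by (intro rnorm_pos[OF g]) auto
  have bd: "?q a * norm w \<le> rnorm g x w \<and> rnorm g x w \<le> ?q b * norm w" if "x \<in> K" for x w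
  proof (cases "w = 0")
    case False
    have "rnorm g x w = norm w * rnorm g x (w /\<^sub>R norm w)"
      using rnorm_scaleR[of g x "norm w" "w /\<^sub>R norm w"] False by simp
    moreover have "(x, w /\<^sub>R norm w) \<in> ?S" using that False by simp
    ultimately show ?thesis using a(2) b(2) by (force simp: mult.commute intro: mult_left_mono)
  qed (auto simp: rnorm_def)
  show ?thesis
  proof (rule that[of "?q a" "?q b"])
    show "?q b > 0" using pos b(2)[OF a(1)] by linarith
  qed (use pos bd in auto)
qed

section \<open>Paths of finite length and the distance they define\<close>

definition finite_length_path :: "(real^'n \<Rightarrow> real^'n^'n) \<Rightarrow> (real \<Rightarrow> real^'n) \<Rightarrow> bool" where
  "finite_length_path g \<gamma> \<longleftrightarrow> valid_path \<gamma> \<and> speed g \<gamma> integrable_on {0..1}"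

text \<open>A stand-in for the infimum in \<open>rdist\<close>: through \<open>rdist_le\<close> and
  \<open>rdist_less\<close> distances are estimated by single paths, and the relation behaves well
  under reversal and concatenation.\<close>

definition path_length_le :: "(real^'n \<Rightarrow> real^'n^'n) \<Rightarrow> real^'n \<Rightarrow> real^'n \<Rightarrow> real \<Rightarrow> bool" where
  "path_length_le g x y L \<longleftrightarrow> (\<exists>\<gamma>. finite_length_path g \<gamma> \<and> pathstart \<gamma> = x \<and> pathfinish \<gamma> = y \<and>
     integral {0..1} (speed g \<gamma>) \<le> L)"

lemma path_length_leI:
  "valid_path \<gamma> \<Longrightarrow> (speed g \<gamma> has_integral I) {0..1} \<Longrightarrow> I \<le> L \<Longrightarrow> pathstart \<gamma> = x \<Longrightarrow> pathfinish \<gamma> = y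
    \<Longrightarrow> path_length_le g x y L"
  unfolding path_length_le_def finite_length_path_def has_integral_iff by blast

lemma path_length_leE:
  assumes "path_length_le g x y L"
  obtains \<gamma> where "valid_path \<gamma>" "speed g \<gamma> integrable_on {0..1}" "pathstart \<gamma> = x" "pathfinish \<gamma> = y"
    "integral {0..1} (speed g \<gamma>) \<le> L"
  using assms unfolding path_length_le_def finite_length_path_def by blast

lemma valid_path_vector_derivative:
  assumes "valid_path \<gamma>"
  obtains S where "finite S" "\<And>t. t \<in> {0..1} - S \<Longrightarrow> (\<gamma> has_vector_derivative vector_derivative \<gamma> (at t)) (at t)"
    "continuous_on ({0..1} - S) (\<lambda>t. vector_derivative \<gamma> (at t))"
  using assms unfolding valid_path_def piecewise_C1_differentiable_on_def C1_differentiable_on_eq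
  by (metis vector_derivative_works)

lemma valid_path_affine:
  assumes "valid_path \<gamma>"
  shows "valid_path (\<lambda>t. affine_map B b (\<gamma> t))"
proof -
  obtain S D where S: "continuous_on {0..1} \<gamma>" "finite S" "continuous_on ({0..1} - S) D"
    "\<And>t. t \<in> {0..1} - S \<Longrightarrow> (\<gamma> has_vector_derivative D t) (at t)"
    using assms unfolding valid_path_def piecewise_C1_differentiable_on_def C1_differentiable_on_def by blast
  have 1: "((\<lambda>t. affine_map B b (\<gamma> t)) has_vector_derivative B *v D t) (at t)" if "t \<in> {0..1} - S" for t
    unfolding affine_map_def
    by (rule has_vector_derivative_eq_rhs, rule has_vector_derivative_add[OF
        bounded_linear.has_vector_derivative[OF matrix_vector_mul_bounded_linear S(4)[OF that]]
        has_vector_derivative_const]) simp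
  have 2: "continuous_on ({0..1} - S) (\<lambda>t. B *v D t)"
    by (rule continuous_on_matrix_vector_mult[OF continuous_on_const S(3)])
  have 3: "continuous_on {0..1} (\<lambda>t. affine_map B b (\<gamma> t))"
    unfolding affine_map_def
    by (intro continuous_on_add continuous_on_matrix_vector_mult[OF continuous_on_const S(1)] continuous_on_const)
  show ?thesis
    unfolding valid_path_def piecewise_C1_differentiable_on_def C1_differentiable_on_def
    by (intro conjI 3 exI[of _ S] exI[of _ "\<lambda>t. B *v D t"] 2 S(2)) (use 1 in auto)
qed

text \<open>The fundamental theorem of calculus for \<open>F\<close> along the path, off the
  finitely many exceptional parameters. The hypotheses concern only the stretch from
  \<open>a\<close> to \<open>b\<close>, so the bound is usable where the estimate on
  \<open>F'\<close> holds on a part of the path.\<close>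

lemma path_Lipschitz_bound:
  fixes F :: "real^'n \<Rightarrow> 'c::banach"
  assumes g: "riemannian_metric g" and \<gamma>: "finite_length_path g \<gamma>"
    and ab: "0 \<le> a" "a \<le> b" "b \<le> 1" and M: "M \<ge> 0"
    and F: "\<And>t. t \<in> {a..b} \<Longrightarrow> (F has_derivative F' (\<gamma> t)) (at (\<gamma> t))"
    and le: "\<And>t w. t \<in> {a..b} \<Longrightarrow> norm (F' (\<gamma> t) w) \<le> M * rnorm g (\<gamma> t) w"
  shows "norm (F (\<gamma> b) - F (\<gamma> a)) \<le> M * integral {0..1} (speed g \<gamma>)"
proof -
  have sub: "{a..b} \<subseteq> {0..1}" using ab by auto
  have vp: "valid_path \<gamma>" and int: "speed g \<gamma> integrable_on {0..1}"
    using \<gamma> by (auto simp: finite_length_path_def)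
  obtain S where S: "finite S" "\<And>t. t \<in> {0..1} - S \<Longrightarrow> (\<gamma> has_vector_derivative vector_derivative \<gamma> (at t)) (at t)"
    using valid_path_vector_derivative[OF vp] by metis
  have cont: "continuous_on {a..b} \<gamma>"
    using vp sub by (auto simp: valid_path_def piecewise_C1_differentiable_on_def intro: continuous_on_subset)
  let ?D = "\<lambda>t. F' (\<gamma> t) (vector_derivative \<gamma> (at t))"
  have "(?D has_integral (F (\<gamma> b) - F (\<gamma> a))) {a..b}"
  proof (rule fundamental_theorem_of_calculus_interior_strong[OF S(1) ab(2)])
    show "((\<lambda>t. F (\<gamma> t)) has_vector_derivative ?D t) (at t)" if "t \<in> {a<..<b} - S" for t
    proof -
      have t: "t \<in> {a..b}" "t \<in> {0..1} - S" using that ab by auto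
      from has_derivative_compose[OF S(2)[OF t(2), unfolded has_vector_derivative_def] F[OF t(1)]]
      show ?thesis using has_derivative_linear[OF F[OF t(1)]]
        by (simp add: has_vector_derivative_def linear_cmul)
    qed
    have "continuous (at x within {a..b}) (\<lambda>t. F (\<gamma> t))" if "x \<in> {a..b}" for x
    proof -
      have "isCont F (\<gamma> x)" using has_derivative_continuous[OF F[OF that]] .
      moreover have "(\<gamma> \<longlongrightarrow> \<gamma> x) (at x within {a..b})"
        using cont that by (auto simp: continuous_on_def)
      ultimately have "((\<lambda>t. F (\<gamma> t)) \<longlongrightarrow> F (\<gamma> x)) (at x within {a..b})"
        by (rule isCont_tendsto_compose)
      then show ?thesis by (simp add: continuous_within)
    qed
    then show "continuous_on {a..b} (\<lambda>t. F (\<gamma> t))" by (simp add: continuous_on_eq_continuous_within)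
  qed
  then have D: "?D integrable_on {a..b}" "integral {a..b} ?D = F (\<gamma> b) - F (\<gamma> a)"
    by (auto simp: has_integral_iff)
  have int_ab: "speed g \<gamma> integrable_on {a..b}"
    using integrable_on_subinterval[OF int sub] .
  have "norm (integral {a..b} ?D) \<le> integral {a..b} (\<lambda>t. M * speed g \<gamma> t)"
  proof (rule integral_norm_bound_integral[OF D(1)])
    show "(\<lambda>t. M * speed g \<gamma> t) integrable_on {a..b}" using integrable_on_mult_right[OF int_ab] .
    show "norm (?D t) \<le> M * speed g \<gamma> t" if "t \<in> {a..b}" for t
      using le[OF that] by (simp add: speed_def)
  qed
  then have "norm (F (\<gamma> b) - F (\<gamma> a)) \<le> integral {a..b} (\<lambda>t. M * speed g \<gamma> t)"
    by (simp add: D(2))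
  also have "\<dots> = M * integral {a..b} (speed g \<gamma>)" by simp
  also have "\<dots> \<le> M * integral {0..1} (speed g \<gamma>)"
    using integral_subset_le[OF sub int_ab int] speed_nonneg[OF g] M by (intro mult_left_mono) auto
  finally show ?thesis .
qed

lemma speed_affine_reparam:
  assumes "\<gamma> differentiable at (m * t + c)"
  shows "speed g (\<lambda>t. \<gamma> (m * t + c)) t = \<bar>m\<bar> * speed g \<gamma> (m * t + c)"
proof -
  have "((\<lambda>t. m * t + c) has_vector_derivative m) (at t)"
    by (auto simp: has_vector_derivative_def intro!: derivative_eq_intros)
  from vector_diff_chain_at[OF this, of \<gamma> "vector_derivative \<gamma> (at (m * t + c))"] assms
  have "((\<lambda>t. \<gamma> (m * t + c)) has_vector_derivative m *\<^sub>R vector_derivative \<gamma> (at (m * t + c))) (at t)"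
    by (simp add: vector_derivative_works o_def)
  then show ?thesis by (simp add: speed_def rnorm_scaleR vector_derivative_at)
qed

lemma speed_cong:
  assumes "eventually (\<lambda>s. \<gamma> s = \<delta> s) (nhds t)"
  shows "speed g \<gamma> t = speed g \<delta> t"
  using vector_derivative_cong_eq[where f = \<gamma> and g = \<delta> and x = t and y = t and A = UNIV and B = UNIV] assms
    eventually_nhds_x_imp_x[OF assms]
  by (simp add: speed_def)

lemma path_length_le_sym:
  assumes "path_length_le g x y L"
  shows "path_length_le g y x L"
proof -
  obtain \<gamma> where \<gamma>: "valid_path \<gamma>" "speed g \<gamma> integrable_on {0..1}" "pathstart \<gamma> = x" "pathfinish \<gamma> = y"
    "integral {0..1} (speed g \<gamma>) \<le> L"
    using path_length_leE[OF assms] .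
  obtain S where S: "finite S" "\<And>t. t \<in> {0..1} - S \<Longrightarrow> (\<gamma> has_vector_derivative vector_derivative \<gamma> (at t)) (at t)"
    using valid_path_vector_derivative[OF \<gamma>(1)] by metis
  have "((\<lambda>t. speed g \<gamma> (-1 * t + 1)) has_integral integral {0..1} (speed g \<gamma>)) {0..1}"
    using has_integral_affinity01[OF integrable_integral[OF \<gamma>(2)], of "-1" 1] by simp
  then have "(speed g (reversepath \<gamma>) has_integral integral {0..1} (speed g \<gamma>)) {0..1}"
  proof (rule has_integral_spike_finite[rotated 2])
    show "finite ((\<lambda>t. 1 - t) ` S)" using S by simp
    show "speed g (reversepath \<gamma>) t = speed g \<gamma> (-1 * t + 1)" if "t \<in> {0..1} - (\<lambda>t. 1 - t) ` S" for t
    proof -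
      have "1 - t \<notin> S" using that by force
      then have "\<gamma> differentiable at (-1 * t + 1)"
        using S(2)[of "1 - t"] that by (auto simp: has_vector_derivative_def differentiable_def)
      from speed_affine_reparam[OF this, of g] show ?thesis by (simp add: reversepath_def)
    qed
  qed
  then show ?thesis by (rule path_length_leI[rotated]) (use \<gamma> in auto)
qed

lemma path_length_le_trans:
  assumes "path_length_le g x y L1" "path_length_le g y z L2"
  shows "path_length_le g x z (L1 + L2)"
proof -
  obtain \<gamma> where \<gamma>: "valid_path \<gamma>" "speed g \<gamma> integrable_on {0..1}" "pathstart \<gamma> = x" "pathfinish \<gamma> = y"
    "integral {0..1} (speed g \<gamma>) \<le> L1"
    using path_length_leE[OF assms(1)] .
  obtain \<delta> where \<delta>: "valid_path \<delta>" "speed g \<delta> integrable_on {0..1}" "pathstart \<delta> = y" "pathfinish \<delta> = z"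
    "integral {0..1} (speed g \<delta>) \<le> L2"
    using path_length_leE[OF assms(2)] .
  obtain S where S: "finite S" "\<And>t. t \<in> {0..1} - S \<Longrightarrow> \<gamma> differentiable at t"
    using \<gamma>(1) by (auto simp: valid_path_def piecewise_C1_differentiable_on_def C1_differentiable_on_eq)
  obtain T where T: "finite T" "\<And>t. t \<in> {0..1} - T \<Longrightarrow> \<delta> differentiable at t"
    using \<delta>(1) by (auto simp: valid_path_def piecewise_C1_differentiable_on_def C1_differentiable_on_eq)
  have "((\<lambda>t. 2 * speed g \<gamma> (2 * t)) has_integral integral {0..1} (speed g \<gamma>)) {0..1/2}"
    using has_integral_affinity01[OF integrable_integral[OF \<gamma>(2)], of 2 0, THEN has_integral_mult_right, of 2] 
    by (simp add: image_affinity_atLeastAtMost_div_diff)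
  then have 1: "(speed g (\<gamma> +++ \<delta>) has_integral integral {0..1} (speed g \<gamma>)) {0..1/2}"
  proof (rule has_integral_spike_finite[rotated 2])
    let ?S = "insert (1/2) ((\<lambda>t. t / 2) ` S)"
    show "finite ?S" using S by simp
    show "speed g (\<gamma> +++ \<delta>) t = 2 * speed g \<gamma> (2 * t)" if "t \<in> {0..1/2} - ?S" for t
    proof -
      have "2 * t \<notin> S"
      proof
        assume "2 * t \<in> S"
        then have "2 * t / 2 \<in> (\<lambda>t. t / 2) ` S" by blast
        then show False using that by simp
      qed
      moreover have "t < 1/2" using that by auto
      ultimately have "\<gamma> differentiable at (2 * t + 0)"
        using S(2)[of "2 * t"] that by auto
      from speed_affine_reparam[OF this, of g] have "speed g (\<lambda>t. \<gamma> (2 * t)) t = 2 * speed g \<gamma> (2 * t)" by simp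
      moreover have "eventually (\<lambda>s. (\<gamma> +++ \<delta>) s = \<gamma> (2 * s)) (nhds t)"
        unfolding eventually_nhds using \<open>t < 1/2\<close>
        by (auto intro!: exI[of _ "{..<1/2}"] simp: joinpaths_def)
      ultimately show ?thesis using speed_cong by metis
    qed
  qed
  have img: "(\<lambda>t. t / 2 + 1 / 2) ` {0..1::real} = {1/2..1}"
    using image_affinity_atLeastAtMost[of "1/2" "1/2" 0 "1::real"] by simp
  have "((\<lambda>t. 2 * speed g \<delta> (2 * t + (-1))) has_integral integral {0..1} (speed g \<delta>)) {1/2..1}"
    using has_integral_affinity01[OF integrable_integral[OF \<delta>(2)], of 2 "-1", THEN has_integral_mult_right, of 2] 
    by (simp add: img)
  then have 2: "(speed g (\<gamma> +++ \<delta>) has_integral integral {0..1} (speed g \<delta>)) {1/2..1}"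
  proof (rule has_integral_spike_finite[rotated 2])
    let ?S = "insert (1/2) ((\<lambda>t. (t + 1) / 2) ` T)"
    show "finite ?S" using T by simp
    show "speed g (\<gamma> +++ \<delta>) t = 2 * speed g \<delta> (2 * t + (-1))" if "t \<in> {1/2..1} - ?S" for t
    proof -
      have "2 * t + (-1) \<notin> T"
      proof
        assume "2 * t + (-1) \<in> T"
        then have "(2 * t + (-1) + 1) / 2 \<in> (\<lambda>t. (t + 1) / 2) ` T" by blast
        then show False using that by simp
      qed
      moreover have t: "t > 1/2" using that by auto
      ultimately have "\<delta> differentiable at (2 * t + (-1))"
        using T(2)[of "2 * t + (-1)"] that by auto
      from speed_affine_reparam[OF this, of g]
      have "speed g (\<lambda>t. \<delta> (2 * t + (-1))) t = 2 * speed g \<delta> (2 * t + (-1))" by simp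
      moreover have "eventually (\<lambda>s. (\<gamma> +++ \<delta>) s = \<delta> (2 * s + (-1))) (nhds t)"
        unfolding eventually_nhds using t
        by (auto intro!: exI[of _ "{1/2<..}"] simp: joinpaths_def)
      ultimately show ?thesis using speed_cong by metis
    qed
  qed
  have "(speed g (\<gamma> +++ \<delta>) has_integral integral {0..1} (speed g \<gamma>) + integral {0..1} (speed g \<delta>)) {0..1}"
    by (rule has_integral_combine[OF _ _ 1 2]) auto
  then show ?thesis by (rule path_length_leI[rotated]) (use \<gamma> \<delta> valid_path_join[OF \<gamma>(1) \<delta>(1)] in simp_all)
qed

lemma path_length_le_line:
  assumes g: "riemannian_metric g" and le: "\<And>z w. z \<in> closed_segment x y \<Longrightarrow> rnorm g z w \<le> M * norm w"
  shows "path_length_le g x y (M * norm (y - x))"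
proof -
  have sp: "speed g (linepath x y) = (\<lambda>t. rnorm g (linepath x y t) (y - x))"
    by (auto simp: speed_def vector_derivative_linepath_at)
  have cont: "continuous_on {0..1} (speed g (linepath x y))"
    unfolding sp by (intro continuous_on_rnorm g continuous_intros)
  have "integral {0..1} (speed g (linepath x y)) \<le> integral {0..1} (\<lambda>t::real. M * norm (y - x))"
    by (intro integral_le integrable_continuous_interval cont continuous_intros)
      (auto simp: sp linepath_in_path intro!: le)
  then show ?thesis
    by (intro path_length_leI[OF _ integrable_integral[OF integrable_continuous_interval[OF cont]]]) auto
qed

lemma path_length_le_exists:
  assumes "riemannian_metric g"
  obtains L where "path_length_le g x y L"
  by (rule rnorm_compact_bounds[OF assms compact_segment[of x y]]) (metis path_length_le_line[OF assms])

lemma path_length_le_nonneg: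
  assumes "riemannian_metric g" "path_length_le g x y L"
  shows "L \<ge> 0"
  using path_length_leE[OF assms(2)] integral_nonneg[of "speed g _" "{0..1}"] speed_nonneg[OF assms(1)] order_trans
  by metis

lemma rdist_le:
  assumes "riemannian_metric g" "path_length_le g x y L"
  shows "rdist g x y \<le> L"
proof -
  obtain \<gamma> where \<gamma>: "valid_path \<gamma>" "speed g \<gamma> integrable_on {0..1}" "pathstart \<gamma> = x" "pathfinish \<gamma> = y"
    and le: "integral {0..1} (speed g \<gamma>) \<le> L"
    using path_length_leE[OF assms(2)] .
  have "rdist g x y \<le> integral {0..1} (speed g \<gamma>)"
    unfolding rdist_def using \<gamma> speed_nonneg[OF assms(1)]
    by (intro cInf_lower bdd_belowI[of _ 0]) (auto intro!: integral_nonneg)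
  with le show ?thesis by simp
qed

lemma rdist_less:
  assumes g: "riemannian_metric g" and "rdist g x y < L"
  shows "path_length_le g x y L"
proof -
  obtain L' where "path_length_le g x y L'" using path_length_le_exists[OF g] .
  then have "{integral {0..1} (speed g \<gamma>) | \<gamma>.
     valid_path \<gamma> \<and> pathstart \<gamma> = x \<and> pathfinish \<gamma> = y \<and> speed g \<gamma> integrable_on {0..1}} \<noteq> {}"
    by (auto simp: path_length_le_def finite_length_path_def)
  from cInf_lessD[OF this assms(2)[unfolded rdist_def]] show ?thesis
    by (force simp: path_length_le_def finite_length_path_def)
qed

lemma rdist_geI:
  assumes "riemannian_metric g" "\<And>L. path_length_le g x y L \<Longrightarrow> r \<le> L"
  shows "r \<le> rdist g x y"
  by (rule ccontr) (metis assms dense not_le rdist_less)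

text \<open>Either the path stays in the ball, and its Euclidean displacement is controlled
  directly, or it stays there until it first meets the sphere of radius \<open>r\<close>, having by
  then covered the distance \<open>r\<close>. This is what makes \<open>rdist\<close> separate
  points.\<close>

lemma path_length_le_ge_min:
  assumes g: "riemannian_metric g" and r: "r > 0" "m > 0"
    and le: "\<And>z w. z \<in> cball x r \<Longrightarrow> m * norm w \<le> rnorm g z w"
    and L: "path_length_le g x y L"
  shows "m * min r (dist x y) \<le> L"
proof -
  obtain \<gamma> where \<gamma>: "finite_length_path g \<gamma>" "pathstart \<gamma> = x" "pathfinish \<gamma> = y"
    and le': "integral {0..1} (speed g \<gamma>) \<le> L"
    using L unfolding path_length_le_def by blast
  have cont: "continuous_on {0..1} \<gamma>"
    using \<gamma>(1) by (auto simp: finite_length_path_def valid_path_def piecewise_C1_differentiable_on_def)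
  have bd: "m * dist x (\<gamma> b) \<le> L" if b: "b \<in> {0..1}" and in_ball: "\<And>t. t \<in> {0..b} \<Longrightarrow> \<gamma> t \<in> cball x r" for b
  proof -
    have "norm (\<gamma> b - \<gamma> 0) \<le> inverse m * integral {0..1} (speed g \<gamma>)"
    proof (rule path_Lipschitz_bound[OF g \<gamma>(1), of 0 b "inverse m" "\<lambda>x. x" "\<lambda>x w. w"])
      show "norm w \<le> inverse m * rnorm g (\<gamma> t) w" if "t \<in> {0..b}" for t w
        using le[OF in_ball[OF that], of w] r by (simp add: field_simps)
    qed (use b r in \<open>auto intro: has_derivative_ident\<close>)
    moreover have "\<gamma> 0 = x" using \<gamma>(2) by (simp add: pathstart_def)
    ultimately show ?thesis using le' r by (simp add: field_simps dist_norm norm_minus_commute)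
  qed
  show ?thesis
  proof (cases "\<forall>t\<in>{0..1}. \<gamma> t \<in> cball x r")
    case True
    then have "m * dist x y \<le> L" using bd[of 1] \<gamma>(3) by (simp add: pathfinish_def)
    moreover have "m * min r (dist x y) \<le> m * dist x y" using r by (intro mult_left_mono) auto
    ultimately show ?thesis by linarith
  next
    case False
    then obtain c where c: "c \<in> {0..1}" "dist x (\<gamma> c) > r" by auto
    have cont': "continuous_on {0..1} (\<lambda>t. dist x (\<gamma> t))" by (intro continuous_intros cont)
    define A where "A = {t\<in>{0..1}. dist x (\<gamma> t) = r}"
    have "compact A" unfolding A_def
      using continuous_closed_preimage_constant[OF cont' closed_atLeastAtMost]
      by (auto simp: compact_eq_bounded_closed intro: bounded_subset[of "{0..1}"])
    moreover have "A \<noteq> {}"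
    proof -
      have "continuous_on {0..c} (\<lambda>t. dist x (\<gamma> t))" using continuous_on_subset[OF cont'] c by auto
      then obtain s where "0 \<le> s" "s \<le> c" "dist x (\<gamma> s) = r"
        using IVT'[of "\<lambda>t. dist x (\<gamma> t)" 0 r c] c r \<gamma>(2) by (auto simp: pathstart_def)
      then have "s \<in> A" using c(1) by (simp add: A_def)
      then show ?thesis by blast
    qed
    \<comment> \<open>The first parameter at which the path meets the sphere.\<close>
    ultimately obtain b where b: "b \<in> A" "\<And>t. t \<in> A \<Longrightarrow> b \<le> t" using compact_attains_inf[of A] by metis
    have "\<gamma> t \<in> cball x r" if t: "t \<in> {0..b}" for t
    proof (rule ccontr)
      assume "\<gamma> t \<notin> cball x r"
      then have far: "r \<le> dist x (\<gamma> t)" by simp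
      have b1: "b \<le> 1" using b(1) by (simp add: A_def)
      have "continuous_on {0..t} (\<lambda>t. dist x (\<gamma> t))" using continuous_on_subset[OF cont'] t b1 by auto
      then obtain s where "0 \<le> s" "s \<le> t" "dist x (\<gamma> s) = r"
        using IVT'[of "\<lambda>t. dist x (\<gamma> t)" 0 r t] r \<gamma>(2) t far by (auto simp: pathstart_def)
      then have "s \<in> A" using t b1 by (simp add: A_def)
      then have "t = b" using b(2)[of s] t \<open>s \<le> t\<close> by simp
      then show False using b(1) \<open>\<gamma> t \<notin> cball x r\<close> by (auto simp: A_def)
    qed
    from bd[OF _ this] have "m * r \<le> L" using b(1) by (auto simp: A_def)
    moreover have "m * min r (dist x y) \<le> m * r" using r by (intro mult_left_mono) auto
    ultimately show ?thesis by linarith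
  qed
qed

lemma Metric_space_rdist:
  assumes g: "riemannian_metric g"
  shows "Metric_space UNIV (rdist g)"
proof
  fix x y z
  have nonneg: "0 \<le> rdist g x y" for x y
    by (rule rdist_geI[OF g], rule path_length_le_nonneg[OF g])
  then show "0 \<le> rdist g x y" .
  have "rdist g x y \<le> rdist g y x" for x y
    by (rule rdist_geI[OF g], rule rdist_le[OF g], rule path_length_le_sym)
  then show "rdist g x y = rdist g y x" by (intro antisym)
  show "rdist g x z \<le> rdist g x y + rdist g y z"
  proof (rule field_le_epsilon)
    fix e :: real assume "e > 0"
    then have "path_length_le g x z ((rdist g x y + e/2) + (rdist g y z + e/2))"
      by (intro path_length_le_trans[of g x y _ z]; intro rdist_less[OF g]) auto
    from rdist_le[OF g this] show "rdist g x z \<le> rdist g x y + rdist g y z + e" by simp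
  qed
  show "rdist g x y = 0 \<longleftrightarrow> x = y"
  proof
    assume 0: "rdist g x y = 0"
    obtain m M where m: "m > 0" "\<And>z w. z \<in> cball x 1 \<Longrightarrow> m * norm w \<le> rnorm g z w"
      using rnorm_compact_bounds[OF g compact_cball[of x 1]] by metis
    have "m * min 1 (dist x y) \<le> rdist g x y"
      by (intro rdist_geI[OF g] path_length_le_ge_min[OF g _ m(1) m(2)]) auto
    with 0 m(1) have "min 1 (dist x y) \<le> 0" by (metis mult_pos_pos not_le)
    then have "dist x y \<le> 0" by linarith
    then show "x = y" by (metis dist_le_zero_iff)
  next
    assume "x = y"
    obtain M where "\<And>z w. z \<in> closed_segment x x \<Longrightarrow> rnorm g z w \<le> M * norm w"
      using rnorm_compact_bounds[OF g compact_segment[of x x]] by metis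
    then have "path_length_le g x x (M * norm (x - x))" by (rule path_length_le_line[OF g])
    then have "path_length_le g x x 0" by simp
    from rdist_le[OF g this] \<open>x = y\<close> show "rdist g x y = 0" using nonneg[of x y] by simp
  qed
qed

text \<open>A Cauchy sequence eventually stays within distance 1 of one of its members, so the
  hypothesis makes its tail bounded in the Euclidean sense, and a subsequence converges there. Near
  the limit \<open>rdist\<close> is dominated by a multiple of the Euclidean distance, so the
  subsequence converges for \<open>rdist\<close> too.\<close>

lemma complete_riemannian_metricI:
  assumes g: "riemannian_metric g"
    and bd: "\<And>p L. \<exists>B. \<forall>\<gamma>. finite_length_path g \<gamma> \<and> pathstart \<gamma> = p \<and> integral {0..1} (speed g \<gamma>) \<le> L
      \<longrightarrow> norm (pathfinish \<gamma>) \<le> B"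
  shows "complete_riemannian_metric g"
proof -
  interpret R: Metric_space UNIV "rdist g" by (rule Metric_space_rdist[OF g])
  have "\<exists>x. limitin R.mtopology \<sigma> x sequentially" if C: "R.MCauchy \<sigma>" for \<sigma>
  proof -
    from C obtain N where N: "\<And>n. n \<ge> N \<Longrightarrow> rdist g (\<sigma> N) (\<sigma> n) < 1"
      unfolding R.MCauchy_def by (metis order_refl zero_less_one)
    obtain B where B: "\<And>\<gamma>. finite_length_path g \<gamma> \<Longrightarrow> pathstart \<gamma> = \<sigma> N \<Longrightarrow>
        integral {0..1} (speed g \<gamma>) \<le> 1 \<Longrightarrow> norm (pathfinish \<gamma>) \<le> B"
      using bd[of "\<sigma> N" 1] by blast
    have "\<sigma> (n + N) \<in> cball 0 B" for n
      using rdist_less[OF g N[of "n + N"]] B unfolding path_length_le_def by (metis le_add2 mem_cball_0)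
    then obtain l r where r: "strict_mono r" and l: "((\<lambda>n. \<sigma> (n + N)) \<circ> r) \<longlonglongrightarrow> l"
      using compact_cball[of 0 B] unfolding compact_def by metis
    obtain m M where M: "M > 0" "\<And>z w. z \<in> cball l 1 \<Longrightarrow> rnorm g z w \<le> M * norm w"
      using rnorm_compact_bounds[OF g compact_cball[of l 1]] by metis
    have bound: "rdist g y l \<le> M * dist y l" if "dist y l < 1" for y
    proof -
      have "closed_segment y l \<subseteq> cball l 1"
        using that by (intro closed_segment_subset) (auto simp: dist_commute)
      then show ?thesis
        using path_length_le_line[OF g, of y l M] M(2) rdist_le[OF g] by (auto simp: dist_norm norm_minus_commute subset_eq)
    qed
    have "limitin R.mtopology (\<sigma> \<circ> (\<lambda>n. r n + N)) l sequentially"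
      unfolding R.limit_metric_sequentially
    proof (intro conjI allI impI)
      fix e :: real assume "e > 0"
      then obtain K where K: "\<And>n. n \<ge> K \<Longrightarrow> dist (\<sigma> (r n + N)) l < min 1 (e / M)"
        using l[unfolded lim_sequentially] M(1) by (metis comp_apply divide_pos_pos min_less_iff_conj zero_less_one)
      have "rdist g (\<sigma> (r n + N)) l < e" if "n \<ge> K" for n
        using bound[of "\<sigma> (r n + N)"] K[OF that] M(1) by (simp add: field_simps) 
      then show "\<exists>N'. \<forall>n\<ge>N'. (\<sigma> \<circ> (\<lambda>n. r n + N)) n \<in> UNIV \<and> rdist g ((\<sigma> \<circ> (\<lambda>n. r n + N)) n) l < e"
        by auto
    qed auto
    moreover have "strict_mono (\<lambda>n. r n + N)" using r by (simp add: strict_mono_def)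
    ultimately show ?thesis using R.MCauchy_convergent_subsequence[OF C] by blast
  qed
  then show ?thesis using g by (simp add: complete_riemannian_metric_def R.mcomplete_def)
qed

text \<open>The delicate point is integrability of the new speed, since a valid path may have an
  unbounded derivative: off a finite set that speed is continuous, hence measurable, and it is
  dominated by \<open>c\<close> times the old one.\<close>

lemma affine_map_path_length_le:
  assumes g: "riemannian_metric g" and c: "c \<ge> 0"
    and le: "\<And>x w. rnorm g (affine_map B b x) (B *v w) \<le> c * rnorm g x w"
    and L: "path_length_le g x y L"
  shows "path_length_le g (affine_map B b x) (affine_map B b y) (c * L)"
proof -
  obtain \<gamma> where \<gamma>: "valid_path \<gamma>" "speed g \<gamma> integrable_on {0..1}" "pathstart \<gamma> = x" "pathfinish \<gamma> = y"
    and le': "integral {0..1} (speed g \<gamma>) \<le> L"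
    using path_length_leE[OF L] .
  let ?\<delta> = "\<lambda>t. affine_map B b (\<gamma> t)"
  obtain S where S: "finite S" "\<And>t. t \<in> {0..1} - S \<Longrightarrow> (\<gamma> has_vector_derivative vector_derivative \<gamma> (at t)) (at t)"
    "continuous_on ({0..1} - S) (\<lambda>t. vector_derivative \<gamma> (at t))"
    using valid_path_vector_derivative[OF \<gamma>(1)] by metis
  have vd: "vector_derivative ?\<delta> (at t) = B *v vector_derivative \<gamma> (at t)" if "t \<in> {0..1} - S" for t
    unfolding affine_map_def
    by (rule vector_derivative_at, rule has_vector_derivative_eq_rhs, rule has_vector_derivative_add[OF
        bounded_linear.has_vector_derivative[OF matrix_vector_mul_bounded_linear S(2)[OF that]]
        has_vector_derivative_const]) simp
  have sp: "speed g ?\<delta> t \<le> c * speed g \<gamma> t" if "t \<in> {0..1} - S" for t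
    using le by (simp add: speed_def vd[OF that])
  have "continuous_on {0..1} \<gamma>"
    using \<gamma>(1) by (auto simp: valid_path_def piecewise_C1_differentiable_on_def)
  then have c\<gamma>: "continuous_on ({0..1} - S) \<gamma>" by (rule continuous_on_subset) auto
  have "continuous_on ({0..1} - S) (\<lambda>t. rnorm g (?\<delta> t) (B *v vector_derivative \<gamma> (at t)))"
    unfolding affine_map_def
    by (intro continuous_on_rnorm[OF g] continuous_on_add continuous_on_const c\<gamma> S(3) continuous_on_matrix_vector_mult)
  then have cont: "continuous_on ({0..1} - S) (speed g ?\<delta>)"
    by (rule continuous_on_eq) (simp add: speed_def vd)
  have meas: "({0..1} - S) \<in> sets lebesgue" using S(1) by (simp add: sets.Diff negligible_imp_sets negligible_finite)
  have sub: "negligible S" using S(1) by (rule negligible_finite)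
  have int': "(\<lambda>t. c * speed g \<gamma> t) integrable_on ({0..1} - S)"
    by (intro integrable_on_mult_right, rule integrable_spike_set[OF \<gamma>(2)])
      (auto intro: negligible_subset[OF sub])
  have "speed g ?\<delta> integrable_on ({0..1} - S)"
    by (rule measurable_bounded_by_integrable_imp_integrable[OF
        continuous_imp_measurable_on_sets_lebesgue[OF cont meas] int' _ meas])
      (use sp speed_nonneg[OF g] in auto)
  then have int: "speed g ?\<delta> integrable_on {0..1}"
    by (rule integrable_spike_set) (auto intro: negligible_subset[OF sub])
  have "integral {0..1} (speed g ?\<delta>) = integral ({0..1} - S) (speed g ?\<delta>)"
    by (rule integral_spike_set) (auto intro: negligible_subset[OF sub])
  also have "\<dots> \<le> integral ({0..1} - S) (\<lambda>t. c * speed g \<gamma> t)"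
    by (intro integral_le int' sp \<open>speed g ?\<delta> integrable_on ({0..1} - S)\<close>)
  also have "\<dots> = integral {0..1} (\<lambda>t. c * speed g \<gamma> t)"
    by (rule integral_spike_set) (auto intro: negligible_subset[OF sub])
  also have "\<dots> \<le> c * L" using le' c by (simp add: mult_left_mono)
  finally show ?thesis
    by (rule path_length_leI[OF valid_path_affine[OF \<gamma>(1)] integrable_integral[OF int]])
      (use \<gamma>(3,4) in \<open>simp_all add: pathstart_def pathfinish_def\<close>)
qed

lemma affine_map_rdist_le:
  assumes g: "riemannian_metric g" and c: "c > 0"
    and le: "\<And>x w. rnorm g (affine_map B b x) (B *v w) \<le> c * rnorm g x w"
  shows "rdist g (affine_map B b x) (affine_map B b y) \<le> c * rdist g x y"
proof -
  have "rdist g (affine_map B b x) (affine_map B b y) / c \<le> rdist g x y"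
  proof (rule rdist_geI[OF g])
    fix L assume "path_length_le g x y L"
    from rdist_le[OF g affine_map_path_length_le[OF g _ le this]] c
    show "rdist g (affine_map B b x) (affine_map B b y) / c \<le> L" by (simp add: field_simps)
  qed
  then show ?thesis using c by (simp add: field_simps)
qed

text \<open>Banach's fixed point theorem for \<open>rdist\<close>. Uniqueness is recorded as well,
  because it allows a fixed point of an iterate to be recognised as a fixed point of the map
  itself.\<close>

lemma affine_contraction_fixed_point:
  assumes g: "complete_riemannian_metric g"
    and le: "\<And>x w. rnorm g (affine_map B b x) (B *v w) \<le> 1/2 * rnorm g x w"
  shows "\<exists>!z. affine_map B b z = z"
proof -
  have rg: "riemannian_metric g" using g by (simp add: complete_riemannian_metric_def)
  interpret R: Metric_space UNIV "rdist g" by (rule Metric_space_rdist[OF rg])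
  have con: "rdist g (affine_map B b x) (affine_map B b y) \<le> 1/2 * rdist g x y" for x y
    by (rule affine_map_rdist_le[OF rg _ le]) auto
  obtain z where z: "affine_map B b z = z"
    using R.Banach_fixedpoint_thm[of "affine_map B b" "1/2"] con g by (auto simp: complete_riemannian_metric_def)
  moreover have "y = z" if "affine_map B b y = y" for y
    using con[of y z] R.nonneg[of y z] z that by (auto simp: R.zero)
  ultimately show ?thesis by blast
qed

section \<open>Affine maps and Anosov splittings\<close>

primrec mpow :: "real^'n^'n \<Rightarrow> nat \<Rightarrow> real^'n^'n" where
  "mpow A 0 = mat 1"
| "mpow A (Suc m) = A ** mpow A m"

lemma mpow_Suc2: "mpow A (Suc m) = mpow A m ** A"
  by (induction m) (simp_all add: matrix_mul_assoc)

lemma mpow_Suc_vec: "mpow A (Suc m) *v x = A *v (mpow A m *v x)"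
  by (simp add: matrix_vector_mul_assoc)

lemma mpow_Suc2_vec: "mpow A (Suc m) *v x = mpow A m *v (A *v x)"
  unfolding mpow_Suc2 by (simp add: matrix_vector_mul_assoc)

lemma affine_map_funpow: "\<exists>b. affine_map A v ^^ m = affine_map (mpow A m) b"
proof (induction m)
  case 0
  show ?case by (rule exI[of _ 0]) (simp add: affine_map_def fun_eq_iff)
next
  case (Suc m)
  then obtain b where b: "affine_map A v ^^ m = affine_map (mpow A m) b" by blast
  show ?case
    by (rule exI[of _ "A *v b + v"])
      (simp add: b fun_eq_iff, simp add: affine_map_def matrix_vector_right_distrib matrix_vector_mul_assoc)
qed

lemma frechet_derivative_affine_map: "frechet_derivative (affine_map A v) (at x) = (*v) A"
proof -
  have "(affine_map A v has_derivative (\<lambda>w. A *v w + 0)) (at x)"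
    unfolding affine_map_def
    by (intro has_derivative_add has_derivative_const
        bounded_linear_imp_has_derivative matrix_vector_mul_bounded_linear)
  then have "(affine_map A v has_derivative (*v) A) (at x)" by simp
  from frechet_derivative_at[OF this] show ?thesis by simp
qed

lemma frechet_derivative_affine_map_funpow:
  "frechet_derivative (affine_map A v ^^ m) (at x) = (*v) (mpow A m)"
  using affine_map_funpow frechet_derivative_affine_map by metis

lemma smooth_on_affine_map: "smooth_on UNIV (affine_map A v)"
  unfolding affine_map_def
  by (intro smooth_on_add smooth_on_const smooth_on_bounded_linear matrix_vector_mul_bounded_linear open_UNIV)

lemma matrix_inv_mult:
  assumes "invertible A"
  shows "A ** matrix_inv A = mat 1" "matrix_inv A ** A = mat 1"
  using someI_ex[OF assms[unfolded invertible_def]] unfolding matrix_inv_def by auto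

lemma matrix_inv_vec:
  assumes "invertible A"
  shows "A *v (matrix_inv A *v x) = x" "matrix_inv A *v (A *v x) = x"
  using matrix_inv_mult[OF assms] by (simp_all add: matrix_vector_mul_assoc)

lemma affine_map_inverse:
  assumes "invertible A"
  shows "affine_map A v (affine_map (matrix_inv A) (- (matrix_inv A *v v)) x) = x"
    and "affine_map (matrix_inv A) (- (matrix_inv A *v v)) (affine_map A v x) = x"
  using matrix_inv_vec[OF assms]
  by (simp_all add: affine_map_def algebra_simps matrix_vector_right_distrib matrix_vector_mult_diff_distrib)

lemma bij_affine_map: "invertible A \<Longrightarrow> bij (affine_map A v)"
  by (rule bijI') (metis affine_map_inverse)+

lemma inv_affine_map:
  "invertible A \<Longrightarrow> inv (affine_map A v) = affine_map (matrix_inv A) (- (matrix_inv A *v v))"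
  by (rule inv_equality) (simp_all add: affine_map_inverse)

lemma invertible_matrix_inv: "invertible A \<Longrightarrow> invertible (matrix_inv A)"
  using matrix_inv_mult invertible_def by blast

lemma diffeomorphism_affine_map: "invertible A \<Longrightarrow> diffeomorphism (affine_map A v)"
  by (simp add: diffeomorphism_def bij_affine_map inv_affine_map smooth_on_affine_map)

lemma mpow_matrix_inv_vec:
  assumes "invertible A"
  shows "mpow A m *v (mpow (matrix_inv A) m *v x) = x" "mpow (matrix_inv A) m *v (mpow A m *v x) = x"
proof -
  have "mpow A m *v (mpow (matrix_inv A) m *v x) = x \<and> mpow (matrix_inv A) m *v (mpow A m *v x) = x"
  proof (induction m arbitrary: x)
    case (Suc m)
    show ?case
      unfolding mpow_Suc2_vec[of A] mpow_Suc_vec[of "matrix_inv A"] matrix_inv_vec[OF assms]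
      using Suc[of x] Suc[of "A *v x"]
      by (metis matrix_inv_vec[OF assms])
  qed simp
  then show "mpow A m *v (mpow (matrix_inv A) m *v x) = x" "mpow (matrix_inv A) m *v (mpow A m *v x) = x"
    by auto
qed

lemma inv_funpow_cancel:
  assumes "bij f"
  shows "(f ^^ m) ((inv f ^^ m) x) = x" "(inv f ^^ m) ((f ^^ m) x) = x"
proof -
  have "(f ^^ m) ((inv f ^^ m) x) = x \<and> (inv f ^^ m) ((f ^^ m) x) = x"
  proof (induction m arbitrary: x)
    case (Suc m)
    have "(f ^^ Suc m) ((inv f ^^ Suc m) x) = (f ^^ m) (f (inv f ((inv f ^^ m) x)))"
      by (simp add: funpow_swap1)
    also have "\<dots> = x" using Suc assms by (simp add: bij_is_surj surj_f_inv_f)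
    finally have 1: "(f ^^ Suc m) ((inv f ^^ Suc m) x) = x" .
    have "(inv f ^^ Suc m) ((f ^^ Suc m) x) = (inv f ^^ m) (inv f (f ((f ^^ m) x)))"
      by (simp add: funpow_swap1)
    also have "\<dots> = x" using Suc assms by (simp add: bij_is_inj)
    finally show ?case using 1 by blast
  qed simp
  then show "(f ^^ m) ((inv f ^^ m) x) = x" "(inv f ^^ m) ((f ^^ m) x) = x" by auto
qed

lemma invariant_bundle_funpow:
  assumes "\<And>x. (*v) A ` E x = E (f x)"
  shows "(*v) (mpow A m) ` E x = E ((f ^^ m) x)"
proof (induction m)
  case 0
  show ?case by simp
next
  case (Suc m)
  have "(*v) (mpow A (Suc m)) ` E x = (*v) A ` ((*v) (mpow A m) ` E x)"
    by (simp add: image_image matrix_vector_mul_assoc)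
  then show ?case using Suc assms by simp
qed

text \<open>Invariance of \<open>Eu\<close> permits replacing a vector by its image under
  \<open>mpow A m\<close>, which turns contraction by inverse iterates into expansion by forward
  iterates. The inverse map thereby disappears, and all derivatives become powers of
  \<open>A\<close>.\<close>

lemma anosov_splitting_affine_iff:
  fixes A :: "real^'n^'n" and v :: "real^'n"
  assumes A: "invertible A"
  defines "f \<equiv> affine_map A v"
  shows "anosov_splitting g f Es Eu \<longleftrightarrow>
    continuous_subbundle Es \<and> continuous_subbundle Eu \<and>
    (\<forall>x. Es x \<inter> Eu x = {0} \<and> {a + b | a b. a \<in> Es x \<and> b \<in> Eu x} = UNIV) \<and>
    (\<forall>x. (*v) A ` Es x = Es (f x) \<and> (*v) A ` Eu x = Eu (f x)) \<and>
    (\<exists>C \<mu>. C \<ge> 1 \<and> 0 < \<mu> \<and> \<mu> < 1 \<and>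
      (\<forall>m x. \<forall>w\<in>Es x. rnorm g ((f ^^ m) x) (mpow A m *v w) \<le> C * \<mu> ^ m * rnorm g x w) \<and>
      (\<forall>m x. \<forall>w\<in>Eu x. rnorm g x w \<le> C * \<mu> ^ m * rnorm g ((f ^^ m) x) (mpow A m *v w)))"
proof -
  have bij: "bij f" using bij_affine_map[OF A] by (simp add: f_def)
  have fd: "frechet_derivative f (at x) = (*v) A" for x by (simp add: f_def frechet_derivative_affine_map)
  have fdm: "frechet_derivative (f ^^ m) (at x) = (*v) (mpow A m)" for m x
    by (simp add: f_def frechet_derivative_affine_map_funpow)
  have fdi: "frechet_derivative (inv f ^^ m) (at x) = (*v) (mpow (matrix_inv A) m)" for m x
    by (simp add: f_def inv_affine_map[OF A] frechet_derivative_affine_map_funpow)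
  have eq: "(\<forall>m x. \<forall>w\<in>Eu x. rnorm g ((inv f ^^ m) x) (mpow (matrix_inv A) m *v w) \<le> C * \<mu> ^ m * rnorm g x w)
    \<longleftrightarrow> (\<forall>m x. \<forall>w\<in>Eu x. rnorm g x w \<le> C * \<mu> ^ m * rnorm g ((f ^^ m) x) (mpow A m *v w))" (is "?L \<longleftrightarrow> ?R")
    if inv: "\<forall>x. (*v) A ` Es x = Es (f x) \<and> (*v) A ` Eu x = Eu (f x)" for C \<mu>
  proof -
    have im: "(*v) (mpow A m) ` Eu x = Eu ((f ^^ m) x)" for m x
      by (rule invariant_bundle_funpow) (use inv in auto)
    show ?thesis
    proof
      assume L: ?L
      show ?R
      proof (intro allI ballI)
        fix m x w assume w: "w \<in> Eu x"
        have "mpow A m *v w \<in> Eu ((f ^^ m) x)" using im w by blast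
        with L have "rnorm g ((inv f ^^ m) ((f ^^ m) x)) (mpow (matrix_inv A) m *v (mpow A m *v w))
          \<le> C * \<mu> ^ m * rnorm g ((f ^^ m) x) (mpow A m *v w)" by blast
        then show "rnorm g x w \<le> C * \<mu> ^ m * rnorm g ((f ^^ m) x) (mpow A m *v w)"
          by (simp add: inv_funpow_cancel[OF bij] mpow_matrix_inv_vec[OF A])
      qed
    next
      assume R: ?R
      show ?L
      proof (intro allI ballI)
        fix m x w assume w: "w \<in> Eu x"
        let ?y = "(inv f ^^ m) x" and ?u = "mpow (matrix_inv A) m *v w"
        have "w \<in> (*v) (mpow A m) ` Eu ?y" using im[of m ?y] w by (simp add: inv_funpow_cancel[OF bij])
        then have "?u \<in> Eu ?y" using mpow_matrix_inv_vec(2)[OF A] by force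
        with R have "rnorm g ?y ?u \<le> C * \<mu> ^ m * rnorm g ((f ^^ m) ?y) (mpow A m *v ?u)" by blast
        then show "rnorm g ?y ?u \<le> C * \<mu> ^ m * rnorm g x w"
          by (simp add: inv_funpow_cancel[OF bij] mpow_matrix_inv_vec[OF A])
      qed
    qed
  qed
  show ?thesis
    unfolding anosov_splitting_def fd fdm fdi using eq by (intro conj_cong refl ex_cong1) blast+
qed

lemma exists_power_le_half:
  fixes C \<mu> :: real
  assumes "C \<ge> 1" "0 < \<mu>" "\<mu> < 1"
  obtains m where "C * \<mu> ^ m \<le> 1/2"
proof -
  obtain m where "\<mu> ^ m < 1 / (2 * C)" using real_arch_pow_inv[of "1 / (2*C)" \<mu>] assms by auto
  then have "C * \<mu> ^ m \<le> 1/2" using assms by (simp add: field_simps)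
  then show ?thesis using that by blast
qed

text \<open>\<open>f\<close> commutes with its iterate, so it maps the unique fixed point of the
  iterate to a fixed point of the iterate, that is, to itself.\<close>

lemma funpow_fixed_point:
  assumes "\<exists>!z. (f ^^ m) z = z"
  obtains z where "f z = z"
proof -
  obtain z where z: "(f ^^ m) z = z" "\<And>y. (f ^^ m) y = y \<Longrightarrow> y = z" using assms by metis
  have "(f ^^ m) (f z) = f z" using z(1) by (metis funpow_swap1)
  then show ?thesis using z(2) that by blast
qed

lemma continuous_subbundle_subspace:
  assumes "continuous_subbundle E"
  shows "subspace (E x)"
proof -
  obtain U k and X :: "nat \<Rightarrow> real^'a \<Rightarrow> real^'a" where "x \<in> U" "\<forall>x\<in>U. span ((\<lambda>i. X i x) ` {..<k}) = E x"
    using assms unfolding continuous_subbundle_def by fast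
  then show ?thesis by (metis subspace_span)
qed

lemma index_without_fixed_point:
  fixes A :: "real^'n^'n"
  assumes A: "invertible A" and g: "complete_riemannian_metric g"
    and sp: "anosov_splitting g (affine_map A v) Es Eu"
    and k: "\<And>x. dim (Es x) = k" and nofix: "\<And>z. affine_map A v z \<noteq> z"
  shows "k \<in> {1..CARD('n) - 1}"
proof -
  let ?f = "affine_map A v"
  have rg: "riemannian_metric g" using g by (simp add: complete_riemannian_metric_def)
  obtain C \<mu> where C: "C \<ge> 1" "0 < \<mu>" "\<mu> < 1"
    and s: "\<And>m x w. w \<in> Es x \<Longrightarrow> rnorm g ((?f ^^ m) x) (mpow A m *v w) \<le> C * \<mu> ^ m * rnorm g x w"
    and u: "\<And>m x w. w \<in> Eu x \<Longrightarrow> rnorm g ((inv ?f ^^ m) x) (mpow (matrix_inv A) m *v w) \<le> C * \<mu> ^ m * rnorm g x w"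
    using sp[unfolded anosov_splitting_def, THEN conjunct2, THEN conjunct2, THEN conjunct2, THEN conjunct2]
    unfolding inv_affine_map[OF A] frechet_derivative_affine_map_funpow by auto
  have split: "Es x \<inter> Eu x = {0}" "{a + b | a b. a \<in> Es x \<and> b \<in> Eu x} = UNIV" for x
    using sp[unfolded anosov_splitting_def, THEN conjunct2, THEN conjunct2, THEN conjunct1] by auto
  have "continuous_subbundle Es" "continuous_subbundle Eu"
    using sp by (simp_all only: anosov_splitting_def)
  then have sub: "subspace (Es x)" "subspace (Eu x)" for x by (auto intro: continuous_subbundle_subspace)
  \<comment> \<open>The constant \<open>C\<close> may prevent the map from contracting in a single
    step; a high enough iterate halves the lengths.\<close>
  obtain m where m: "C * \<mu> ^ m \<le> 1/2" using exists_power_le_half[OF C] .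
  have half: "C * \<mu> ^ m * rnorm g x w \<le> 1/2 * rnorm g x w" for x w
    using m rnorm_nonneg[OF rg] by (intro mult_right_mono) auto
  have "k \<noteq> 0"
  proof
    assume "k = 0"
    then have "Es x = {0}" for x using k[of x] split(1)[of x] by (auto simp: dim_eq_0)
    then have Eu: "w \<in> Eu x" for x w using split(2)[of x] by auto
    obtain b where b: "inv ?f ^^ m = affine_map (mpow (matrix_inv A) m) b"
      using affine_map_funpow inv_affine_map[OF A] by metis
    have "\<exists>!z. affine_map (mpow (matrix_inv A) m) b z = z"
      using u[OF Eu, of m, unfolded b] half by (intro affine_contraction_fixed_point[OF g]) (rule order_trans)
    then have "\<exists>!z. (inv ?f ^^ m) z = z" by (simp only: b)
    then obtain z where "inv ?f z = z" by (rule funpow_fixed_point)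
    then have "?f z = z" using bij_affine_map[OF A, of v] by (metis bij_inv_eq_iff)
    then show False using nofix by blast
  qed
  moreover have "k \<noteq> CARD('n)"
  proof
    assume "k = CARD('n)"
    then have "dim (Es x) = DIM(real^'n)" for x using k by simp
    then have "Es x = UNIV" for x using dim_eq_full[of "Es x"] span_eq_iff[of "Es x"] sub by auto
    then have Es: "w \<in> Es x" for x w by auto
    obtain b where b: "?f ^^ m = affine_map (mpow A m) b"
      using affine_map_funpow by metis
    have "\<exists>!z. affine_map (mpow A m) b z = z"
      using s[OF Es, of m, unfolded b] half by (intro affine_contraction_fixed_point[OF g]) (rule order_trans)
    then have "\<exists>!z. (?f ^^ m) z = z" by (simp only: b)
    then obtain z where "?f z = z" by (rule funpow_fixed_point)
    then show False using nofix by blast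
  qed
  moreover have "k \<le> CARD('n)" using dim_subset_UNIV[of "Es 0"] k[of 0] by simp
  ultimately show ?thesis by auto
qed

section \<open>Subbundles and metrics given by a coframe\<close>

definition coordinate_bundle :: "(real^'n \<Rightarrow> real^'n^'n) \<Rightarrow> 'n set \<Rightarrow> real^'n \<Rightarrow> (real^'n) set" where
  "coordinate_bundle \<Theta> S x = {w. \<forall>j. j \<notin> S \<longrightarrow> (\<Theta> x *v w) $ j = 0}"

text \<open>The rows of \<open>T\<close> are covectors and the columns of its inverse form the dual
  basis; the common kernel of the covectors outside \<open>S\<close> is spanned by the dual vectors
  with index in \<open>S\<close>.\<close>

lemma coordinate_bundle_span:
  fixes T :: "real^'n^'n"
  assumes T: "invertible T" and k: "bij_betw h {..<k} S"
  defines "X \<equiv> \<lambda>i. matrix_inv T *v axis (h i) 1"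
  shows "inj_on X {..<k}" "independent (X ` {..<k})"
    "span (X ` {..<k}) = {w. \<forall>j. j \<notin> S \<longrightarrow> (T *v w) $ j = 0}"
proof -
  let ?B = "(\<lambda>j. axis j 1 :: real^'n) ` S"
  have XB: "X ` {..<k} = (*v) (matrix_inv T) ` ?B"
    using bij_betw_imp_surj_on[OF k] by (auto simp: X_def image_image)
  have inj: "inj ((*v) (matrix_inv T))"
    by (rule injI) (metis matrix_inv_vec(1)[OF T])
  show "inj_on X {..<k}"
  proof (rule inj_onI)
    fix i j assume ij: "i \<in> {..<k}" "j \<in> {..<k}" and "X i = X j"
    then have "axis (h i) 1 = (axis (h j) 1 :: real^'n)" using inj by (auto simp: X_def dest: injD)
    then have "h i = h j" by (simp add: axis_eq_axis)
    then show "i = j" using k ij by (auto simp: bij_betw_def dest: inj_onD)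
  qed
  have B: "?B \<subseteq> Basis" by auto
  then have "independent ?B" using independent_Basis independent_mono by blast
  then show "independent (X ` {..<k})"
    unfolding XB
    by (rule linear_independent_injective_image[OF matrix_vector_mul_linear]) (rule inj_on_subset[OF inj subset_UNIV])
  have "span ?B = {x. \<forall>i\<in>Basis. i \<notin> ?B \<longrightarrow> x \<bullet> i = 0}" by (rule span_substd_basis[OF B])
  also have "\<dots> = {x. \<forall>j. j \<notin> S \<longrightarrow> x $ j = 0}"
    by (auto simp: Basis_vec_def inner_axis axis_eq_axis)
  finally have sp: "span ?B = {x. \<forall>j. j \<notin> S \<longrightarrow> x $ j = 0}" .
  show "span (X ` {..<k}) = {w. \<forall>j. j \<notin> S \<longrightarrow> (T *v w) $ j = 0}"
    unfolding XB linear_span_image[OF matrix_vector_mul_linear] sp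
  proof (intro equalityI subsetI)
    fix w assume "w \<in> {w. \<forall>j. j \<notin> S \<longrightarrow> (T *v w) $ j = 0}"
    then show "w \<in> (*v) (matrix_inv T) ` {x. \<forall>j. j \<notin> S \<longrightarrow> x $ j = 0}"
      by (intro image_eqI[of _ _ "T *v w"]) (simp_all add: matrix_inv_vec[OF T])
  qed (auto simp: matrix_inv_vec[OF T])
qed

text \<open>Cramer's rule exhibits the inverse through quotients of determinants, which makes the
  continuity of the dual frame evident.\<close>

lemma matrix_inv_vec_cramer:
  fixes T :: "real^'n^'n"
  assumes "invertible T"
  shows "matrix_inv T *v b = (\<chi> k. det (\<chi> i j. if j = k then b $ i else T $ i $ j) / det T)"
proof -
  have "det T \<noteq> 0" using assms invertible_det_nz by blast
  from cramer[OF this, of "matrix_inv T *v b" b] show ?thesis by (simp add: matrix_inv_vec[OF assms])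
qed

lemma continuous_subbundle_coordinate_bundle:
  fixes \<Theta> :: "real^'n \<Rightarrow> real^'n^'n"
  assumes \<Theta>: "continuous_on UNIV \<Theta>" "\<And>x. invertible (\<Theta> x)"
  shows "continuous_subbundle (coordinate_bundle \<Theta> S)" "dim (coordinate_bundle \<Theta> S x) = card S"
proof -
  obtain h where h: "bij_betw h {..<card S} S"
    using ex_bij_betw_nat_finite[of S] by (auto simp: lessThan_atLeast0)
  let ?X = "\<lambda>i x. matrix_inv (\<Theta> x) *v axis (h i) 1"
  note fr = coordinate_bundle_span[OF \<Theta>(2) h, folded coordinate_bundle_def]
  have nz: "det (\<Theta> x) \<noteq> 0" for x using \<Theta>(2) invertible_det_nz by blast
  have c: "continuous_on UNIV (\<lambda>x. \<Theta> x $ i $ j)" for i j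
    by (intro continuous_intros \<Theta>(1))
  have c: "continuous_on UNIV (\<lambda>x. \<Theta> x $ i $ j)" "continuous_on UNIV (\<lambda>x. if P then d else \<Theta> x $ i $ j)" for i j P and d :: real
    using c by (cases P; simp)+
  have "continuous_on UNIV (?X i)" for i
    unfolding matrix_inv_vec_cramer[OF \<Theta>(2)] det_def
    by (intro continuous_on_vec_lambda continuous_on_divide continuous_on_sum continuous_on_mult continuous_on_const
        continuous_on_prod) (auto intro: c simp: nz[unfolded det_def])
  then show "continuous_subbundle (coordinate_bundle \<Theta> S)"
    unfolding continuous_subbundle_def
    by (intro allI exI[of _ UNIV] exI[of _ "card S"] exI[of _ ?X] conjI impI ballI open_UNIV UNIV_I)
      (use fr in auto)
  show "dim (coordinate_bundle \<Theta> S x) = card S"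
    using dim_span_eq_card_independent[OF fr(2)[of x]] card_image[OF fr(1)[of x]] fr(3)[of x]
    by (simp add: coordinate_bundle_def)
qed

lemma constant_subbundle:
  assumes "subspace E"
  shows "continuous_subbundle (\<lambda>_. E)"
proof -
  obtain B where B: "B \<subseteq> E" "independent B" "E \<subseteq> span B" "card B = dim E" using basis_exists by blast
  have sp: "span B = E" using B assms by (simp add: span_minimal subset_antisym)
  have "finite B" using B(2) independent_imp_finite by blast
  then obtain h where h: "bij_betw h {..<card B} B"
    using ex_bij_betw_nat_finite[of B] by (auto simp: lessThan_atLeast0)
  then have "inj_on h {..<card B}" "h ` {..<card B} = B" by (auto simp: bij_betw_def)
  then show ?thesis
    unfolding continuous_subbundle_def
    by (intro allI exI[of _ UNIV] exI[of _ "card B"] exI[of _ "\<lambda>i _. h i"] conjI impI ballI open_UNIV UNIV_I)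
      (use B sp in \<open>auto intro: continuous_on_const\<close>)
qed

text \<open>The diagonal metric in the coframe formed by the rows theta_j of
  \<open>\<Theta> x\<close>, that is, the sum of a_j theta_j^2.\<close>

definition frame_metric :: "('n \<Rightarrow> real^'n \<Rightarrow> real) \<Rightarrow> (real^'n \<Rightarrow> real^'n^'n) \<Rightarrow> real^'n \<Rightarrow> real^'n^'n" where
  "frame_metric a \<Theta> x = (\<chi> p q. \<Sum>j\<in>UNIV. a j x * \<Theta> x $ j $ p * \<Theta> x $ j $ q)"

lemma inner_frame_metric:
  "w \<bullet> (frame_metric a \<Theta> x *v w) = (\<Sum>j\<in>UNIV. a j x * ((\<Theta> x *v w) $ j)\<^sup>2)"
proof -
  have "w \<bullet> (frame_metric a \<Theta> x *v w)
      = (\<Sum>p\<in>UNIV. \<Sum>q\<in>UNIV. \<Sum>j\<in>UNIV. a j x * (\<Theta> x $ j $ p * w $ p) * (\<Theta> x $ j $ q * w $ q))"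
    by (simp add: inner_vec_def matrix_vector_mult_def frame_metric_def sum_distrib_left sum_distrib_right mult_ac)
  also have "\<dots> = (\<Sum>p\<in>UNIV. \<Sum>j\<in>UNIV. \<Sum>q\<in>UNIV. a j x * (\<Theta> x $ j $ p * w $ p) * (\<Theta> x $ j $ q * w $ q))"
    by (intro sum.cong refl sum.swap)
  also have "\<dots> = (\<Sum>j\<in>UNIV. \<Sum>p\<in>UNIV. \<Sum>q\<in>UNIV. a j x * (\<Theta> x $ j $ p * w $ p) * (\<Theta> x $ j $ q * w $ q))"
    by (rule sum.swap)
  also have "\<dots> = (\<Sum>j\<in>UNIV. a j x * ((\<Theta> x *v w) $ j)\<^sup>2)"
    by (simp add: matrix_vector_mult_def power2_eq_square sum_product sum_distrib_left mult_ac)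
  finally show ?thesis .
qed

lemma riemannian_metric_frame_metric:
  fixes \<Theta> :: "real^'n \<Rightarrow> real^'n^'n"
  assumes \<Theta>: "smooth_on UNIV \<Theta>" "\<And>x. invertible (\<Theta> x)"
    and a: "\<And>j. smooth_on UNIV (a j)" "\<And>j x. a j x > 0"
  shows "riemannian_metric (frame_metric a \<Theta>)"
  unfolding riemannian_metric_def
proof (intro conjI allI impI)
  show "smooth_on UNIV (frame_metric a \<Theta>)"
  proof (intro smooth_on_matrix open_UNIV)
    show "smooth_on UNIV (\<lambda>x. frame_metric a \<Theta> x $ p $ q)" for p q
      unfolding frame_metric_def vec_lambda_beta
      by (intro smooth_on_sum smooth_on_mult smooth_on_vec_nth \<Theta> a open_UNIV)
  qed
  fix x
  show "transpose (frame_metric a \<Theta> x) = frame_metric a \<Theta> x"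
    by (simp add: transpose_def frame_metric_def mult_ac)
  fix w :: "real^'n" assume "w \<noteq> 0"
  then have "\<Theta> x *v w \<noteq> 0" using matrix_inv_vec(2)[OF \<Theta>(2), of x w] by auto
  then obtain j where j: "(\<Theta> x *v w) $ j \<noteq> 0" by (auto simp: vec_eq_iff)
  have "0 < (\<Sum>j\<in>UNIV. a j x * ((\<Theta> x *v w) $ j)\<^sup>2)"
    by (rule sum_pos2[of UNIV j]) (use j a(2) in \<open>auto intro!: mult_nonneg_nonneg less_imp_le[OF a(2)]\<close>)
  then show "w \<bullet> (frame_metric a \<Theta> x *v w) > 0" by (simp add: inner_frame_metric)
qed

text \<open>Along an orbit the covectors change by signs only, which the squares absorb, so the
  weights alone govern the norm. They multiply squared norms, so the factors \<open>exp (-2)\<close>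
  and \<open>exp 2\<close> mean the rate \<open>exp (-1)\<close>, with constant 1.\<close>

lemma anosov_splitting_frame_metric:
  fixes A :: "real^'n^'n" and \<Theta> :: "real^'n \<Rightarrow> real^'n^'n"
  assumes A: "invertible A"
    and \<Theta>: "smooth_on UNIV \<Theta>" "\<And>x. invertible (\<Theta> x)"
    and a: "\<And>j. smooth_on UNIV (a j)" "\<And>j x. a j x > 0"
    and \<sigma>: "\<And>j. \<bar>\<sigma> j\<bar> = 1"
    and eq: "\<And>x w j. (\<Theta> (affine_map A v x) *v (A *v w)) $ j = \<sigma> j * (\<Theta> x *v w) $ j"
    and wt: "\<And>j x. a j (affine_map A v x) = (if j \<in> S then exp (-2) else exp 2) * a j x"
  shows "anosov_splitting (frame_metric a \<Theta>) (affine_map A v) (coordinate_bundle \<Theta> S) (coordinate_bundle \<Theta> (- S))"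
  unfolding anosov_splitting_affine_iff[OF A]
proof (intro conjI allI)
  let ?f = "affine_map A v" and ?g = "frame_metric a \<Theta>"
  have c\<Theta>: "continuous_on UNIV \<Theta>" by (rule smooth_on_imp_continuous_on[OF \<Theta>(1)])
  show "continuous_subbundle (coordinate_bundle \<Theta> S)" "continuous_subbundle (coordinate_bundle \<Theta> (- S))"
    by (intro continuous_subbundle_coordinate_bundle c\<Theta> \<Theta>(2))+
  have im: "(*v) A ` coordinate_bundle \<Theta> R x = coordinate_bundle \<Theta> R (?f x)" for R x
  proof (intro equalityI subsetI)
    fix w assume "w \<in> coordinate_bundle \<Theta> R (?f x)"
    moreover have "(\<Theta> (?f x) *v w) $ j = \<sigma> j * (\<Theta> x *v (matrix_inv A *v w)) $ j" for j
      using eq[of x "matrix_inv A *v w" j] by (simp add: matrix_inv_vec[OF A])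
    moreover have "\<sigma> j \<noteq> 0" for j using \<sigma>[of j] by auto
    ultimately have "matrix_inv A *v w \<in> coordinate_bundle \<Theta> R x" by (simp add: coordinate_bundle_def)
    then show "w \<in> (*v) A ` coordinate_bundle \<Theta> R x"
      by (intro image_eqI[of _ _ "matrix_inv A *v w"]) (simp_all add: matrix_inv_vec[OF A])
  qed (auto simp: coordinate_bundle_def eq)
  have eqm: "((\<Theta> ((?f ^^ m) x) *v (mpow A m *v w)) $ j)\<^sup>2 = ((\<Theta> x *v w) $ j)\<^sup>2" for m x w j
  proof (induction m)
    case (Suc m)
    have "(\<sigma> j)\<^sup>2 = 1" using \<sigma>[of j] by (metis one_power2 power2_abs)
    then show ?case using Suc eq[of "(?f ^^ m) x" "mpow A m *v w" j]
      unfolding mpow_Suc_vec by (simp add: power_mult_distrib)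
  qed simp
  have wtm: "a j ((?f ^^ m) x) = (if j \<in> S then exp (-1) ^ m * exp (-1) ^ m * a j x else a j x / (exp (-1) ^ m * exp (-1) ^ m))" for m j x
    by (induction m) (auto simp: wt field_simps exp_minus simp flip: exp_add)
  have rn: "rnorm ?g x w = sqrt (\<Sum>j\<in>UNIV. a j x * ((\<Theta> x *v w) $ j)\<^sup>2)" for x w
    by (simp add: rnorm_def inner_frame_metric)
  let ?\<mu> = "exp (-1) :: real"
  have scale: "sqrt (?\<mu> ^ m * ?\<mu> ^ m * y) = ?\<mu> ^ m * sqrt y" for m y
    by (simp add: real_sqrt_mult)
  fix x
  show "coordinate_bundle \<Theta> S x \<inter> coordinate_bundle \<Theta> (- S) x = {0}"
  proof -
    have "w = 0" if "w \<in> coordinate_bundle \<Theta> S x" "w \<in> coordinate_bundle \<Theta> (- S) x" for w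
    proof -
      have "\<Theta> x *v w = 0" using that by (auto simp: coordinate_bundle_def vec_eq_iff)
      then show "w = 0" using matrix_inv_vec(2)[OF \<Theta>(2), of x w] by simp
    qed
    then show ?thesis by (auto simp: coordinate_bundle_def)
  qed
  show "{a + b |a b. a \<in> coordinate_bundle \<Theta> S x \<and> b \<in> coordinate_bundle \<Theta> (- S) x} = UNIV"
  proof -
    have "\<exists>a b. w = a + b \<and> a \<in> coordinate_bundle \<Theta> S x \<and> b \<in> coordinate_bundle \<Theta> (- S) x" for w
    proof -
      let ?y = "\<Theta> x *v w"
      let ?p = "\<chi> j. if j \<in> S then ?y $ j else 0" and ?q = "\<chi> j. if j \<in> S then 0 else ?y $ j"
      have pq: "?p + ?q = ?y" by (simp add: vec_eq_iff)
      have "w = matrix_inv (\<Theta> x) *v ?p + matrix_inv (\<Theta> x) *v ?q"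
        unfolding matrix_vector_right_distrib[symmetric] pq matrix_inv_vec[OF \<Theta>(2)] ..
      moreover have "matrix_inv (\<Theta> x) *v ?p \<in> coordinate_bundle \<Theta> S x"
        "matrix_inv (\<Theta> x) *v ?q \<in> coordinate_bundle \<Theta> (- S) x"
        by (auto simp: coordinate_bundle_def matrix_inv_vec[OF \<Theta>(2)])
      ultimately show ?thesis by (intro exI conjI)
    qed
    then show ?thesis by auto
  qed
  show "(*v) A ` coordinate_bundle \<Theta> S x = coordinate_bundle \<Theta> S (?f x)"
    "(*v) A ` coordinate_bundle \<Theta> (- S) x = coordinate_bundle \<Theta> (- S) (?f x)"
    by (rule im)+
  have 1: "rnorm ?g ((?f ^^ m) x) (mpow A m *v w) \<le> 1 * ?\<mu> ^ m * rnorm ?g x w"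
    if w: "w \<in> coordinate_bundle \<Theta> S x" for m x w
  proof -
    have "(\<Sum>j\<in>UNIV. a j ((?f ^^ m) x) * ((\<Theta> ((?f ^^ m) x) *v (mpow A m *v w)) $ j)\<^sup>2)
      = (\<Sum>j\<in>UNIV. ?\<mu> ^ m * ?\<mu> ^ m * (a j x * ((\<Theta> x *v w) $ j)\<^sup>2))"
      by (intro sum.cong refl) (use w in \<open>auto simp: eqm wtm coordinate_bundle_def\<close>)
    then show ?thesis unfolding rn by (simp add: scale flip: sum_distrib_left)
  qed
  have 2: "rnorm ?g x w \<le> 1 * ?\<mu> ^ m * rnorm ?g ((?f ^^ m) x) (mpow A m *v w)"
    if w: "w \<in> coordinate_bundle \<Theta> (- S) x" for m x w
  proof -
    have "(\<Sum>j\<in>UNIV. a j x * ((\<Theta> x *v w) $ j)\<^sup>2) = (\<Sum>j\<in>UNIV. ?\<mu> ^ m * ?\<mu> ^ m *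
       (a j ((?f ^^ m) x) * ((\<Theta> ((?f ^^ m) x) *v (mpow A m *v w)) $ j)\<^sup>2))"
      by (intro sum.cong refl) (use w in \<open>auto simp: eqm wtm coordinate_bundle_def\<close>)
    then show ?thesis unfolding rn by (simp add: scale flip: sum_distrib_left)
  qed
  show "\<exists>C \<mu>. C \<ge> 1 \<and> 0 < \<mu> \<and> \<mu> < 1 \<and>
      (\<forall>m x. \<forall>w\<in>coordinate_bundle \<Theta> S x. rnorm ?g ((?f ^^ m) x) (mpow A m *v w) \<le> C * \<mu> ^ m * rnorm ?g x w) \<and>
      (\<forall>m x. \<forall>w\<in>coordinate_bundle \<Theta> (- S) x.
        rnorm ?g x w \<le> C * \<mu> ^ m * rnorm ?g ((?f ^^ m) x) (mpow A m *v w))"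
    by (rule exI[of _ 1], rule exI[of _ ?\<mu>], intro conjI allI ballI 1 2) auto
qed

section \<open>Hyperbolic linear parts\<close>

text \<open>The Euclidean version of an Anosov splitting, independent of base points. As in
  \<open>anosov_splitting_affine_iff\<close> the estimate on \<open>F\<close> is phrased by forward
  powers, which avoids the inverse matrix.\<close>

definition hyperbolic_splitting :: "real^'n^'n \<Rightarrow> (real^'n) set \<Rightarrow> (real^'n) set \<Rightarrow> bool" where
  "hyperbolic_splitting A E F \<longleftrightarrow> subspace E \<and> subspace F \<and> E \<inter> F = {0} \<and> {a + b | a b. a \<in> E \<and> b \<in> F} = UNIV \<and>
     (*v) A ` E = E \<and> (*v) A ` F = F \<and>
     (\<exists>C \<mu>. C \<ge> 1 \<and> 0 < \<mu> \<and> \<mu> < 1 \<and>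
       (\<forall>m. \<forall>w\<in>E. norm (mpow A m *v w) \<le> C * \<mu> ^ m * norm w) \<and>
       (\<forall>m. \<forall>w\<in>F. norm w \<le> C * \<mu> ^ m * norm (mpow A m *v w)))"

lemma rnorm_euclidean: "rnorm (\<lambda>_. mat 1) x w = norm w"
  by (simp add: rnorm_def norm_eq_sqrt_inner)

lemma riemannian_metric_euclidean: "riemannian_metric (\<lambda>_. mat 1)"
  by (simp add: riemannian_metric_def smooth_on_const transpose_mat)

lemma complete_riemannian_metric_euclidean: "complete_riemannian_metric (\<lambda>_::real^'n. mat 1)"
proof (rule complete_riemannian_metricI[OF riemannian_metric_euclidean])
  fix p :: "real^'n" and L
  have "norm (pathfinish \<gamma>) \<le> norm p + L"
    if \<gamma>: "finite_length_path (\<lambda>_. mat 1) \<gamma>" "pathstart \<gamma> = p" "integral {0..1} (speed (\<lambda>_. mat 1) \<gamma>) \<le> L" for \<gamma>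
  proof -
    have "norm (\<gamma> 1 - \<gamma> 0) \<le> 1 * integral {0..1} (speed (\<lambda>_. mat 1) \<gamma>)"
      by (rule path_Lipschitz_bound[OF riemannian_metric_euclidean \<gamma>(1), of 0 1 1 "\<lambda>x. x" "\<lambda>x w. w"])
        (auto simp: rnorm_euclidean intro: has_derivative_ident)
    moreover have "norm (\<gamma> 1) \<le> norm (\<gamma> 0) + norm (\<gamma> 1 - \<gamma> 0)"
      by (metis add.commute diff_add_cancel norm_triangle_ineq)
    ultimately show ?thesis using \<gamma>(2,3) by (simp add: pathstart_def pathfinish_def)
  qed
  then show "\<exists>B. \<forall>\<gamma>. finite_length_path (\<lambda>_. mat 1) \<gamma> \<and> pathstart \<gamma> = p \<and>
      integral {0..1} (speed (\<lambda>_. mat 1) \<gamma>) \<le> L \<longrightarrow> norm (pathfinish \<gamma>) \<le> B"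
    by (intro exI[of _ "norm p + L"]) auto
qed

lemma le_zero_if_le_power:
  fixes a K \<mu> :: real
  assumes "\<And>m. a \<le> K * \<mu> ^ m" "0 < \<mu>" "\<mu> < 1"
  shows "a \<le> 0"
proof -
  have "(\<lambda>m. K * \<mu> ^ m) \<longlonglongrightarrow> K * 0"
    by (intro tendsto_mult tendsto_const LIMSEQ_power_zero) (use assms in auto)
  then have "(\<lambda>m. K * \<mu> ^ m) \<longlonglongrightarrow> 0" by simp
  then show ?thesis by (rule LIMSEQ_le_const) (use assms(1) in auto)
qed

lemma mpow_invariant:
  assumes "(*v) A ` E = E"
  shows "(*v) (mpow A m) ` E = E"
  using invariant_bundle_funpow[of A "\<lambda>_. E" "\<lambda>x. x" m undefined] assms by simp

text \<open>The components of a fixed vector in \<open>E\<close> and \<open>F\<close> are fixed as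
  well, since their displacements are opposite and hence lie in both subspaces. The exponential
  estimates then leave only zero.\<close>

lemma hyperbolic_no_fixed_vector:
  assumes "hyperbolic_splitting A E F" "A *v x = x"
  shows "x = 0"
proof -
  obtain C \<mu> where C: "C \<ge> 1" "0 < \<mu>" "\<mu> < 1"
    and s: "\<And>m w. w \<in> E \<Longrightarrow> norm (mpow A m *v w) \<le> C * \<mu> ^ m * norm w"
    and u: "\<And>m w. w \<in> F \<Longrightarrow> norm w \<le> C * \<mu> ^ m * norm (mpow A m *v w)"
    using assms(1) unfolding hyperbolic_splitting_def by auto
  have sub: "subspace E" "subspace F" and int: "E \<inter> F = {0}" and inv: "(*v) A ` E = E" "(*v) A ` F = F"
    using assms(1) unfolding hyperbolic_splitting_def by auto
  have "x \<in> {a + b | a b. a \<in> E \<and> b \<in> F}" using assms(1) by (simp add: hyperbolic_splitting_def)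
  then obtain a b where ab: "x = a + b" "a \<in> E" "b \<in> F" by blast
  have "A *v a \<in> E" "A *v b \<in> F" using inv ab by blast+
  moreover have "A *v a + A *v b = a + b" using assms(2) ab(1) by (simp add: matrix_vector_right_distrib)
  then have "A *v a - a = b - A *v b" by (simp add: algebra_simps)
  ultimately have "A *v a - a \<in> E \<inter> F"
    using sub ab by (metis IntI subspace_diff)
  then have "A *v a - a = 0" using int by blast
  with \<open>A *v a - a = b - A *v b\<close> have f: "A *v a = a" "A *v b = b" by simp_all
  have "mpow A m *v a = a" "mpow A m *v b = b" for m
    by (induction m) (simp_all add: f flip: matrix_vector_mul_assoc)
  then have "norm a \<le> (C * norm a) * \<mu> ^ m" "norm b \<le> (C * norm b) * \<mu> ^ m" for m
    using s[OF ab(2), of m] u[OF ab(3), of m] by (simp_all add: mult_ac)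
  then have "norm a \<le> 0" "norm b \<le> 0" using le_zero_if_le_power C by metis+
  then show ?thesis using ab by simp
qed

lemma hyperbolic_affine_fixed_point:
  assumes "hyperbolic_splitting A E F"
  obtains p where "affine_map A v p = p"
proof -
  have "inj ((*v) (mat 1 - A))"
    using hyperbolic_no_fixed_vector[OF assms]
    by (auto simp: linear_injective_0[OF matrix_vector_mul_linear] matrix_vector_mult_diff_rdistrib)
  then have "surj ((*v) (mat 1 - A))"
    using linear_injective_imp_surjective[OF matrix_vector_mul_linear] by blast
  then obtain p where "v = (mat 1 - A) *v p" by blast
  then have "affine_map A v p = p" by (simp add: affine_map_def matrix_vector_mult_diff_rdistrib)
  then show ?thesis using that by blast
qed

lemma anosov_splitting_hyperbolic:
  assumes A: "invertible A" and h: "hyperbolic_splitting A E F"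
  shows "anosov_splitting (\<lambda>_. mat 1) (affine_map A v) (\<lambda>_. E) (\<lambda>_. F)"
  unfolding anosov_splitting_affine_iff[OF A] rnorm_euclidean
  using h constant_subbundle[of E] constant_subbundle[of F] unfolding hyperbolic_splitting_def by blast

text \<open>The orbit of a fixed point does not move, so \<open>g\<close> enters only through the
  single norm at \<open>p\<close>, which dominates a multiple of the Euclidean norm. A vector with
  bounded forward orbit has no component in \<open>F\<close>, one with bounded backward orbit none
  in \<open>E\<close>. Since both pairs are complementary, the resulting inclusions force
  \<open>Es p = E\<close>.\<close>

lemma hyperbolic_splitting_unique:
  assumes A: "invertible A" and h: "hyperbolic_splitting A E F"
    and rg: "riemannian_metric g" and sp: "anosov_splitting g (affine_map A v) Es Eu"
    and p: "affine_map A v p = p"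
  shows "Es p = E"
proof -
  let ?f = "affine_map A v"
  obtain C \<mu> where C: "C \<ge> 1" "0 < \<mu>" "\<mu> < 1"
    and s: "\<And>m w. w \<in> E \<Longrightarrow> norm (mpow A m *v w) \<le> C * \<mu> ^ m * norm w"
    and u: "\<And>m w. w \<in> F \<Longrightarrow> norm w \<le> C * \<mu> ^ m * norm (mpow A m *v w)"
    using h unfolding hyperbolic_splitting_def by auto
  have sub: "subspace E" "subspace F" and int: "E \<inter> F = {0}" and inv: "(*v) A ` E = E" "(*v) A ` F = F"
    using h unfolding hyperbolic_splitting_def by auto
  have dec: "\<exists>a b. x = a + b \<and> a \<in> E \<and> b \<in> F" for x
  proof -
    have "x \<in> {a + b | a b. a \<in> E \<and> b \<in> F}" using h by (simp add: hyperbolic_splitting_def)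
    then show ?thesis by blast
  qed
  have fm: "(?f ^^ m) p = p" for m by (induction m) (simp_all add: p)
  note sp' = sp[unfolded anosov_splitting_affine_iff[OF A]]
  obtain C' \<mu>' where C': "C' \<ge> 1" "0 < \<mu>'" "\<mu>' < 1"
    and s': "\<And>m w. w \<in> Es p \<Longrightarrow> rnorm g p (mpow A m *v w) \<le> C' * \<mu>' ^ m * rnorm g p w"
    and u': "\<And>m w. w \<in> Eu p \<Longrightarrow> rnorm g p w \<le> C' * \<mu>' ^ m * rnorm g p (mpow A m *v w)"
    using sp'[THEN conjunct2, THEN conjunct2, THEN conjunct2, THEN conjunct2] fm by metis
  have inv': "(*v) A ` Eu x = Eu (?f x)" for x
    using sp'[THEN conjunct2, THEN conjunct2, THEN conjunct2, THEN conjunct1] by blast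
  have split: "\<exists>a b. x = a + b \<and> a \<in> Es p \<and> b \<in> Eu p" for x
  proof -
    have "x \<in> {a + b | a b. a \<in> Es p \<and> b \<in> Eu p}"
      using sp'[THEN conjunct2, THEN conjunct2, THEN conjunct1] by simp
    then show ?thesis by blast
  qed
  have subp: "subspace (Es p)"
    using sp' continuous_subbundle_subspace by blast
  obtain c M where c: "c > 0" "\<And>w. c * norm w \<le> rnorm g p w"
    using rnorm_compact_bounds[OF rg, of "{p}"] by (metis compact_sing singletonI)
  have pw: "\<mu> ^ m \<le> 1" "\<mu>' ^ m \<le> 1" for m using C C' by (auto intro: power_le_one)
  have rn0: "rnorm g p w \<ge> 0" for w by (rule rnorm_nonneg[OF rg])
  have EsE: "Es p \<subseteq> E"
  proof
    fix w assume w: "w \<in> Es p"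
    obtain a b where ab: "w = a + b" "a \<in> E" "b \<in> F" using dec by blast
    \<comment> \<open>The forward orbits of \<open>w\<close> and of its component in
      \<open>E\<close> are bounded, hence so is that of \<open>b\<close>; expansion on
      \<open>F\<close> turns this into a bound on \<open>b\<close> that decays with
      \<open>m\<close>.\<close>
    have "norm b \<le> (C * (C' * rnorm g p w / c + C * norm a)) * \<mu> ^ m" for m
    proof -
      have "c * norm (mpow A m *v w) \<le> C' * \<mu>' ^ m * rnorm g p w" using c(2) s'[OF w] by (rule order_trans)
      also have "\<dots> \<le> C' * 1 * rnorm g p w" using C' pw rn0 by (intro mult_right_mono mult_left_mono) auto
      finally have 1: "norm (mpow A m *v w) \<le> C' * rnorm g p w / c" using c(1) by (simp add: field_simps)
      have "norm (mpow A m *v a) \<le> C * 1 * norm a"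
        using s[OF ab(2), of m] C pw by (elim order_trans) (intro mult_right_mono mult_left_mono, auto)
      moreover have "mpow A m *v b = mpow A m *v w - mpow A m *v a"
        by (simp add: ab(1) matrix_vector_right_distrib)
      ultimately have "norm (mpow A m *v b) \<le> C' * rnorm g p w / c + C * norm a"
        using 1 norm_triangle_ineq4[of "mpow A m *v w" "mpow A m *v a"] by simp
      then have "C * \<mu> ^ m * norm (mpow A m *v b) \<le> C * \<mu> ^ m * (C' * rnorm g p w / c + C * norm a)"
        using C by (intro mult_left_mono) auto
      with u[OF ab(3), of m] show ?thesis by (simp add: mult_ac)
    qed
    then have "norm b \<le> 0" using le_zero_if_le_power C by metis
    then show "w \<in> E" using ab by simp
  qed
  have EuF: "Eu p \<subseteq> F"
  proof
    fix w assume w: "w \<in> Eu p"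
    obtain a b where ab: "w = a + b" "a \<in> E" "b \<in> F" using dec by blast
    \<comment> \<open>The mirror image: everything is pulled back by \<open>m\<close> steps, the
      preimages of \<open>w\<close> and \<open>b\<close> are bounded, hence so is that of
      \<open>a\<close>, and contraction on \<open>E\<close> brings the bound forward.\<close>
    have "norm a \<le> (C * (C' * rnorm g p w / c + C * norm b)) * \<mu> ^ m" for m
    proof -
      have "w \<in> (*v) (mpow A m) ` Eu p" using invariant_bundle_funpow[of A Eu ?f m p] inv' w fm by simp
      then obtain w' where w': "w' \<in> Eu p" "mpow A m *v w' = w" by (metis imageE)
      have "a \<in> (*v) (mpow A m) ` E" "b \<in> (*v) (mpow A m) ` F"
        using mpow_invariant[OF inv(1), of m] mpow_invariant[OF inv(2), of m] ab by simp_all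
      then obtain a' b' where a': "a' \<in> E" "mpow A m *v a' = a" and b': "b' \<in> F" "mpow A m *v b' = b"
        by (metis imageE)
      have "mpow A m *v (a' + b') = mpow A m *v w'" using a' b' w' ab(1) by (simp add: matrix_vector_right_distrib)
      from arg_cong[OF this, of "(*v) (mpow (matrix_inv A) m)"] have sum: "a' + b' = w'"
        by (simp add: mpow_matrix_inv_vec[OF A])
      have "c * norm w' \<le> C' * \<mu>' ^ m * rnorm g p w" using c(2) u'[OF w'(1), of m] w'(2) by (metis order_trans)
      also have "\<dots> \<le> C' * 1 * rnorm g p w" using C' pw rn0 by (intro mult_right_mono mult_left_mono) auto
      finally have 1: "norm w' \<le> C' * rnorm g p w / c" using c(1) by (simp add: field_simps)
      have "norm b' \<le> C * 1 * norm b"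
        using u[OF b'(1), of m] C pw unfolding b'(2) by (elim order_trans) (intro mult_right_mono mult_left_mono, auto)
      moreover have "a' = w' - b'" using sum by (simp add: algebra_simps)
      ultimately have "norm a' \<le> C' * rnorm g p w / c + C * norm b"
        using 1 norm_triangle_ineq4[of w' b'] by simp
      then have "C * \<mu> ^ m * norm a' \<le> C * \<mu> ^ m * (C' * rnorm g p w / c + C * norm b)"
        using C by (intro mult_left_mono) auto
      with s[OF a'(1), of m] show ?thesis unfolding a'(2) by (simp add: mult_ac)
    qed
    then have "norm a \<le> 0" using le_zero_if_le_power C by metis
    then show "w \<in> F" using ab by simp
  qed
  show ?thesis
  proof (intro equalityI EsE subsetI)
    fix w assume w: "w \<in> E"
    obtain a b where ab: "w = a + b" "a \<in> Es p" "b \<in> Eu p" using split by blast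
    then have "b = w - a" by simp
    then have "b \<in> E" using w ab EsE sub by (metis subsetD subspace_diff)
    then have "b = 0" using int ab EuF by blast
    then show "w \<in> Es p" using ab by simp
  qed
qed

lemma index_spectrum_hyperbolic:
  assumes A: "invertible A" and h: "hyperbolic_splitting A E F"
  shows "index_spectrum (affine_map A v) = {dim E}" "(A, v) \<in> anosov_pairs"
proof -
  note sp = anosov_splitting_hyperbolic[OF A h, of v] and g = complete_riemannian_metric_euclidean
  have an: "anosov (\<lambda>_. mat 1) (affine_map A v)"
    using sp diffeomorphism_affine_map[OF A] by (auto simp: anosov_def)
  then show "(A, v) \<in> anosov_pairs" using A g by (auto simp: anosov_pairs_def)
  have "dim E \<in> index_spectrum (affine_map A v)"
    unfolding index_spectrum_def using g an sp by blast
  moreover have "k = dim E" if k: "k \<in> index_spectrum (affine_map A v)" for k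
  proof -
    obtain g Es Eu where g: "complete_riemannian_metric g" "anosov_splitting g (affine_map A v) Es Eu" "\<forall>x. dim (Es x) = k"
      using k unfolding index_spectrum_def mem_Collect_eq by metis
    \<comment> \<open>The index is the same at every point, so it may be read off at the fixed
      point.\<close>
    obtain p where p: "affine_map A v p = p" using hyperbolic_affine_fixed_point[OF h] .
    from g(1) have "riemannian_metric g" by (simp add: complete_riemannian_metric_def)
    from hyperbolic_splitting_unique[OF A h this g(2) p] g(3) show ?thesis by metis
  qed
  ultimately show "index_spectrum (affine_map A v) = {dim E}" by blast
qed

section \<open>Stable subspaces of linear operators\<close>

text \<open>Vectors whose orbits decay exponentially, with constants that may depend on the vector.
  This bypasses generalised eigenspaces and applies alike to real matrices, their complexifications
  and their inverses.\<close>

definition stab :: "('a::real_normed_vector \<Rightarrow> 'a) \<Rightarrow> 'a set" where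
  "stab T = {x. \<exists>C \<rho>. 0 < \<rho> \<and> \<rho> < 1 \<and> (\<forall>m. norm ((T ^^ m) x) \<le> C * \<rho> ^ m)}"

lemma stabI: "0 < \<rho> \<Longrightarrow> \<rho> < 1 \<Longrightarrow> (\<And>m. norm ((T ^^ m) x) \<le> C * \<rho> ^ m) \<Longrightarrow> x \<in> stab T"
  unfolding stab_def by blast

lemma stabE:
  assumes "x \<in> stab T"
  obtains C \<rho> where "C \<ge> 0" "0 < \<rho>" "\<rho> < 1" "\<And>m. norm ((T ^^ m) x) \<le> C * \<rho> ^ m"
proof -
  obtain C \<rho> where C: "0 < \<rho>" "\<rho> < 1" "\<And>m. norm ((T ^^ m) x) \<le> C * \<rho> ^ m"
    using assms unfolding stab_def by blast
  have "C \<ge> 0" using C(3)[of 0] norm_ge_zero[of x] by (simp del: norm_ge_zero)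
  then show ?thesis using that C by blast
qed

lemma linear_funpow:
  fixes T :: "'a::real_vector \<Rightarrow> 'a"
  assumes "linear T"
  shows "linear (T ^^ m)"
proof (induction m)
  case 0
  have "T ^^ 0 = id" by auto
  then show ?case using linear_id by metis
next
  case (Suc m)
  then show ?case using linear_compose[OF Suc assms] by (simp add: o_def)
qed

lemma subspace_stab:
  assumes "linear T"
  shows "subspace (stab T)"
proof (rule subspaceI)
  note l = linear_funpow[OF assms]
  show "0 \<in> stab T" by (rule stabI[of "1/2" _ _ 0]) (simp_all add: linear_0[OF l])
  show "x + y \<in> stab T" if xy: "x \<in> stab T" "y \<in> stab T" for x y
  proof -
    obtain C \<rho> where C: "C \<ge> 0" "0 < \<rho>" "\<rho> < 1" "\<And>m. norm ((T ^^ m) x) \<le> C * \<rho> ^ m" by (rule stabE[OF xy(1)], rule that)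
    obtain D \<sigma> where D: "D \<ge> 0" "0 < \<sigma>" "\<sigma> < 1" "\<And>m. norm ((T ^^ m) y) \<le> D * \<sigma> ^ m" by (rule stabE[OF xy(2)], rule that)
    show ?thesis
    proof (rule stabI)
      fix m
      have "norm ((T ^^ m) (x + y)) \<le> norm ((T ^^ m) x) + norm ((T ^^ m) y)"
        by (simp add: linear_add[OF l] norm_triangle_ineq)
      also have "\<dots> \<le> C * \<rho> ^ m + D * \<sigma> ^ m" using C(4) D(4) by (rule add_mono)
      also have "\<dots> \<le> C * max \<rho> \<sigma> ^ m + D * max \<rho> \<sigma> ^ m"
        using C D by (intro add_mono mult_left_mono power_mono) auto
      finally show "norm ((T ^^ m) (x + y)) \<le> (C + D) * max \<rho> \<sigma> ^ m" by (simp add: algebra_simps)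
    qed (use C D in auto)
  qed
  show "c *\<^sub>R x \<in> stab T" if x: "x \<in> stab T" for c x
  proof -
    obtain C \<rho> where C: "C \<ge> 0" "0 < \<rho>" "\<rho> < 1" "\<And>m. norm ((T ^^ m) x) \<le> C * \<rho> ^ m" by (rule stabE[OF x], rule that)
    show ?thesis
      by (rule stabI[OF C(2,3), of _ _ "\<bar>c\<bar> * C"])
        (use C(4) in \<open>auto simp: linear_cmul[OF l] mult.assoc intro!: mult_left_mono\<close>)
  qed
qed

lemma stab_image_iff:
  "T x \<in> stab T \<longleftrightarrow> x \<in> stab T"
proof
  assume x: "T x \<in> stab T"
  obtain C \<rho> where C: "C \<ge> 0" "0 < \<rho>" "\<rho> < 1" "\<And>m. norm ((T ^^ m) (T x)) \<le> C * \<rho> ^ m" by (rule stabE[OF x], rule that)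
  show "x \<in> stab T"
  proof (rule stabI[OF C(2,3)])
    show "norm ((T ^^ m) x) \<le> (norm x + C / \<rho>) * \<rho> ^ m" for m
    proof (cases m)
      case (Suc k)
      have "norm ((T ^^ m) x) \<le> (C / \<rho>) * \<rho> ^ m" using C(4)[of k] C(2) by (simp add: Suc funpow_swap1)
      also have "\<dots> \<le> (norm x + C / \<rho>) * \<rho> ^ m" using C by (intro mult_right_mono) auto
      finally show ?thesis .
    qed (use C in auto)
  qed
next
  assume x: "x \<in> stab T"
  obtain C \<rho> where C: "C \<ge> 0" "0 < \<rho>" "\<rho> < 1" "\<And>m. norm ((T ^^ m) x) \<le> C * \<rho> ^ m" by (rule stabE[OF x], rule that)
  show "T x \<in> stab T"
    by (rule stabI[OF C(2,3), of _ _ "C * \<rho>"]) (use C(4)[of "Suc _"] in \<open>simp add: funpow_swap1 mult_ac\<close>)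
qed

text \<open>An orthonormal basis of the stable space carries finitely many rates; the worst of them,
  with the sum of the constants, serves for all vectors.\<close>

lemma stab_uniform:
  fixes T :: "'a::euclidean_space \<Rightarrow> 'a"
  assumes "linear T"
  obtains C \<rho> where "C \<ge> 1" "0 < \<rho>" "\<rho> < 1" "\<And>m x. x \<in> stab T \<Longrightarrow> norm ((T ^^ m) x) \<le> C * \<rho> ^ m * norm x"
proof -
  note l = linear_funpow[OF assms]
  obtain B where B: "B \<subseteq> stab T" "pairwise orthogonal B" "\<And>b. b \<in> B \<Longrightarrow> norm b = 1" "independent B" "span B = stab T"
    using orthonormal_basis_subspace[OF subspace_stab[OF assms]] by metis
  have fin: "finite B" using B(4) independent_imp_finite by blast
  have "\<forall>b\<in>B. \<exists>C \<rho>. C \<ge> 0 \<and> 0 < \<rho> \<and> \<rho> < 1 \<and> (\<forall>m. norm ((T ^^ m) b) \<le> C * \<rho> ^ m)"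
    using B(1) stabE by (metis subsetD)
  then obtain c r where cr: "\<And>b. b \<in> B \<Longrightarrow> c b \<ge> 0 \<and> 0 < r b \<and> r b < 1 \<and> (\<forall>m. norm ((T ^^ m) b) \<le> c b * r b ^ m)"
    by metis
  \<comment> \<open>The entry 1/2 keeps the maximum meaningful and positive when the basis is
    empty.\<close>
  define \<rho> where "\<rho> = Max (insert (1/2) (r ` B))"
  have \<rho>: "1/2 \<le> \<rho>" "\<And>b. b \<in> B \<Longrightarrow> r b \<le> \<rho>" unfolding \<rho>_def by (rule Max_ge; use fin in simp)+
  have "\<rho> \<in> insert (1/2) (r ` B)" unfolding \<rho>_def by (rule Max_in) (use fin in auto)
  then have "\<rho> < 1" using cr by auto
  show ?thesis
  proof (rule that[of "1 + sum c B" \<rho>])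
    show "1 \<le> 1 + sum c B" using cr by (simp add: sum_nonneg)
    show "0 < \<rho>" "\<rho> < 1" using \<rho>(1) \<open>\<rho> < 1\<close> by auto
    fix m x assume x: "x \<in> stab T"
    have "(T ^^ m) x = (T ^^ m) (\<Sum>b\<in>B. (x \<bullet> b) *\<^sub>R b)"
      using orthonormal_basis_expand[OF B(2) B(3) _ fin, of x] x B(5) by simp
    also have "\<dots> = (\<Sum>b\<in>B. (x \<bullet> b) *\<^sub>R (T ^^ m) b)" by (simp add: linear_sum[OF l] linear_cmul[OF l])
    also have "norm \<dots> \<le> (\<Sum>b\<in>B. norm x * (c b * \<rho> ^ m))"
    proof (rule sum_norm_le)
      fix b assume b: "b \<in> B"
      have "\<bar>x \<bullet> b\<bar> \<le> norm x" using Cauchy_Schwarz_ineq2[of x b] B(3)[OF b] by simp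
      moreover have "norm ((T ^^ m) b) \<le> c b * \<rho> ^ m"
        using cr[OF b] \<rho>(2)[OF b] by (meson less_imp_le mult_left_mono order_trans power_mono)
      ultimately show "norm ((x \<bullet> b) *\<^sub>R (T ^^ m) b) \<le> norm x * (c b * \<rho> ^ m)"
        by (simp add: mult_mono)
    qed
    also have "\<dots> = sum c B * \<rho> ^ m * norm x" by (simp add: sum_distrib_left sum_distrib_right mult_ac)
    also have "\<dots> \<le> (1 + sum c B) * \<rho> ^ m * norm x"
      using \<rho>(1) by (intro mult_right_mono) auto
    finally show "norm ((T ^^ m) x) \<le> (1 + sum c B) * \<rho> ^ m * norm x" .
  qed
qed

lemma inverse_funpow:
  fixes T S :: "'a \<Rightarrow> 'a"
  assumes "\<And>x. T (S x) = x"
  shows "(T ^^ m) ((S ^^ m) x) = x"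
proof (induction m arbitrary: x)
  case (Suc m)
  have "(T ^^ Suc m) ((S ^^ Suc m) x) = (T ^^ m) (T (S ((S ^^ m) x)))" by (simp add: funpow_swap1)
  then show ?case using Suc assms by simp
qed simp

lemma stab_funpow_iff: "(T ^^ m) x \<in> stab T \<longleftrightarrow> x \<in> stab T"
  by (induction m) (simp_all add: stab_image_iff)

text \<open>\<open>x\<close> is the image under \<open>T ^^ m\<close> of \<open>(S ^^ m) x\<close>,
  and these vectors form a bounded sequence in the stable space of \<open>T\<close>, so the norm of
  \<open>x\<close> has a decaying bound. Because the vector to which \<open>T ^^ m\<close> is
  applied varies with \<open>m\<close>, the uniform constants of \<open>stab_uniform\<close> are
  called for.\<close>

lemma stab_Int_inverse:
  fixes T S :: "'a::euclidean_space \<Rightarrow> 'a"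
  assumes T: "linear T" and TS: "\<And>x. T (S x) = x" and x: "x \<in> stab T" "x \<in> stab S"
  shows "x = 0"
proof -
  obtain C \<rho> where C: "C \<ge> 1" "0 < \<rho>" "\<rho> < 1" "\<And>m x. x \<in> stab T \<Longrightarrow> norm ((T ^^ m) x) \<le> C * \<rho> ^ m * norm x"
    by (rule stab_uniform[OF T], rule that)
  obtain D \<sigma> where D: "D \<ge> 0" "0 < \<sigma>" "\<sigma> < 1" "\<And>m. norm ((S ^^ m) x) \<le> D * \<sigma> ^ m" by (rule stabE[OF x(2)], rule that)
  have "norm x \<le> (C * D) * \<rho> ^ m" for m
  proof -
    have "(S ^^ m) x \<in> stab T" using stab_funpow_iff[of m T "(S ^^ m) x"] x(1) by (simp add: inverse_funpow[of T S, OF TS])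
    from C(4)[OF this, of m] have "norm x \<le> C * \<rho> ^ m * norm ((S ^^ m) x)" by (simp add: inverse_funpow[of T S, OF TS])
    also have "\<dots> \<le> C * \<rho> ^ m * (D * 1)"
      using C D(4)[of m] D power_le_one[of \<sigma> m] by (intro mult_left_mono order_trans[OF D(4)]) auto
    finally show ?thesis by (simp add: mult_ac)
  qed
  then have "norm x \<le> 0" using le_zero_if_le_power C by metis
  then show ?thesis by simp
qed

section \<open>The spectral splitting\<close>

definition cvec :: "real^'n \<Rightarrow> complex^'n" where
  "cvec x = (\<chi> i. complex_of_real (x $ i))"

definition rvec :: "complex^'n \<Rightarrow> real^'n" where
  "rvec y = (\<chi> i. Re (y $ i))"

lemma complex_matrix_cvec: "complex_matrix A *v cvec x = cvec (A *v x)"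
  by (simp add: complex_matrix_def cvec_def matrix_vector_mult_def vec_eq_iff)

lemma rvec_complex_matrix: "rvec (complex_matrix A *v y) = A *v rvec y"
  by (simp add: complex_matrix_def rvec_def matrix_vector_mult_def vec_eq_iff)

lemma complex_matrix_mult: "complex_matrix (A ** B) = complex_matrix A ** complex_matrix B"
  by (simp add: complex_matrix_def matrix_matrix_mult_def vec_eq_iff)

lemma complex_matrix_mat1: "complex_matrix (mat 1) = mat 1"
  by (simp add: complex_matrix_def mat_def vec_eq_iff)

lemma norm_cvec: "norm (cvec x) = norm x"
  by (simp add: norm_vec_def cvec_def)

lemma rvec_cvec: "rvec (cvec x) = x"
  by (simp add: rvec_def cvec_def vec_eq_iff)

lemma norm_rvec_le: "norm (rvec y) \<le> norm y"
  unfolding norm_vec_def rvec_def by (intro L2_set_mono) (simp_all add: abs_Re_le_cmod)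

lemma norm_vector_scalar_mult: "norm (c *s y) = cmod c * norm (y :: complex^'n)"
proof -
  have "(\<Sum>i\<in>UNIV. (cmod c * cmod (y $ i))\<^sup>2) = (cmod c)\<^sup>2 * (\<Sum>i\<in>UNIV. (cmod (y $ i))\<^sup>2)"
    by (simp add: power_mult_distrib sum_distrib_left)
  then show ?thesis by (simp add: norm_vec_def L2_set_def norm_mult real_sqrt_mult)
qed

lemma linear_complex_matrix_vector: "linear ((*v) (T :: complex^'n^'m))"
  by (rule linearI) (simp_all add: matrix_vector_mult_def vec_eq_iff distrib_left sum.distrib scaleR_sum_right)

lemma funpow_vector_scalar_mult: "((*v) (T :: complex^'n^'n) ^^ m) (c *s x) = c *s ((*v) T ^^ m) x"
  by (induction m) (simp_all add: vector_scalar_commute)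

lemma funpow_eigenvector:
  assumes "T *v (y :: complex^'n) = c *s y"
  shows "((*v) T ^^ m) y = c ^ m *s y"
  by (induction m) (simp_all add: assms vector_scalar_commute vector_smult_assoc mult.commute)

lemma stab_vector_scalar_mult:
  fixes T :: "complex^'n^'n"
  assumes "x \<in> stab ((*v) T)"
  shows "c *s x \<in> stab ((*v) T)"
proof -
  obtain C \<rho> where C: "C \<ge> 0" "0 < \<rho>" "\<rho> < 1" "\<And>m. norm (((*v) T ^^ m) x) \<le> C * \<rho> ^ m"
    by (rule stabE[OF assms], rule that)
  show ?thesis
    by (rule stabI[OF C(2,3), of _ _ "cmod c * C"])
      (use C(4) in \<open>auto simp: funpow_vector_scalar_mult norm_vector_scalar_mult mult.assoc intro!: mult_left_mono\<close>)
qed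

lemma stab_eigenvector:
  fixes T :: "complex^'n^'n"
  assumes "T *v y = c *s y" "y \<in> stab ((*v) T)" "y \<noteq> 0"
  shows "cmod c < 1"
proof (rule ccontr)
  assume "\<not> cmod c < 1"
  then have c: "cmod c \<ge> 1" by simp
  obtain C \<rho> where C: "C \<ge> 0" "0 < \<rho>" "\<rho> < 1" "\<And>m. norm (((*v) T ^^ m) y) \<le> C * \<rho> ^ m"
    by (rule stabE[OF assms(2)], rule that)
  have "norm y \<le> C * \<rho> ^ m" for m
  proof -
    have "1 * norm y \<le> cmod c ^ m * norm y" using c by (intro mult_right_mono one_le_power) auto
    also have "\<dots> = norm (((*v) T ^^ m) y)"
      by (simp add: funpow_eigenvector[OF assms(1)] norm_vector_scalar_mult norm_power)
    finally show ?thesis using C(4)[of m] by simp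
  qed
  then have "norm y \<le> 0" using le_zero_if_le_power C by metis
  then show False using assms(3) by simp
qed

lemma stab_inverse_eigenvector:
  fixes T S :: "complex^'n^'n"
  assumes TS: "T ** S = mat 1" "S ** T = mat 1" and y: "T *v y = c *s y" "y \<in> stab ((*v) S)" "y \<noteq> 0"
  shows "cmod c > 1"
proof -
  have Sy: "c *s (S *v y) = y"
    using arg_cong[OF y(1), of "(*v) S"] TS by (simp add: matrix_vector_mul_assoc vector_scalar_commute)
  then have c: "c \<noteq> 0" using y(3) by auto
  have "S *v y = inverse c *s y"
    using arg_cong[OF Sy, of "\<lambda>z. inverse c *s z"] c by (simp add: vector_smult_assoc)
  then have "cmod (inverse c) < 1" using stab_eigenvector y by blast
  then show ?thesis using c by (simp add: norm_inverse inverse_less_1_iff)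
qed

text \<open>The orbit of \<open>x\<close> satisfies a first order recursion with factor
  \<open>r\<close> and a decaying inhomogeneity. The new rate is taken strictly above both
  \<open>cmod r\<close> and the given rate, which leaves room when the two coincide and the decay
  may carry a polynomial factor.\<close>

lemma stab_of_shift:
  fixes T :: "complex^'n^'n"
  assumes r: "cmod r < 1" and x: "T *v x - r *s x \<in> stab ((*v) T)"
  shows "x \<in> stab ((*v) T)"
proof -
  let ?y = "T *v x - r *s x"
  obtain C \<rho> where C: "C \<ge> 0" "0 < \<rho>" "\<rho> < 1" "\<And>m. norm (((*v) T ^^ m) ?y) \<le> C * \<rho> ^ m"
    by (rule stabE[OF x], rule that)
  define \<sigma> where "\<sigma> = max (cmod r) \<rho>"
  obtain \<tau> where \<tau>: "\<sigma> < \<tau>" "\<tau> < 1" using dense[of \<sigma> 1] r C by (auto simp: \<sigma>_def)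
  have \<sigma>: "cmod r \<le> \<sigma>" "\<rho> \<le> \<sigma>" "0 < \<sigma>" using C by (auto simp: \<sigma>_def)
  \<comment> \<open>Large enough for the start of the induction and for its step, which requires
    \<open>\<sigma> * D + C \<le> \<tau> * D\<close>.\<close>
  define D where "D = max (norm x) (C / (\<tau> - \<sigma>))"
  have D: "norm x \<le> D" "C \<le> D * (\<tau> - \<sigma>)" "D \<ge> 0"
  proof -
    have "C / (\<tau> - \<sigma>) \<le> D" by (simp add: D_def)
    then show "C \<le> D * (\<tau> - \<sigma>)" using \<tau> by (simp add: field_simps)
    show "norm x \<le> D" by (simp add: D_def)
    then show "D \<ge> 0" by (rule order_trans[OF norm_ge_zero])
  qed
  have bd: "norm (((*v) T ^^ m) x) \<le> D * \<tau> ^ m" for m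
  proof (induction m)
    case (Suc m)
    note l = linear_funpow[OF linear_complex_matrix_vector[of T], of m]
    have "((*v) T ^^ Suc m) x = ((*v) T ^^ m) (r *s x + ?y)" by (simp add: funpow_swap1)
    also have "\<dots> = r *s ((*v) T ^^ m) x + ((*v) T ^^ m) ?y"
      by (simp only: linear_add[OF l] funpow_vector_scalar_mult)
    finally have "norm (((*v) T ^^ Suc m) x) \<le> cmod r * norm (((*v) T ^^ m) x) + norm (((*v) T ^^ m) ?y)"
      by (metis norm_triangle_ineq norm_vector_scalar_mult)
    also have "\<dots> \<le> \<sigma> * (D * \<tau> ^ m) + C * \<tau> ^ m"
    proof (rule add_mono)
      show "cmod r * norm (((*v) T ^^ m) x) \<le> \<sigma> * (D * \<tau> ^ m)"
        using Suc \<sigma> by (intro mult_mono) auto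
      have "C * \<rho> ^ m \<le> C * \<tau> ^ m" using C \<sigma> \<tau> by (intro mult_left_mono power_mono) auto
      then show "norm (((*v) T ^^ m) ?y) \<le> C * \<tau> ^ m" using C(4)[of m] by linarith
    qed
    also have "\<dots> = (\<sigma> * D + C) * \<tau> ^ m" by (simp add: algebra_simps)
    also have "\<dots> \<le> (D * \<tau>) * \<tau> ^ m"
      using D(2) \<tau> \<sigma> by (intro mult_right_mono) (auto simp: algebra_simps)
    finally show ?case by (simp add: mult_ac)
  qed (use D in auto)
  show ?thesis by (rule stabI[OF _ \<tau>(2) bd]) (use \<tau> \<sigma> in auto)
qed

lemma linear_surj_on_subspace:
  fixes L :: "'a::euclidean_space \<Rightarrow> 'a"
  assumes L: "linear L" and W: "subspace W" and im: "\<And>x. x \<in> W \<Longrightarrow> L x \<in> W"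
    and inj: "\<And>x. x \<in> W \<Longrightarrow> L x = 0 \<Longrightarrow> x = 0" and w: "w \<in> W"
  obtains x where "x \<in> W" "L x = w"
proof -
  have "inj_on L W"
  proof (rule inj_onI)
    fix x y assume xy: "x \<in> W" "y \<in> W" "L x = L y"
    then have "L (x - y) = 0" by (simp add: linear_diff[OF L])
    moreover have "x - y \<in> W" using subspace_diff[OF W] xy by blast
    ultimately have "x - y = 0" using inj by blast
    then show "x = y" by simp
  qed
  then have "inj_on L (span W)" using W by (simp add: span_eq_iff[THEN iffD2])
  from dim_image_eq[OF L this] have "dim (L ` W) = dim W" .
  then have "L ` W = W"
    by (intro subspace_dim_equal linear_subspace_image[OF L W] W) (use im in auto)
  with w have "w \<in> L ` W" by simp
  then obtain x where "w = L x" "x \<in> W" by (rule imageE)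
  then show ?thesis by (intro that) simp_all
qed

section \<open>The spectral splitting over the complex numbers\<close>

locale hyperbolic_complex =
  fixes T S :: "complex^'n^'n"
  assumes TS: "T ** S = mat 1" and ST: "S ** T = mat 1"
    and unit: "\<And>c x. cmod c = 1 \<Longrightarrow> T *v x = c *s x \<Longrightarrow> x = 0"
begin

lemma ST_vec: "S *v (T *v x) = x"
  by (simp add: matrix_vector_mul_assoc ST)

definition W :: "(complex^'n) set" where
  "W = {a + b | a b. a \<in> stab ((*v) T) \<and> b \<in> stab ((*v) S)}"

lemma WI: "a \<in> stab ((*v) T) \<Longrightarrow> b \<in> stab ((*v) S) \<Longrightarrow> a + b \<in> W"
  by (auto simp: W_def)

lemma sub_T: "subspace (stab ((*v) T))" and sub_S: "subspace (stab ((*v) S))"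
  by (rule subspace_stab[OF linear_complex_matrix_vector])+

lemma subspace_W: "subspace W"
  unfolding W_def using subspace_sums[OF sub_T sub_S] by simp

lemma W_scale:
  assumes "x \<in> W"
  shows "c *s x \<in> W"
proof -
  obtain a b where "x = a + b" "a \<in> stab ((*v) T)" "b \<in> stab ((*v) S)" using assms by (auto simp: W_def)
  then show ?thesis using WI[of "c *s a" "c *s b"] by (simp add: stab_vector_scalar_mult vector_add_ldistrib)
qed

lemma T_stab_S: "x \<in> stab ((*v) S) \<Longrightarrow> T *v x \<in> stab ((*v) S)"
  using stab_image_iff[of "(*v) S" "T *v x"] by (simp add: ST_vec)

lemma T_stab_T: "x \<in> stab ((*v) T) \<Longrightarrow> T *v x \<in> stab ((*v) T)"
  using stab_image_iff[of "(*v) T" x] by simp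

lemma linear_shift: "linear (\<lambda>x. T *v x - r *s x)"
proof -
  have "linear (\<lambda>x::complex^'n. r *s x)" by (rule linearI) (simp_all add: vec_eq_iff distrib_left)
  then show ?thesis by (intro linear_compose_sub linear_complex_matrix_vector)
qed

lemma shift_stab_S: "cmod r > 1 \<Longrightarrow> T *v x - r *s x \<in> stab ((*v) S) \<Longrightarrow> x \<in> stab ((*v) S)"
proof -
  assume r: "cmod r > 1" and x: "T *v x - r *s x \<in> stab ((*v) S)"
  then have r0: "r \<noteq> 0" by auto
  have "S *v (T *v x - r *s x) \<in> stab ((*v) S)" using x by (simp add: stab_image_iff)
  then have "(- inverse r) *s (S *v (T *v x - r *s x)) \<in> stab ((*v) S)" by (rule stab_vector_scalar_mult)
  moreover have "(- inverse r) *s (S *v (T *v x - r *s x)) = S *v x - inverse r *s x"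
  proof -
    have "S *v (T *v x - r *s x) = x - r *s (S *v x)"
      by (simp add: matrix_vector_mult_diff_distrib ST_vec vector_scalar_commute)
    moreover have "(- inverse r) *s (x - r *s z) = z - inverse r *s x" for z
      using r0 by (simp add: vec_eq_iff field_simps)
    ultimately show ?thesis by simp
  qed
  ultimately have "S *v x - inverse r *s x \<in> stab ((*v) S)" by simp
  then show ?thesis using stab_of_shift[of "inverse r"] r r0 by (simp add: norm_inverse inverse_less_1_iff)
qed

text \<open>For \<open>cmod r < 1\<close> the map T - r is injective on the stable space of
  \<open>S\<close>, since eigenvectors there belong to eigenvalues outside the disc, and hence
  bijective on it. Subtracting a preimage of \<open>b\<close> leaves a vector whose image is stable
  for \<open>T\<close>, so \<open>stab_of_shift\<close> applies. The case \<open>cmod r > 1\<close>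
  exchanges \<open>T\<close> and \<open>S\<close>. For \<open>cmod r = 1\<close> the assumption
  \<open>unit\<close> makes T - r injective everywhere.\<close>

lemma shift_W:
  assumes "T *v y - r *s y \<in> W"
  shows "y \<in> W"
proof -
  let ?L = "\<lambda>x. T *v x - r *s x"
  obtain a b where ab: "?L y = a + b" "a \<in> stab ((*v) T)" "b \<in> stab ((*v) S)"
    using assms by (auto simp: W_def)
  consider "cmod r < 1" | "cmod r = 1" | "cmod r > 1" by linarith
  then show ?thesis
  proof cases
    case 1
    have "?L x \<in> stab ((*v) S)" if "x \<in> stab ((*v) S)" for x
      using T_stab_S[OF that] stab_vector_scalar_mult[OF that] subspace_diff[OF sub_S] by blast
    moreover have "x = 0" if x: "x \<in> stab ((*v) S)" "?L x = 0" for x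
    proof (rule ccontr)
      assume "x \<noteq> 0"
      then have "cmod r > 1" using stab_inverse_eigenvector[OF TS ST _ x(1)] x(2) by simp
      then show False using 1 by simp
    qed
    ultimately obtain b' where b': "b' \<in> stab ((*v) S)" "?L b' = b"
      using linear_surj_on_subspace[OF linear_shift sub_S _ _ ab(3)] by metis
    have "?L (y - b') = a" using linear_diff[OF linear_shift[of r], of y b'] ab(1) b'(2) by simp
    then have "y - b' \<in> stab ((*v) T)" using stab_of_shift[OF 1, of T "y - b'"] ab(2) by simp
    from WI[OF this b'(1)] show ?thesis by simp
  next
    case 2
    have "?L x \<in> W" if x: "x \<in> W" for x
    proof -
      obtain c d where cd: "x = c + d" "c \<in> stab ((*v) T)" "d \<in> stab ((*v) S)"
        using x by (auto simp: W_def)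
      have "T *v x \<in> W" unfolding cd(1) matrix_vector_right_distrib
        by (intro WI T_stab_T T_stab_S cd)
      then show ?thesis using W_scale[OF x] subspace_diff[OF subspace_W] by blast
    qed
    moreover have inj: "x = 0" if x: "?L x = 0" for x
      using unit[OF 2, of x] x by simp
    ultimately obtain y' where y': "y' \<in> W" "?L y' = ?L y"
      using linear_surj_on_subspace[OF linear_shift subspace_W _ _ assms] by metis
    have "?L (y - y') = 0" using linear_diff[OF linear_shift[of r], of y y'] y'(2) by simp
    then have "y = y'" using inj by fastforce
    then show ?thesis using y'(1) by simp
  next
    case 3
    have "?L x \<in> stab ((*v) T)" if "x \<in> stab ((*v) T)" for x
      using T_stab_T[OF that] stab_vector_scalar_mult[OF that] subspace_diff[OF sub_T] by blast
    moreover have "x = 0" if x: "x \<in> stab ((*v) T)" "?L x = 0" for x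
    proof (rule ccontr)
      assume "x \<noteq> 0"
      then have "cmod r < 1" using stab_eigenvector[OF _ x(1)] x(2) by simp
      then show False using 3 by simp
    qed
    ultimately obtain a' where a': "a' \<in> stab ((*v) T)" "?L a' = a"
      using linear_surj_on_subspace[OF linear_shift sub_T _ _ ab(2)] by metis
    have "?L (y - a') = b" using linear_diff[OF linear_shift[of r], of y a'] ab(1) a'(2) by simp
    then have "y - a' \<in> stab ((*v) S)" using shift_stab_S[OF 3, of "y - a'"] ab(3) by simp
    from WI[OF a'(1) this] show ?thesis by (simp add: algebra_simps)
  qed
qed

definition poly_action :: "complex poly \<Rightarrow> complex^'n \<Rightarrow> complex^'n" where
  "poly_action p y = (\<Sum>i\<le>degree p. coeff p i *s ((*v) T ^^ i) y)"

lemma poly_action_eq: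
  assumes "degree p \<le> n"
  shows "poly_action p y = (\<Sum>i\<le>n. coeff p i *s ((*v) T ^^ i) y)"
  unfolding poly_action_def
  by (rule sum.mono_neutral_left) (use assms in \<open>auto simp: coeff_eq_0 not_le\<close>)

lemma poly_action_linear_factor:
  "poly_action ([:- r, 1:] * q) y = T *v poly_action q y - r *s poly_action q y"
proof -
  let ?n = "degree q" and ?t = "\<lambda>i. ((*v) T ^^ i) y"
  have deg: "degree ([:- r, 1:] * q) \<le> Suc ?n" using degree_mult_le[of "[:- r, 1:]" q] by simp
  have c: "coeff ([:- r, 1:] * q) i = (if i = 0 then 0 else coeff q (i - 1)) - r * coeff q i" for i
    by (cases i) (simp_all add: coeff_pCons)
  have "poly_action ([:- r, 1:] * q) y
     = (\<Sum>i\<le>Suc ?n. (if i = 0 then 0 else coeff q (i - 1)) *s ?t i) - (\<Sum>i\<le>Suc ?n. (r * coeff q i) *s ?t i)"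
    unfolding poly_action_eq[OF deg] c by (simp only: vector_sub_rdistrib sum_subtractf)
  also have "(\<Sum>i\<le>Suc ?n. (if i = 0 then 0 else coeff q (i - 1)) *s ?t i) = (\<Sum>i\<le>?n. coeff q i *s ?t (Suc i))"
    by (subst sum.atMost_Suc_shift) simp
  also have "\<dots> = T *v poly_action q y"
    by (simp add: poly_action_def linear_sum[OF linear_complex_matrix_vector] vector_scalar_commute)
  also have "(\<Sum>i\<le>Suc ?n. (r * coeff q i) *s ?t i) = r *s poly_action q y"
    by (simp add: poly_action_def coeff_eq_0 vec_eq_iff sum_distrib_left mult.assoc)
  finally show ?thesis .
qed

text \<open>Over the complex numbers \<open>p\<close> splits into linear factors, and
  \<open>shift_W\<close> removes them one at a time.\<close>

lemma poly_action_W: "p \<noteq> 0 \<Longrightarrow> poly_action p y \<in> W \<Longrightarrow> y \<in> W"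
proof (induction "degree p" arbitrary: p)
  case 0
  then have "coeff p 0 \<noteq> 0" using leading_coeff_neq_0[of p] by simp
  moreover have "coeff p 0 *s y \<in> W" using 0 by (simp add: poly_action_def)
  from W_scale[OF this, of "inverse (coeff p 0)"] have "(inverse (coeff p 0) * coeff p 0) *s y \<in> W"
    by (simp add: vector_smult_assoc)
  ultimately show ?case by simp
next
  case (Suc d)
  have "\<not> constant (poly p)" using Suc.hyps(2) by (simp add: constant_degree)
  then obtain r where "poly p r = 0" using fundamental_theorem_of_algebra by blast
  then obtain q where q: "p = [:- r, 1:] * q" by (metis dvdE poly_eq_0_iff_dvd)
  then have "q \<noteq> 0" using Suc.prems by auto
  then have "degree p = Suc (degree q)" unfolding q by (subst degree_mult_eq) auto
  then have d: "d = degree q" using Suc.hyps(2) by simp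
  have "poly_action q y \<in> W" using Suc.prems(2) unfolding q poly_action_linear_factor by (rule shift_W)
  then show ?case using Suc.hyps(1)[OF d \<open>q \<noteq> 0\<close>] by blast
qed

text \<open>Sufficiently many iterates of \<open>y\<close> are linearly dependent over the reals, so
  a nonzero polynomial annihilates \<open>y\<close>; the value 0 lies in \<open>W\<close>, and
  \<open>poly_action_W\<close> pulls membership back to \<open>y\<close>. A relation for one vector
  suffices, so Cayley-Hamilton is not invoked.\<close>

lemma W_UNIV: "y \<in> W"
proof -
  let ?N = "DIM(complex^'n)" and ?f = "\<lambda>i. ((*v) T ^^ i) y"
  have "\<exists>c :: nat \<Rightarrow> real. (\<exists>i\<le>?N. c i \<noteq> 0) \<and> (\<Sum>i\<le>?N. c i *\<^sub>R ?f i) = 0"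
  proof (cases "inj_on ?f {..?N}")
    case True
    then have "card (?f ` {..?N}) = Suc ?N" by (simp add: card_image)
    then have "dependent (?f ` {..?N})" using independent_bound[of "?f ` {..?N}"] by auto
    then obtain u where u: "\<exists>v\<in>?f ` {..?N}. u v \<noteq> 0" "(\<Sum>v\<in>?f ` {..?N}. u v *\<^sub>R v) = 0"
      by (subst (asm) dependent_finite) auto
    then show ?thesis
      using u(2)[unfolded sum.reindex[OF True] o_def] by (intro exI[of _ "\<lambda>i. u (?f i)"]) auto
  next
    case False
    \<comment> \<open>Dependence of a set says nothing about repeated members; two equal iterates
      give the relation directly.\<close>
    then obtain i j where ij: "i \<le> ?N" "j \<le> ?N" "i \<noteq> j" "?f i = ?f j" unfolding inj_on_def by blast
    let ?c = "\<lambda>k. (if k = i then 1 else 0) - (if k = j then 1 else (0::real))"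
    have "(\<Sum>k\<le>?N. ?c k *\<^sub>R ?f k) = (\<Sum>k\<le>?N. (if k = i then ?f k else 0) - (if k = j then ?f k else 0))"
      using ij(3) by (intro sum.cong refl) auto
    also have "\<dots> = 0" using ij by (simp add: sum_subtractf)
    finally show ?thesis using ij by (intro exI[of _ ?c]) auto
  qed
  then obtain c :: "nat \<Rightarrow> real" and i0 where c: "i0 \<le> ?N" "c i0 \<noteq> 0" "(\<Sum>i\<le>?N. c i *\<^sub>R ?f i) = 0" by blast
  define p where "p = (\<Sum>i\<le>?N. monom (complex_of_real (c i)) i)"
  have co: "coeff p i = (if i \<le> ?N then complex_of_real (c i) else 0)" for i
    by (simp add: p_def coeff_sum)
  then have "p \<noteq> 0" using c by (metis coeff_0 of_real_eq_0_iff)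
  have "degree p \<le> ?N" by (rule degree_le) (simp add: co)
  then have "poly_action p y = (\<Sum>i\<le>?N. complex_of_real (c i) *s ?f i)" by (simp add: poly_action_eq co)
  moreover have "complex_of_real a *s z = a *\<^sub>R z" for a and z :: "complex^'n"
    by (simp add: vec_eq_iff scaleR_conv_of_real[where 'a = complex])
  ultimately have "poly_action p y = 0" using c(3) by simp
  then have "poly_action p y \<in> W" using subspace_0[OF subspace_W] by simp
  with \<open>p \<noteq> 0\<close> show ?thesis by (rule poly_action_W)
qed

end

lemma funpow_cvec: "((*v) (complex_matrix A) ^^ m) (cvec x) = cvec (((*v) A ^^ m) x)"
  by (induction m) (simp_all add: complex_matrix_cvec)

lemma funpow_rvec: "rvec (((*v) (complex_matrix A) ^^ m) y) = ((*v) A ^^ m) (rvec y)"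
  by (induction m) (simp_all add: rvec_complex_matrix)

lemma stab_cvec: "x \<in> stab ((*v) A) \<Longrightarrow> cvec x \<in> stab ((*v) (complex_matrix A))"
  unfolding stab_def by (simp add: funpow_cvec norm_cvec)

lemma stab_rvec:
  assumes "y \<in> stab ((*v) (complex_matrix A))"
  shows "rvec y \<in> stab ((*v) A)"
proof -
  obtain C \<rho> where C: "C \<ge> 0" "0 < \<rho>" "\<rho> < 1" "\<And>m. norm (((*v) (complex_matrix A) ^^ m) y) \<le> C * \<rho> ^ m"
    by (rule stabE[OF assms], rule that)
  show ?thesis
    by (rule stabI[OF C(2,3), of _ _ C]) (use C(4) norm_rvec_le in \<open>auto simp: funpow_rvec[symmetric] intro: order_trans\<close>)
qed

lemma mpow_funpow: "mpow A m *v x = ((*v) A ^^ m) x"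
  by (induction m) (simp_all flip: matrix_vector_mul_assoc)

lemma linear_image_eqI:
  assumes "\<And>x. x \<in> E \<Longrightarrow> f x \<in> E" "\<And>x. x \<in> E \<Longrightarrow> g x \<in> E" "\<And>x. f (g x) = x"
  shows "f ` E = E"
  using assms by (metis (no_types, lifting) image_iff subsetI subset_antisym)

text \<open>The decomposition is obtained for the complexified matrix and carried back by taking
  real parts, which commutes with the real matrix and does not increase norms. Trivial intersection,
  invariance and the estimates are proved for the real stable spaces directly.\<close>

lemma hyperbolic_splitting_stab:
  fixes A :: "real^'n^'n"
  assumes A: "invertible A" and unit: "\<And>c. c \<in> spectrum A \<Longrightarrow> norm c \<noteq> 1"
  shows "hyperbolic_splitting A (stab ((*v) A)) (stab ((*v) (matrix_inv A)))"
proof -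
  let ?E = "stab ((*v) A)" and ?F = "stab ((*v) (matrix_inv A))"
  have lin: "linear ((*v) A)" "linear ((*v) (matrix_inv A))" by (rule matrix_vector_mul_linear)+
  note inv = matrix_inv_vec[OF A]
  interpret H: hyperbolic_complex "complex_matrix A" "complex_matrix (matrix_inv A)"
  proof
    show "complex_matrix A ** complex_matrix (matrix_inv A) = mat 1"
      "complex_matrix (matrix_inv A) ** complex_matrix A = mat 1"
      by (simp_all add: matrix_inv_mult[OF A] complex_matrix_mat1 flip: complex_matrix_mult)
    show "x = 0" if "cmod c = 1" "complex_matrix A *v x = c *s x" for c x
      using unit[of c] that by (auto simp: spectrum_def)
  qed
  obtain C \<rho> where C: "C \<ge> 1" "0 < \<rho>" "\<rho> < 1" "\<And>m x. x \<in> ?E \<Longrightarrow> norm (((*v) A ^^ m) x) \<le> C * \<rho> ^ m * norm x"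
    by (rule stab_uniform[OF lin(1)], rule that)
  obtain D \<sigma> where D: "D \<ge> 1" "0 < \<sigma>" "\<sigma> < 1" "\<And>m x. x \<in> ?F \<Longrightarrow> norm (((*v) (matrix_inv A) ^^ m) x) \<le> D * \<sigma> ^ m * norm x"
    by (rule stab_uniform[OF lin(2)], rule that)
  have AF: "A *v x \<in> ?F" if "x \<in> ?F" for x
    using stab_image_iff[of "(*v) (matrix_inv A)" "A *v x"] that by (simp add: inv)
  have AF': "matrix_inv A *v x \<in> ?F" if "x \<in> ?F" for x
    using stab_image_iff[of "(*v) (matrix_inv A)" x] that by simp
  have AE: "A *v x \<in> ?E" if "x \<in> ?E" for x
    using stab_image_iff[of "(*v) A" x] that by simp
  have AE': "matrix_inv A *v x \<in> ?E" if "x \<in> ?E" for x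
    using stab_image_iff[of "(*v) A" "matrix_inv A *v x"] that by (simp add: inv)
  have AmF: "((*v) A ^^ m) x \<in> ?F" if "x \<in> ?F" for x m
    by (induction m) (simp_all add: that AF)
  let ?\<mu> = "max \<rho> \<sigma>" and ?C = "max C D"
  have le: "C * \<rho> ^ m \<le> ?C * ?\<mu> ^ m" "D * \<sigma> ^ m \<le> ?C * ?\<mu> ^ m" for m
    using C D by (auto intro!: mult_mono power_mono)
  show ?thesis
    unfolding hyperbolic_splitting_def
  proof (intro conjI)
    show sub: "subspace ?E" "subspace ?F" by (rule subspace_stab[OF lin(1)], rule subspace_stab[OF lin(2)])
    show "?E \<inter> ?F = {0}"
    proof (intro equalityI subsetI)
      fix x assume "x \<in> ?E \<inter> ?F"
      then have "x = 0" using stab_Int_inverse[OF lin(1), of "(*v) (matrix_inv A)" x] inv by simp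
      then show "x \<in> {0}" by simp
    qed (use sub in \<open>auto simp: subspace_0\<close>)
    have "\<exists>a b. x = a + b \<and> a \<in> ?E \<and> b \<in> ?F" for x
    proof -
      obtain a b where "cvec x = a + b" and ab: "a \<in> stab ((*v) (complex_matrix A))"
        "b \<in> stab ((*v) (complex_matrix (matrix_inv A)))"
        using H.W_UNIV[of "cvec x"] unfolding H.W_def by blast
      then have "rvec (cvec x) = rvec a + rvec b" by (simp add: rvec_def vec_eq_iff)
      then show ?thesis using stab_rvec[OF ab(1)] stab_rvec[OF ab(2)] unfolding rvec_cvec by blast
    qed
    then show "{a + b | a b. a \<in> ?E \<and> b \<in> ?F} = UNIV" by auto
    show "(*v) A ` ?E = ?E" by (rule linear_image_eqI[of _ _ "(*v) (matrix_inv A)"]) (simp_all add: AE AE' inv)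
    show "(*v) A ` ?F = ?F" by (rule linear_image_eqI[of _ _ "(*v) (matrix_inv A)"]) (simp_all add: AF AF' inv)
    show "\<exists>C \<mu>. C \<ge> 1 \<and> 0 < \<mu> \<and> \<mu> < 1 \<and> (\<forall>m. \<forall>w\<in>?E. norm (mpow A m *v w) \<le> C * \<mu> ^ m * norm w) \<and>
       (\<forall>m. \<forall>w\<in>?F. norm w \<le> C * \<mu> ^ m * norm (mpow A m *v w))"
    proof (rule exI[of _ ?C], rule exI[of _ ?\<mu>], intro conjI allI ballI)
      show "norm (mpow A m *v w) \<le> ?C * ?\<mu> ^ m * norm w" if "w \<in> ?E" for m w
        using C(4)[OF that, of m] mult_right_mono[OF le(1)[of m] norm_ge_zero[of w]] by (simp add: mpow_funpow)
      \<comment> \<open>Decay under the inverse is applied to the \<open>m\<close>-th image of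
        \<open>w\<close>.\<close>
      show "norm w \<le> ?C * ?\<mu> ^ m * norm (mpow A m *v w)" if "w \<in> ?F" for m w
        using D(4)[OF AmF[OF that, of m], of m] mult_right_mono[OF le(2)[of m] norm_ge_zero[of "((*v) A ^^ m) w"]]
          inverse_funpow[of "(*v) (matrix_inv A)" "(*v) A" m w, OF inv(2)] by (simp add: mpow_funpow)
    qed (use C D in auto)
  qed
qed

section \<open>Characteristic polynomials and the dimension of the stable space\<close>

lemma poly_det:
  fixes N :: "'a::comm_ring_1 poly^'n^'n"
  shows "poly (det N) c = det (\<chi> i j. poly (N $ i $ j) c)"
  by (simp add: det_def poly_sum poly_prod)

lemma det_eq_0_iff_kernel:
  fixes M :: "'a::field^'n^'n"
  shows "det M = 0 \<longleftrightarrow> (\<exists>x. x \<noteq> 0 \<and> M *v x = 0)"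
  using invertible_det_nz[of M] invertible_left_inverse[of M] matrix_left_invertible_ker[of M] by blast

text \<open>In the Leibniz expansion only the identity permutation attains degree
  \<open>card S\<close>: one that moves an index outside \<open>S\<close> meets a zero entry, and
  one that moves an index of \<open>S\<close> loses a linear factor there. For
  \<open>S = UNIV\<close> this concerns an ordinary characteristic polynomial; a smaller
  \<open>S\<close> describes the characteristic matrix of a diagonal block padded by identity
  rows.\<close>

lemma det_partial_charpoly:
  fixes N :: "'a::idom poly^'n^'n"
  assumes diag: "\<And>i. i \<in> S \<Longrightarrow> \<exists>b. N $ i $ i = [:b, 1:]"
    and off: "\<And>i j. i \<in> S \<Longrightarrow> i \<noteq> j \<Longrightarrow> degree (N $ i $ j) = 0"
    and out: "\<And>i j. i \<notin> S \<Longrightarrow> N $ i $ j = (if i = j then 1 else 0)"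
  shows "degree (det N) = card S" "lead_coeff (det N) = 1"
proof -
  let ?P = "{p. p permutes (UNIV :: 'n set)}" and ?Q = "\<Prod>i\<in>UNIV. N $ i $ i"
  have fin: "finite ?P" by (simp add: finite_permutations)
  have nz: "N $ i $ i \<noteq> 0" for i using diag[of i] out[of i i] by (cases "i \<in> S") auto
  have degi: "degree (N $ i $ i) = (if i \<in> S then 1 else 0)" for i
    using diag[of i] out[of i i] by (cases "i \<in> S") auto
  have lci: "lead_coeff (N $ i $ i) = 1" for i
    using diag[of i] out[of i i] by (cases "i \<in> S") auto
  have degQ: "degree ?Q = card S"
    by (subst degree_prod_sum_eq) (auto simp: nz degi sum.If_cases)
  have lcQ: "lead_coeff ?Q = 1" by (simp add: lead_coeff_prod lci)
  have small: "coeff (of_int (sign p) * (\<Prod>i\<in>UNIV. N $ i $ p i)) k = 0"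
    if p: "p \<in> ?P - {id}" and k: "k \<ge> card S" for p k
  proof -
    obtain i where i: "p i \<noteq> i" using p by (auto simp: fun_eq_iff)
    have "coeff (\<Prod>i\<in>UNIV. N $ i $ p i) k = 0"
    proof (cases "\<forall>j. p j \<noteq> j \<longrightarrow> j \<in> S")
      case False
      then obtain j where "p j \<noteq> j" "j \<notin> S" by blast
      then have "N $ j $ p j = 0" using out[of j "p j"] by auto
      then have "(\<Prod>i\<in>UNIV. N $ i $ p i) = 0" by (intro prod_zero) auto
      then show ?thesis by (metis coeff_0)
    next
      case True
      then have iS: "i \<in> S" using i by blast
      have "degree (N $ j $ p j) \<le> (if j \<in> S - {i} then 1 else 0)" for j
        using True off[of j "p j"] off[of i "p i"] i iS degi[of j] by (cases "p j = j"; cases "j = i") auto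
      then have "(\<Sum>j\<in>UNIV. degree (N $ j $ p j)) \<le> (\<Sum>j\<in>UNIV. if j \<in> S - {i} then 1 else 0)" by (intro sum_mono)
      also have "\<dots> = card (S - {i})" by (simp add: sum.If_cases Int_def del: Diff_iff)
      also have "\<dots> < card S" by (intro psubset_card_mono) (use iS in auto)
      finally have "degree (\<Prod>i\<in>UNIV. N $ i $ p i) < card S"
        using degree_prod_sum_le[of UNIV "\<lambda>i. N $ i $ p i"] by (simp add: o_def)
      then show ?thesis using k by (intro coeff_eq_0) simp
    qed
    then show ?thesis by (cases "sign p = 1") (auto simp: sign_def split: if_splits)
  qed
  have "coeff (det N) k = coeff ?Q k" if "k \<ge> card S" for k
  proof -
    have "coeff (det N) k = (\<Sum>p\<in>?P. coeff (of_int (sign p) * (\<Prod>i\<in>UNIV. N $ i $ p i)) k)"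
      by (simp add: det_def coeff_sum)
    also have "\<dots> = coeff (of_int (sign id) * (\<Prod>i\<in>UNIV. N $ i $ id i)) k
        + (\<Sum>p\<in>?P - {id}. coeff (of_int (sign p) * (\<Prod>i\<in>UNIV. N $ i $ p i)) k)"
      by (subst sum.remove[OF fin, of id]) (simp_all add: permutes_id)
    also have "(\<Sum>p\<in>?P - {id}. coeff (of_int (sign p) * (\<Prod>i\<in>UNIV. N $ i $ p i)) k) = 0"
      by (rule sum.neutral) (use small that in blast)
    finally show ?thesis by (simp add: sign_id)
  qed
  then have c: "coeff (det N) (card S) = 1" "\<And>k. k > card S \<Longrightarrow> coeff (det N) k = 0"
    using degQ lcQ coeff_eq_0[of ?Q] by simp_all
  have "degree (det N) \<le> card S" by (rule degree_le) (use c(2) in blast)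
  moreover have "card S \<le> degree (det N)" by (rule le_degree) (simp add: c(1))
  ultimately show "degree (det N) = card S" by simp
  then show "lead_coeff (det N) = 1" using c(1) by simp
qed

lemma charpoly_monic:
  fixes M :: "'a::idom^'n^'n"
  shows "degree (charpoly M) = CARD('n)" "lead_coeff (charpoly M) = 1" "charpoly M \<noteq> 0"
proof -
  note d = det_partial_charpoly[of UNIV "mat [:0, 1:] - map_matrix (\<lambda>a. [:a:]) M", folded charpoly_def]
  show 1: "degree (charpoly M) = CARD('n)" by (rule d) (auto simp: mat_def)
  show 2: "lead_coeff (charpoly M) = 1" by (rule d) (auto simp: mat_def)
  then show "charpoly M \<noteq> 0" by auto
qed

lemma poly_charpoly:
  fixes M :: "'a::comm_ring_1^'n^'n"
  shows "poly (charpoly M) c = det (mat c - M)"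
proof -
  have "(\<chi> i j. poly ((mat [:0, 1:] - map_matrix (\<lambda>a. [:a:]) M) $ i $ j) c) = mat c - M"
    by (simp add: vec_eq_iff mat_def)
  then show ?thesis by (simp add: charpoly_def poly_det)
qed

lemma mat_vec: "mat c *v x = c *s (x :: 'a::comm_semiring_1^'n)"
  by (simp add: vec_eq_iff matrix_vector_mult_def mat_def if_distrib if_distribR cong: if_cong)

lemma mem_spectrum_iff: "c \<in> spectrum A \<longleftrightarrow> poly (charpoly (complex_matrix A)) c = 0"
proof -
  have "(mat c - complex_matrix A) *v x = 0 \<longleftrightarrow> complex_matrix A *v x = c *s x" for x
    by (auto simp: matrix_vector_mult_diff_rdistrib mat_vec)
  then show ?thesis by (simp add: spectrum_def poly_charpoly det_eq_0_iff_kernel)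
qed

definition poly_matrix :: "real^'n^'m \<Rightarrow> complex poly^'n^'m" where
  "poly_matrix M = (\<chi> i j. [:complex_of_real (M $ i $ j):])"

lemma sum_pCons_0: "(\<Sum>i\<in>I. [:f i:]) = [:\<Sum>i\<in>I. f i:]"
  by (induction I rule: infinite_finite_induct) simp_all

lemma poly_matrix_mult: "poly_matrix (A ** B) = poly_matrix A ** poly_matrix B"
  by (simp add: poly_matrix_def matrix_matrix_mult_def vec_eq_iff sum_pCons_0 mult.commute)

lemma poly_matrix_mat1: "poly_matrix (mat 1) = mat 1"
  by (simp add: poly_matrix_def mat_def vec_eq_iff)

lemma charpoly_complex_matrix: "charpoly (complex_matrix A) = det (mat [:0, 1:] - poly_matrix A)"
proof -
  have "map_matrix (\<lambda>a. [:a:]) (complex_matrix A) = poly_matrix A"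
    by (simp add: vec_eq_iff complex_matrix_def poly_matrix_def)
  then show ?thesis by (simp add: charpoly_def)
qed

lemma mat_mult_commute: "mat c ** M = M ** mat (c :: 'a::comm_semiring_1)"
  by (simp add: vec_eq_iff matrix_matrix_mult_def mat_def if_distrib if_distribR mult.commute cong: if_cong)

lemma matrix_diff_mult:
  fixes A B :: "'a::ring_1^'n^'m"
  shows "(A - B) ** C = A ** C - B ** C"
  by (simp add: vec_eq_iff matrix_matrix_mult_def left_diff_distrib sum_subtractf)

lemma matrix_mult_diff:
  fixes A B :: "'a::ring_1^'n^'m"
  shows "C ** (A - B) = C ** A - C ** B"
  by (simp add: vec_eq_iff matrix_matrix_mult_def right_diff_distrib sum_subtractf)

lemma charpoly_similar:
  fixes A P Q :: "real^'n^'n"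
  assumes "Q ** P = mat 1"
  shows "charpoly (complex_matrix (Q ** A ** P)) = charpoly (complex_matrix A)"
proof -
  let ?X = "mat [:0, 1:] :: complex poly^'n^'n"
  have QP: "poly_matrix Q ** poly_matrix P = mat 1"
    by (simp add: assms poly_matrix_mat1 flip: poly_matrix_mult)
  have "poly_matrix Q ** (?X - poly_matrix A) ** poly_matrix P = ?X - poly_matrix (Q ** A ** P)"
  proof -
    have "poly_matrix Q ** (?X - poly_matrix A) ** poly_matrix P
       = poly_matrix Q ** ?X ** poly_matrix P - poly_matrix Q ** poly_matrix A ** poly_matrix P"
      by (simp only: matrix_diff_mult matrix_mult_diff)
    also have "poly_matrix Q ** ?X ** poly_matrix P = ?X ** (poly_matrix Q ** poly_matrix P)"
      by (simp only: mat_mult_commute[symmetric] matrix_mul_assoc)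
    finally show ?thesis by (simp add: QP poly_matrix_mult)
  qed
  then have "det (?X - poly_matrix (Q ** A ** P)) = det (poly_matrix Q) * det (?X - poly_matrix A) * det (poly_matrix P)"
    by (metis det_mul)
  also have "\<dots> = det (poly_matrix Q ** poly_matrix P) * det (?X - poly_matrix A)"
    by (simp add: det_mul)
  finally show ?thesis by (simp add: charpoly_complex_matrix QP)
qed

text \<open>The columns of \<open>P\<close> with index in \<open>S\<close> form a basis of
  \<open>E\<close>, the others a basis of \<open>F\<close>. Marking a block by a set of indices
  keeps all matrices of one type.\<close>

lemma adapted_basis_matrix:
  fixes E F :: "(real^'n) set"
  assumes E: "subspace E" and F: "subspace F" and int: "E \<inter> F = {0}"
    and sum: "{a + b | a b. a \<in> E \<and> b \<in> F} = UNIV"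
  obtains P :: "real^'n^'n" and S where "card S = dim E" "invertible P"
    "\<forall>j\<in>S. P *v axis j 1 \<in> E" "\<forall>j\<in>-S. P *v axis j 1 \<in> F"
    "\<forall>x\<in>E. \<forall>i\<in>-S. (matrix_inv P *v x) $ i = 0"
    "\<forall>x\<in>F. \<forall>i\<in>S. (matrix_inv P *v x) $ i = 0"
proof -
  have dims: "dim E + dim F = CARD('n)"
    using dim_sums_Int[OF E F] int sum by simp
  obtain S :: "'n set" where S: "card S = dim E"
    using obtain_subset_with_card_n[of "dim E" "UNIV :: 'n set"] dims by auto
  have cS: "card (- S) = dim F" using dims S by (simp add: Compl_eq_Diff_UNIV card_Diff_subset)
  obtain B where B: "B \<subseteq> E" "independent B" "E \<subseteq> span B" "card B = dim E" using basis_exists by blast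
  obtain D where D: "D \<subseteq> F" "independent D" "F \<subseteq> span D" "card D = dim F" using basis_exists by blast
  have fin: "finite B" "finite D" using B(2) D(2) independent_imp_finite by blast+
  obtain b where b: "bij_betw b S B" using finite_same_card_bij[of S B] fin B(4) S by auto
  obtain d where d: "bij_betw d (- S) D" using finite_same_card_bij[of "- S" D] fin D(4) cS by auto
  define h where "h j = (if j \<in> S then b j else d j)" for j
  define P :: "real^'n^'n" where "P = (\<chi> i j. h j $ i)"
  have col: "P *v axis j 1 = h j" for j
    by (simp add: P_def vec_eq_iff matrix_vector_mult_def axis_def if_distrib cong: if_cong)
  have hE: "h j \<in> E" if "j \<in> S" for j
    using that b B(1) by (auto simp: h_def bij_betw_def)
  have hF: "h j \<in> F" if "j \<notin> S" for j
    using that d D(1) by (auto simp: h_def bij_betw_def)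
  have hS: "h ` S = B" "h ` (- S) = D"
    using b d by (auto simp: h_def bij_betw_def image_def)
  have EP: "E \<subseteq> range ((*v) P)" "F \<subseteq> range ((*v) P)"
  proof -
    have sub: "subspace (range ((*v) P))" by (intro linear_subspace_image matrix_vector_mul_linear subspace_UNIV)
    have hr: "h j \<in> range ((*v) P)" for j by (metis col rangeI)
    have "B \<subseteq> range ((*v) P)" "D \<subseteq> range ((*v) P)" unfolding hS[symmetric] using hr by blast+
    then show "E \<subseteq> range ((*v) P)" "F \<subseteq> range ((*v) P)"
      using span_minimal[OF _ sub] B(3) D(3) by (meson order_trans)+
  qed
  have "surj ((*v) P)"
  proof -
    have "x \<in> range ((*v) P)" for x
    proof -
      have "x \<in> {a + b | a b. a \<in> E \<and> b \<in> F}" using sum by simp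
      then obtain u w where "x = u + w" "u \<in> E" "w \<in> F" by blast
      then obtain u' w' where "x = P *v u' + P *v w'" using EP by blast
      then have "x = P *v (u' + w')" by (simp add: matrix_vector_right_distrib)
      then show ?thesis by blast
    qed
    then show ?thesis by blast
  qed
  then have P: "invertible P"
    using matrix_right_invertible_surjective[of P] invertible_right_inverse[of P] by simp
  have Qh: "matrix_inv P *v h j = axis j 1" for j
    using matrix_inv_vec(2)[OF P, of "axis j 1"] by (simp add: col)
  have sub: "subspace {x. (matrix_inv P *v x) $ i = 0}" for i
    by (simp add: subspace_def matrix_vector_right_distrib matrix_vector_mult_scaleR)
  have zE: "(matrix_inv P *v x) $ i = 0" if x: "x \<in> E" "i \<notin> S" for x i
  proof -
    have "B \<subseteq> {x. (matrix_inv P *v x) $ i = 0}" unfolding hS[symmetric] using x(2) by (auto simp: Qh axis_def)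
    from span_minimal[OF this sub] show ?thesis using B(3) x(1) by blast
  qed
  have zF: "(matrix_inv P *v x) $ i = 0" if x: "x \<in> F" "i \<in> S" for x i
  proof -
    have "D \<subseteq> {x. (matrix_inv P *v x) $ i = 0}" unfolding hS[symmetric] using x(2) by (auto simp: Qh axis_def)
    from span_minimal[OF this sub] show ?thesis using D(3) x(1) by blast
  qed
  show ?thesis by (rule that[OF S P]) (simp_all add: col hE hF zE zF)
qed

lemma stab_cvec_combination:
  assumes "\<And>j. w $ j \<noteq> 0 \<Longrightarrow> P *v axis j 1 \<in> stab ((*v) A)"
  shows "complex_matrix P *v w \<in> stab ((*v) (complex_matrix A))"
proof -
  have sub: "subspace (stab ((*v) (complex_matrix A)))" by (rule subspace_stab[OF linear_complex_matrix_vector])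
  have "complex_matrix P *v w = (\<Sum>j\<in>UNIV. w $ j *s column j (complex_matrix P))" by (rule matrix_mult_sum)
  also have "\<dots> = (\<Sum>j\<in>UNIV. w $ j *s cvec (P *v axis j 1))"
    by (intro sum.cong refl arg_cong[of _ _ "(*s) _"])
      (simp add: column_def cvec_def complex_matrix_def vec_eq_iff matrix_vector_mult_def axis_def if_distrib cong: if_cong)
  also have "\<dots> \<in> stab ((*v) (complex_matrix A))"
  proof (intro subspace_sum[OF sub])
    fix j
    show "w $ j *s cvec (P *v axis j 1) \<in> stab ((*v) (complex_matrix A))"
      using assms[of j] subspace_0[OF sub] by (cases "w $ j = 0") (auto intro: stab_vector_scalar_mult stab_cvec)
  qed
  finally show ?thesis .
qed

lemma sum_delta_mult:
  fixes w :: "'n::finite \<Rightarrow> 'a::semiring_1"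
  shows "(\<Sum>j\<in>UNIV. (if i = j then c else 0) * w j) = c * w i"
  by (subst sum.cong[OF refl, of _ _ "\<lambda>j. if j = i then c * w j else 0"]) auto

text \<open>In a basis adapted to the splitting the matrix is block diagonal, so the characteristic
  polynomial is a product of two factors. A root of the first yields an eigenvector in the stable
  space, hence lies inside the disc; a root of the second lies outside. The roots inside, with
  multiplicity, are thus counted by the degree of the first factor, which is the dimension.\<close>

lemma dim_stab:
  fixes A :: "real^'n^'n"
  assumes A: "invertible A" and unit: "\<And>c. c \<in> spectrum A \<Longrightarrow> norm c \<noteq> 1"
  shows "dim (stab ((*v) A)) = size (filter_mset (\<lambda>c. norm c < 1) (proots (charpoly (complex_matrix A))))"
proof -
  let ?E = "stab ((*v) A)" and ?F = "stab ((*v) (matrix_inv A))"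
  have h: "hyperbolic_splitting A ?E ?F" by (rule hyperbolic_splitting_stab[OF A unit])
  then have sub: "subspace ?E" "subspace ?F" and int: "?E \<inter> ?F = {0}"
    and sum: "{a + b | a b. a \<in> ?E \<and> b \<in> ?F} = UNIV" and inv: "(*v) A ` ?E = ?E" "(*v) A ` ?F = ?F"
    by (simp_all add: hyperbolic_splitting_def)
  obtain P :: "real^'n^'n" and S where S: "card S = dim ?E" and P: "invertible P"
    and "\<forall>j\<in>S. P *v axis j 1 \<in> ?E" "\<forall>j\<in>-S. P *v axis j 1 \<in> ?F"
    "\<forall>x\<in>?E. \<forall>i\<in>-S. (matrix_inv P *v x) $ i = 0" "\<forall>x\<in>?F. \<forall>i\<in>S. (matrix_inv P *v x) $ i = 0"
    by (rule adapted_basis_matrix[OF sub int sum], rule that)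
  then have PE: "\<And>j. j \<in> S \<Longrightarrow> P *v axis j 1 \<in> ?E" and PF: "\<And>j. j \<notin> S \<Longrightarrow> P *v axis j 1 \<in> ?F"
    and QE: "\<And>x i. x \<in> ?E \<Longrightarrow> i \<notin> S \<Longrightarrow> (matrix_inv P *v x) $ i = 0"
    and QF: "\<And>x i. x \<in> ?F \<Longrightarrow> i \<in> S \<Longrightarrow> (matrix_inv P *v x) $ i = 0"
    by auto
  define B where "B = matrix_inv P ** A ** P"
  have Bij: "B $ i $ j = (matrix_inv P *v (A *v (P *v axis j 1))) $ i" for i j
  proof -
    have "B $ i $ j = (B *v axis j 1) $ i"
      by (simp add: matrix_vector_mult_def axis_def if_distrib cong: if_cong)
    then show ?thesis by (simp add: B_def matrix_vector_mul_assoc matrix_mul_assoc)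
  qed
  have B0: "B $ i $ j = 0" if "(i \<in> S) \<noteq> (j \<in> S)" for i j
  proof (cases "j \<in> S")
    case True
    then have "A *v (P *v axis j 1) \<in> ?E" using PE inv by blast
    then show ?thesis using QE True that by (simp add: Bij)
  next
    case False
    then have "A *v (P *v axis j 1) \<in> ?F" using PF inv by blast
    then show ?thesis using QF False that by (simp add: Bij)
  qed
  let ?D = "mat [:0, 1:] - poly_matrix B"
  have D0: "?D $ i $ j = 0" if "(i \<in> S) \<noteq> (j \<in> S)" for i j
    using B0[OF that] that by (auto simp: poly_matrix_def mat_def)
  \<comment> \<open>The block of \<open>?D\<close> over \<open>R\<close>, completed by identity
    rows. Since the mixed entries of \<open>?D\<close> vanish, the two completed blocks multiply to
    \<open>?D\<close>.\<close>
  define N where "N R = (\<chi> i j. if i \<in> R then ?D $ i $ j else if i = j then 1 else 0)" for R :: "'n set"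
  have prod: "N S ** N (- S) = ?D"
  proof -
    have "(\<Sum>k\<in>UNIV. N S $ i $ k * N (- S) $ k $ j) = ?D $ i $ j" for i j
    proof (cases "i \<in> S")
      case True
      have "(\<Sum>k\<in>UNIV. N S $ i $ k * N (- S) $ k $ j) = (\<Sum>k\<in>UNIV. if k = j then ?D $ i $ j else 0)"
        by (rule sum.cong[OF refl]) (use True D0[of i] in \<open>auto simp: N_def\<close>)
      then show ?thesis by simp
    next
      case False
      have "(\<Sum>k\<in>UNIV. N S $ i $ k * N (- S) $ k $ j) = (\<Sum>k\<in>UNIV. if k = i then ?D $ i $ j else 0)"
        by (rule sum.cong[OF refl]) (use False in \<open>auto simp: N_def\<close>)
      then show ?thesis by simp
    qed
    then show ?thesis by (simp add: matrix_matrix_mult_def vec_eq_iff)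
  qed
  have Ndet: "degree (det (N R)) = card R" "lead_coeff (det (N R)) = 1" for R
    by (rule det_partial_charpoly; auto simp: N_def mat_def poly_matrix_def)+
  then have Nnz: "det (N R) \<noteq> 0" for R by (metis leading_coeff_0_iff zero_neq_one)
  have chi: "charpoly (complex_matrix A) = det (N S) * det (N (- S))"
    using charpoly_similar[of "matrix_inv P" P A] matrix_inv_mult[OF P]
    by (simp add: B_def[symmetric] charpoly_complex_matrix prod[symmetric] det_mul)
  \<comment> \<open>The identity rows force a kernel vector of the completed block to vanish outside
    \<open>R\<close>, so it is an eigenvector of \<open>B\<close> supported on
    \<open>R\<close>.\<close>
  have eig: "\<exists>w. w \<noteq> 0 \<and> (\<forall>i. i \<notin> R \<longrightarrow> w $ i = 0) \<and>
      complex_matrix A *v (complex_matrix P *v w) = c *s (complex_matrix P *v w)"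
    if R: "R = S \<or> R = - S" and c: "poly (det (N R)) c = 0" for R c
  proof -
    let ?M = "\<chi> i j. poly (N R $ i $ j) c"
    have Mij: "?M $ i $ j = (if i \<in> R then (if i = j then c else 0) - complex_of_real (B $ i $ j) else if i = j then 1 else 0)" for i j
      by (simp add: N_def mat_def poly_matrix_def)
    obtain w where w: "w \<noteq> 0" "?M *v w = 0" using c by (auto simp: poly_det det_eq_0_iff_kernel)
    have row: "(\<Sum>j\<in>UNIV. ?M $ i $ j * w $ j) = 0" for i
      using arg_cong[OF w(2), of "\<lambda>v. v $ i"] by (simp add: matrix_vector_mult_def)
    have w0: "w $ i = 0" if "i \<notin> R" for i
      using row[of i] that unfolding Mij by (simp add: sum_delta_mult)
    have Bw: "(\<Sum>j\<in>UNIV. complex_of_real (B $ i $ j) * w $ j) = c * w $ i" for i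
    proof (cases "i \<in> R")
      case True
      then show ?thesis using row[of i] unfolding Mij
        by (simp add: left_diff_distrib sum_subtractf sum_delta_mult)
    next
      case False
      have "complex_of_real (B $ i $ j) * w $ j = 0" for j
        using B0[of i j] w0[of j] R False by (cases "j \<in> R") auto
      then have "(\<Sum>j\<in>UNIV. complex_of_real (B $ i $ j) * w $ j) = 0" by (intro sum.neutral ballI)
      then show ?thesis using w0[OF False] by simp
    qed
    have "complex_matrix B *v w = c *s w"
      using Bw by (simp add: vec_eq_iff matrix_vector_mult_def complex_matrix_def)
    moreover have "complex_matrix A ** complex_matrix P = complex_matrix P ** complex_matrix B"
      by (simp add: B_def matrix_mul_assoc matrix_inv_mult[OF P] flip: complex_matrix_mult)
    ultimately have "complex_matrix A *v (complex_matrix P *v w) = c *s (complex_matrix P *v w)"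
      by (metis matrix_vector_mul_assoc vector_scalar_commute)
    then show ?thesis using w(1) w0 by blast
  qed
  have Pw: "complex_matrix P *v w \<noteq> 0" if "w \<noteq> 0" for w
  proof
    assume "complex_matrix P *v w = 0"
    then have "complex_matrix (matrix_inv P) *v (complex_matrix P *v w) = 0" by simp
    then show False
      using that by (simp add: matrix_vector_mul_assoc matrix_inv_mult[OF P] complex_matrix_mat1 flip: complex_matrix_mult)
  qed
  have r1: "cmod c < 1" if c: "poly (det (N S)) c = 0" for c
  proof -
    obtain w where w: "w \<noteq> 0" "\<And>i. i \<notin> S \<Longrightarrow> w $ i = 0"
      "complex_matrix A *v (complex_matrix P *v w) = c *s (complex_matrix P *v w)"
      using eig[OF disjI1[OF refl] c] by metis
    have "complex_matrix P *v w \<in> stab ((*v) (complex_matrix A))"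
      by (rule stab_cvec_combination) (use w(2) PE in metis)
    from stab_eigenvector[OF w(3) this Pw[OF w(1)]] show ?thesis .
  qed
  have r2: "cmod c > 1" if c: "poly (det (N (- S))) c = 0" for c
  proof -
    obtain w where w: "w \<noteq> 0" "\<And>i. i \<notin> - S \<Longrightarrow> w $ i = 0"
      "complex_matrix A *v (complex_matrix P *v w) = c *s (complex_matrix P *v w)"
      using eig[OF disjI2[OF refl] c] by metis
    have st: "complex_matrix P *v w \<in> stab ((*v) (complex_matrix (matrix_inv A)))"
      by (rule stab_cvec_combination) (use w(2) PF in \<open>metis ComplD ComplI\<close>)
    have AA: "complex_matrix A ** complex_matrix (matrix_inv A) = mat 1"
      "complex_matrix (matrix_inv A) ** complex_matrix A = mat 1"
      by (simp_all add: matrix_inv_mult[OF A] complex_matrix_mat1 flip: complex_matrix_mult)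
    from stab_inverse_eigenvector[OF AA w(3) st Pw[OF w(1)]] show ?thesis .
  qed
  have "filter_mset (\<lambda>c. norm c < 1) (proots (charpoly (complex_matrix A)))
    = filter_mset (\<lambda>c. norm c < 1) (proots (det (N S))) + filter_mset (\<lambda>c. norm c < 1) (proots (det (N (- S))))"
    by (simp add: chi proots_mult Nnz)
  also have "filter_mset (\<lambda>c. norm c < 1) (proots (det (N S))) = proots (det (N S))"
    using r1 Nnz by (intro multiset_eqI) (auto simp: order_root)
  also have "filter_mset (\<lambda>c. norm c < 1) (proots (det (N (- S)))) = {#}"
    using r2 Nnz by (intro multiset_eqI) (force simp: order_root)
  finally show ?thesis using Ndet(1)[of S] S by (simp add: size_proots_complex)
qed

section \<open>Smooth paths of invertible matrices\<close>

lemma matrix_add_mult: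
  fixes A B :: "real^'n^'m"
  shows "(A + B) ** C = A ** C + B ** C"
  by (rule bounded_bilinear.add_left[OF bounded_bilinear_matrix_matrix_mult])

lemma matrix_mult_add:
  fixes A B :: "real^'n^'m"
  shows "C ** (A + B) = C ** A + C ** B"
  by (rule bounded_bilinear.add_right[OF bounded_bilinear_matrix_matrix_mult])

lemma matrix_mult_scaleR:
  fixes A :: "real^'n^'m"
  shows "(c *\<^sub>R A) ** B = c *\<^sub>R (A ** B)" "A ** (c *\<^sub>R B) = c *\<^sub>R (A ** B)"
  by (rule bounded_bilinear.scaleR_left[OF bounded_bilinear_matrix_matrix_mult])
    (rule bounded_bilinear.scaleR_right[OF bounded_bilinear_matrix_matrix_mult])

text \<open>Block diagonal form with an identity block over \<open>K\<close>. In the application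
  \<open>K\<close> starts as the height coordinate, which must not be disturbed, and the elimination
  enlarges it by its pivots.\<close>

definition fixes_coords :: "'n set \<Rightarrow> real^'n^'n \<Rightarrow> bool" where
  "fixes_coords K M \<longleftrightarrow> (\<forall>i\<in>K. \<forall>j. M $ i $ j = (if i = j then 1 else 0) \<and> M $ j $ i = (if i = j then 1 else 0))"

text \<open>Constancy near both ends, not just the end values, is what allows successive pieces
  built from such a path to be joined smoothly.\<close>

definition smooth_path_to :: "'n set \<Rightarrow> real^'n^'n \<Rightarrow> real^'n^'n \<Rightarrow> bool" where
  "smooth_path_to K M N \<longleftrightarrow> (\<exists>G :: real \<Rightarrow> real^'n^'n. smooth_on UNIV G \<and>
     (\<forall>t. invertible (G t) \<and> fixes_coords K (G t)) \<and> (\<forall>t\<le>1/3. G t = M) \<and> (\<forall>t\<ge>2/3. G t = N))"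

lemma smooth_path_toI:
  fixes G :: "real \<Rightarrow> real^'n^'n"
  assumes "smooth_on UNIV G" "\<And>t. invertible (G t)" "\<And>t. fixes_coords K (G t)"
    "\<And>t. t \<le> 1/3 \<Longrightarrow> G t = M" "\<And>t. t \<ge> 2/3 \<Longrightarrow> G t = N"
  shows "smooth_path_to K M N"
  unfolding smooth_path_to_def by (rule exI[of _ G]) (use assms in auto)

lemma smooth_path_toE:
  assumes "smooth_path_to K M N"
  obtains G :: "real \<Rightarrow> real^'n^'n" where "smooth_on UNIV G" "\<forall>t. invertible (G t) \<and> fixes_coords K (G t)"
    "\<forall>t\<le>1/3. G t = M" "\<forall>t\<ge>2/3. G t = N"
  using assms unfolding smooth_path_to_def by blast

lemma fixes_coords_mult:
  assumes "fixes_coords K M" "fixes_coords K N"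
  shows "fixes_coords K (M ** N)"
proof -
  have "(M ** N) $ i $ j = (if i = j then 1 else 0) \<and> (M ** N) $ j $ i = (if i = j then 1 else 0)" if i: "i \<in> K" for i j
  proof
    have "(M ** N) $ i $ j = (\<Sum>k\<in>UNIV. (if i = k then 1 else 0) * N $ k $ j)"
      using assms(1) i by (simp add: matrix_matrix_mult_def fixes_coords_def)
    then show "(M ** N) $ i $ j = (if i = j then 1 else 0)"
      using assms(2) i by (simp add: sum_delta_mult fixes_coords_def)
    have "(M ** N) $ j $ i = (\<Sum>k\<in>UNIV. (if i = k then 1 else 0) * M $ j $ k)"
      using assms(2) i by (simp add: matrix_matrix_mult_def fixes_coords_def mult.commute)
    then show "(M ** N) $ j $ i = (if i = j then 1 else 0)"
      using assms(1) i by (simp add: sum_delta_mult fixes_coords_def)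
  qed
  then show ?thesis by (simp add: fixes_coords_def)
qed

lemma fixes_coords_mat1: "fixes_coords K (mat 1)"
  by (auto simp: fixes_coords_def mat_def)

lemma fixes_coords_inverse:
  assumes M: "fixes_coords K M" "invertible M"
  shows "fixes_coords K (matrix_inv M)"
proof -
  let ?N = "matrix_inv M"
  have "?N $ i $ j = (if i = j then 1 else 0) \<and> ?N $ j $ i = (if i = j then 1 else 0)" if i: "i \<in> K" for i j
  proof
    have "(M ** ?N) $ i $ j = (\<Sum>k\<in>UNIV. (if i = k then 1 else 0) * ?N $ k $ j)"
      using M(1) i by (simp add: matrix_matrix_mult_def fixes_coords_def)
    then show "?N $ i $ j = (if i = j then 1 else 0)"
      by (simp add: sum_delta_mult matrix_inv_mult[OF M(2)] mat_def)
    have "(?N ** M) $ j $ i = (\<Sum>k\<in>UNIV. (if i = k then 1 else 0) * ?N $ j $ k)"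
      using M(1) i by (simp add: matrix_matrix_mult_def fixes_coords_def mult.commute)
    then show "?N $ j $ i = (if i = j then 1 else 0)"
      by (auto simp: sum_delta_mult matrix_inv_mult[OF M(2)] mat_def)
  qed
  then show ?thesis by (simp add: fixes_coords_def)
qed

lemma smooth_path_to_const:
  "invertible M \<Longrightarrow> fixes_coords K M \<Longrightarrow> smooth_path_to K M M"
  by (rule smooth_path_toI[of "\<lambda>_. M"]) (auto intro: smooth_on_const)

lemma smooth_path_to_mult:
  assumes "smooth_path_to K M M'" "smooth_path_to K N N'"
  shows "smooth_path_to K (M ** N) (M' ** N')"
proof -
  obtain G :: "real \<Rightarrow> real^'a^'a" where G: "smooth_on UNIV G" "\<forall>t. invertible (G t) \<and> fixes_coords K (G t)"
    "\<forall>t\<le>1/3. G t = M" "\<forall>t\<ge>2/3. G t = M'"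
    using smooth_path_toE[OF assms(1)] .
  obtain H :: "real \<Rightarrow> real^'a^'a" where H: "smooth_on UNIV H" "\<forall>t. invertible (H t) \<and> fixes_coords K (H t)"
    "\<forall>t\<le>1/3. H t = N" "\<forall>t\<ge>2/3. H t = N'"
    using smooth_path_toE[OF assms(2)] .
  show ?thesis
    by (rule smooth_path_toI[of "\<lambda>t. G t ** H t"])
      (use G H in \<open>auto intro!: smooth_on_matrix_mult invertible_mult fixes_coords_mult\<close>)
qed

lemma smooth_path_to_ends:
  assumes "smooth_path_to K M N"
  shows "invertible M" "fixes_coords K M" "invertible N" "fixes_coords K N"
proof -
  obtain G :: "real \<Rightarrow> real^'a^'a" where G: "\<forall>t. invertible (G t) \<and> fixes_coords K (G t)"
    "\<forall>t\<le>1/3. G t = M" "\<forall>t\<ge>2/3. G t = N"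
    using smooth_path_toE[OF assms] .
  have "G 0 = M" "G 1 = N" using G by auto
  then show "invertible M" "fixes_coords K M" "invertible N" "fixes_coords K N" using G(1) by metis+
qed

text \<open>Instead of being concatenated, the two paths are multiplied pointwise, with the inverse
  of the middle matrix in between; smoothness and plateaus are then inherited at once.\<close>

lemma smooth_path_to_trans:
  assumes "smooth_path_to K M N" "smooth_path_to K N P"
  shows "smooth_path_to K M P"
proof -
  note N = smooth_path_to_ends[OF assms(2)]
  have "smooth_path_to K (matrix_inv N) (matrix_inv N)"
    by (intro smooth_path_to_const invertible_matrix_inv fixes_coords_inverse N)
  from smooth_path_to_mult[OF smooth_path_to_mult[OF assms(1) this] assms(2)]
  show ?thesis by (simp add: matrix_inv_mult[OF N(1)] flip: matrix_mul_assoc)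
qed

text \<open>For \<open>N\<close> of square zero the inverse of 1 + c N is 1 - c N, so the segment
  starting at the identity stays invertible. Elementary row operations, and the clearing of a whole
  row or column, are of this kind.\<close>

lemma smooth_path_to_nilpotent:
  fixes N :: "real^'n^'n"
  assumes N: "N ** N = 0" and K: "\<And>i j. i \<in> K \<Longrightarrow> N $ i $ j = 0 \<and> N $ j $ i = 0"
  shows "smooth_path_to K (mat 1) (mat 1 + N)"
proof -
  obtain \<sigma> :: "real \<Rightarrow> real" where \<sigma>: "smooth_on UNIV \<sigma>" "\<And>t. t \<le> 1/3 \<Longrightarrow> \<sigma> t = 0" "\<And>t. t \<ge> 2/3 \<Longrightarrow> \<sigma> t = 1"
    by (rule smooth_step_exists) (rule that)
  show ?thesis
  proof (rule smooth_path_toI[of "\<lambda>t. mat 1 + \<sigma> t *\<^sub>R N"])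
    show "smooth_on UNIV (\<lambda>t. mat 1 + \<sigma> t *\<^sub>R N)"
      by (intro smooth_on_add smooth_on_const smooth_on_bilinear[OF _ bounded_bilinear_scaleR] \<sigma> open_UNIV)
    have inv: "(mat 1 + c *\<^sub>R N) ** (mat 1 - c *\<^sub>R N) = mat 1" for c
    proof -
      have "(mat 1 + c *\<^sub>R N) ** (mat 1 - c *\<^sub>R N) = mat 1 - (c * c) *\<^sub>R (N ** N)"
        by (simp add: matrix_mult_diff matrix_add_mult matrix_mult_scaleR scaleR_add_right)
      then show ?thesis by (simp add: N)
    qed
    show "invertible (mat 1 + \<sigma> t *\<^sub>R N)" for t
      using inv[of "\<sigma> t"] invertible_right_inverse by blast
    show "fixes_coords K (mat 1 + \<sigma> t *\<^sub>R N)" for t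
      using K by (auto simp: fixes_coords_def mat_def)
  qed (use \<sigma> in auto)
qed

definition diag_matrix :: "('n \<Rightarrow> real) \<Rightarrow> real^'n^'n" where
  "diag_matrix d = (\<chi> i j. if i = j then d i else 0)"

lemma diag_matrix_mult_nth: "(diag_matrix d ** M) $ i $ j = d i * M $ i $ j"
  by (simp add: diag_matrix_def matrix_matrix_mult_def sum_delta_mult)

lemma diag_matrix_vec: "(diag_matrix d *v x) $ i = d i * x $ i"
  by (simp add: diag_matrix_def matrix_vector_mult_def sum_delta_mult)

lemma diag_matrix_mult: "diag_matrix d ** diag_matrix e = diag_matrix (\<lambda>i. d i * e i)"
  by (simp add: vec_eq_iff diag_matrix_mult_nth) (simp add: diag_matrix_def)

lemma diag_matrix_1: "diag_matrix (\<lambda>_. 1) = mat 1"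
  by (simp add: diag_matrix_def mat_def)

lemma invertible_diag_matrix: "(\<And>i. d i \<noteq> 0) \<Longrightarrow> invertible (diag_matrix d)"
  by (rule invertible_right_inverse[THEN iffD2], rule exI[of _ "diag_matrix (\<lambda>i. 1 / d i)"])
    (simp add: diag_matrix_mult diag_matrix_1)

lemma fixes_coords_diag_matrix: "(\<And>i. i \<in> K \<Longrightarrow> d i = 1) \<Longrightarrow> fixes_coords K (diag_matrix d)"
  by (auto simp: fixes_coords_def diag_matrix_def)

text \<open>The modulus is deformed to 1 through its powers with exponent
  \<open>1 - \<sigma> t\<close>. The sign has to stay, because the determinant must not vanish on
  the way.\<close>

lemma smooth_path_to_scaling:
  fixes K :: "'n::finite set"
  assumes "c \<noteq> 0" "i \<notin> K"
  shows "smooth_path_to K (diag_matrix ((\<lambda>_. 1)(i := c))) (diag_matrix ((\<lambda>_. 1)(i := sgn c)))"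
proof -
  obtain \<sigma> :: "real \<Rightarrow> real" where \<sigma>: "smooth_on UNIV \<sigma>" "\<And>t. t \<le> 1/3 \<Longrightarrow> \<sigma> t = 0" "\<And>t. t \<ge> 2/3 \<Longrightarrow> \<sigma> t = 1"
    by (rule smooth_step_exists) (rule that)
  define d where "d t = sgn c * exp ((1 - \<sigma> t) * ln \<bar>c\<bar>)" for t
  have d: "smooth_on UNIV d" "\<And>t. d t \<noteq> 0" "\<And>t. t \<le> 1/3 \<Longrightarrow> d t = c" "\<And>t. t \<ge> 2/3 \<Longrightarrow> d t = sgn c"
    unfolding d_def using assms(1) \<sigma>
    by (auto intro!: smooth_on_mult smooth_on_const smooth_on_compose_UNIV[OF _ smooth_on_exp] smooth_on_diff
        simp: sgn_mult_abs sgn_zero_iff)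
  show ?thesis
  proof (rule smooth_path_toI[of "\<lambda>t. diag_matrix ((\<lambda>_. 1)(i := d t))"])
    have "smooth_on UNIV (\<lambda>t. if k = l then ((\<lambda>_. 1)(i := d t)) k else 0)" for k l :: 'n
      using d(1) by (cases "k = l"; cases "k = i") (auto intro: smooth_on_const)
    then show "smooth_on UNIV (\<lambda>t. diag_matrix ((\<lambda>_. 1)(i := d t)))"
      by (intro smooth_on_matrix) (simp_all add: diag_matrix_def)
    show "invertible (diag_matrix ((\<lambda>_. 1)(i := d t)))" for t
      by (rule invertible_diag_matrix) (simp add: d)
    show "fixes_coords K (diag_matrix ((\<lambda>_. 1)(i := d t)))" for t
      by (rule fixes_coords_diag_matrix) (use assms(2) in auto)
  qed (use d in auto)
qed

lemma smooth_path_to_left: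
  assumes "smooth_path_to K (mat 1) E" "invertible M" "fixes_coords K M"
  shows "smooth_path_to K M (E ** M)"
  using smooth_path_to_mult[OF assms(1) smooth_path_to_const[OF assms(2,3)]] by simp

lemma smooth_path_to_right:
  assumes "smooth_path_to K (mat 1) E" "invertible M" "fixes_coords K M"
  shows "smooth_path_to K M (M ** E)"
  using smooth_path_to_mult[OF smooth_path_to_const[OF assms(2,3)] assms(1)] by simp

text \<open>Gaussian elimination, one pivot at a time; \<open>K\<close> collects the pivots already treated.\<close>

lemma smooth_path_to_signs:
  fixes M :: "real^'n^'n"
  assumes "invertible M" "fixes_coords K M"
  shows "\<exists>s. (\<forall>i. \<bar>s i\<bar> = 1) \<and> (\<forall>i\<in>K. s i = 1) \<and> smooth_path_to K M (diag_matrix s)"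
  using assms
proof (induction "card (- K)" arbitrary: K M)
  case 0
  then have "- K = {}" by simp
  then have "K = UNIV" by blast
  then have "M = diag_matrix (\<lambda>_. 1)" using 0(3) by (simp add: fixes_coords_def diag_matrix_def vec_eq_iff)
  then show ?case using smooth_path_to_const[OF 0(2,3)] by (intro exI[of _ "\<lambda>_. 1"]) auto
next
  case (Suc n)
  then have "- K \<noteq> {}" by force
  then obtain i where i: "i \<notin> K" by blast
  have "\<exists>M1. smooth_path_to K M M1 \<and> M1 $ i $ i \<noteq> 0"
  proof (cases "M $ i $ i = 0")
    case False
    then show ?thesis using smooth_path_to_const[OF Suc.prems] by blast
  next
    case True
    have "\<exists>j. M $ j $ i \<noteq> 0"
    proof (rule ccontr)
      assume "\<nexists>j. M $ j $ i \<noteq> 0"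
      then have "M *v axis i 1 = 0"
        by (simp add: vec_eq_iff matrix_vector_mult_def axis_def if_distrib cong: if_cong)
      then have "axis i 1 = (0 :: real^'n)" using matrix_inv_vec(2)[OF Suc.prems(1), of "axis i 1"] by simp
      then show False by (simp add: axis_eq_0_iff)
    qed
    then obtain j where j: "M $ j $ i \<noteq> 0" by blast
    then have "j \<noteq> i" using True by auto
    moreover from this have "j \<notin> K" using j Suc.prems(2) by (force simp: fixes_coords_def)
    ultimately have ij: "j \<noteq> i" "j \<notin> K" by simp_all
    \<comment> \<open>Adding row \<open>j\<close> to row \<open>i\<close> produces a nonzero
      pivot.\<close>
    define N :: "real^'n^'n" where "N = (\<chi> k l. if i = k then (if j = l then 1 else 0) else 0)"
    have NN: "N ** N = 0"
      using ij(1) by (auto simp: N_def matrix_matrix_mult_def vec_eq_iff intro!: sum.neutral)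
    have "smooth_path_to K (mat 1) (mat 1 + N)"
      by (rule smooth_path_to_nilpotent[OF NN]) (use i ij in \<open>auto simp: N_def\<close>)
    from smooth_path_to_left[OF this Suc.prems] have "smooth_path_to K M ((mat 1 + N) ** M)" .
    moreover have "((mat 1 + N) ** M) $ i $ i = M $ i $ i + M $ j $ i"
      by (simp add: matrix_add_mult) (simp add: N_def matrix_matrix_mult_def sum_delta_mult)
    ultimately show ?thesis using True j by auto
  qed
  then obtain M1 where M1: "smooth_path_to K M M1" "M1 $ i $ i \<noteq> 0" by blast
  note e1 = smooth_path_to_ends(3,4)[OF M1(1)]
  \<comment> \<open>Clears column \<open>i\<close> off the pivot by row operations;
    \<open>N'\<close> then clears row \<open>i\<close> by column operations.\<close>
  define N :: "real^'n^'n" where "N = (\<chi> k l. if l = i \<and> k \<noteq> i then - (M1 $ k $ i / M1 $ i $ i) else 0)"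
  have "N ** N = 0"
    by (auto simp: N_def matrix_matrix_mult_def vec_eq_iff intro!: sum.neutral)
  then have "smooth_path_to K (mat 1) (mat 1 + N)"
    by (rule smooth_path_to_nilpotent) (use i e1(2) in \<open>auto simp: N_def fixes_coords_def\<close>)
  from smooth_path_to_left[OF this e1] have p2: "smooth_path_to K M1 ((mat 1 + N) ** M1)" .
  define M2 where "M2 = (mat 1 + N) ** M1"
  have "(N ** M1) $ k $ l = (if k = i then 0 else - (M1 $ k $ i / M1 $ i $ i) * M1 $ i $ l)" for k l
  proof -
    have "(N ** M1) $ k $ l = (\<Sum>m\<in>UNIV. (if i = m then (if k = i then 0 else - (M1 $ k $ i / M1 $ i $ i)) else 0) * M1 $ m $ l)"
      unfolding matrix_matrix_mult_def vec_lambda_beta by (rule sum.cong) (auto simp: N_def)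
    then show ?thesis by (simp only: sum_delta_mult) simp
  qed
  then have M2: "M2 $ i $ i \<noteq> 0" "\<And>k. k \<noteq> i \<Longrightarrow> M2 $ k $ i = 0"
    using M1(2) by (simp_all add: M2_def matrix_add_mult)
  note p2 = p2[folded M2_def]
  note e2 = smooth_path_to_ends(3,4)[OF p2]
  define N' :: "real^'n^'n" where "N' = (\<chi> k l. if k = i \<and> l \<noteq> i then - (M2 $ i $ l / M2 $ i $ i) else 0)"
  have "N' ** N' = 0"
    by (auto simp: N'_def matrix_matrix_mult_def vec_eq_iff intro!: sum.neutral)
  then have "smooth_path_to K (mat 1) (mat 1 + N')"
    by (rule smooth_path_to_nilpotent) (use i e2(2) in \<open>auto simp: N'_def fixes_coords_def\<close>)
  from smooth_path_to_right[OF this e2] have p3: "smooth_path_to K M2 (M2 ** (mat 1 + N'))" .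
  define M3 where "M3 = M2 ** (mat 1 + N')"
  have "(M2 ** N') $ k $ l = (if l = i then 0 else - (M2 $ i $ l / M2 $ i $ i) * M2 $ k $ i)" for k l
  proof -
    have "(M2 ** N') $ k $ l = (\<Sum>m\<in>UNIV. (if i = m then (if l = i then 0 else - (M2 $ i $ l / M2 $ i $ i)) else 0) * M2 $ k $ m)"
      unfolding matrix_matrix_mult_def vec_lambda_beta by (rule sum.cong) (auto simp: N'_def)
    then show ?thesis by (simp only: sum_delta_mult) simp
  qed
  then have M3: "M3 $ i $ i \<noteq> 0" "\<And>k. k \<noteq> i \<Longrightarrow> M3 $ k $ i = 0" "\<And>k. k \<noteq> i \<Longrightarrow> M3 $ i $ k = 0"
    using M2 by (simp_all add: M3_def matrix_mult_add)
  note p3 = p3[folded M3_def]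
  note e3 = smooth_path_to_ends(3,4)[OF p3]
  \<comment> \<open>The pivot is split off as a diagonal factor; what remains fixes one more
    coordinate, so the induction hypothesis applies to it.\<close>
  define c where "c = M3 $ i $ i"
  let ?D = "\<lambda>c. diag_matrix ((\<lambda>_. 1)(i := c))"
  define M4 where "M4 = ?D (1 / c) ** M3"
  have DD: "?D c ** ?D (1 / c) = mat 1"
  proof -
    have "(\<lambda>k. ((\<lambda>_. 1)(i := c)) k * ((\<lambda>_. 1)(i := 1 / c)) k) = (\<lambda>_. 1)"
      using M3(1) by (auto simp: c_def)
    then show ?thesis by (simp only: diag_matrix_mult diag_matrix_1)
  qed
  have M34: "M3 = ?D c ** M4" by (simp add: M4_def matrix_mul_assoc DD)
  have "invertible (?D (1 / c))" using M3(1) by (intro invertible_diag_matrix) (simp add: c_def)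
  then have inv4: "invertible M4" unfolding M4_def using e3(1) by (rule invertible_mult)
  have fix4: "fixes_coords (insert i K) M4"
    unfolding fixes_coords_def M4_def diag_matrix_mult_nth
    using M3 e3(2) i by (auto simp: fixes_coords_def c_def)
  have "card (- insert i K) = n"
  proof -
    have "- insert i K = - K - {i}" by auto
    then show ?thesis using Suc.hyps(2) i by (simp add: card_Diff_singleton)
  qed
  then obtain s where s: "\<forall>k. \<bar>s k\<bar> = 1" "\<forall>k\<in>insert i K. s k = 1" "smooth_path_to (insert i K) M4 (diag_matrix s)"
    using Suc.hyps(1)[OF _ inv4 fix4] by blast
  have mono: "smooth_path_to K M4 (diag_matrix s)"
  proof -
    obtain G :: "real \<Rightarrow> real^'n^'n" where G: "smooth_on UNIV G" "\<forall>t. invertible (G t) \<and> fixes_coords (insert i K) (G t)"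
      "\<forall>t\<le>1/3. G t = M4" "\<forall>t\<ge>2/3. G t = diag_matrix s"
      using smooth_path_toE[OF s(3)] .
    show ?thesis by (rule smooth_path_toI[OF G(1)]) (use G(2-4) in \<open>auto simp: fixes_coords_def\<close>)
  qed
  have p4: "smooth_path_to K M3 (?D (sgn c) ** diag_matrix s)"
    unfolding M34 by (intro smooth_path_to_mult mono smooth_path_to_scaling i) (use M3(1) in \<open>simp add: c_def\<close>)
  let ?s = "\<lambda>k. ((\<lambda>_. 1)(i := sgn c)) k * s k"
  have "smooth_path_to K M (diag_matrix ?s)"
    using smooth_path_to_trans[OF M1(1) smooth_path_to_trans[OF p2 smooth_path_to_trans[OF p3 p4]]]
    by (simp only: diag_matrix_mult)
  moreover have "\<bar>?s k\<bar> = 1" for k using s(1) M3(1) by (auto simp: abs_mult abs_sgn_eq c_def)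
  moreover have "?s k = 1" if "k \<in> K" for k using s(2) that i by auto
  ultimately show ?case by (intro exI[of _ ?s]) blast
qed

section \<open>Periodic moving frames\<close>

definition zpow :: "real^'n^'n \<Rightarrow> int \<Rightarrow> real^'n^'n" where
  "zpow X k = (if k \<ge> 0 then mpow X (nat k) else mpow (matrix_inv X) (nat (- k)))"

lemma zpow_Suc:
  assumes X: "invertible X"
  shows "zpow X (k + 1) = X ** zpow X k" "zpow X (k + 1) = zpow X k ** X"
proof -
  have "zpow X (k + 1) = X ** zpow X k \<and> zpow X (k + 1) = zpow X k ** X"
  proof (cases "k \<ge> 0")
    case True
    then have "nat (k + 1) = Suc (nat k)" by simp
    then show ?thesis using True mpow_Suc2[of X] by (simp add: zpow_def)
  next
    case False
    define m where "m = nat (- (k + 1))"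
    have m: "nat (- k) = Suc m" using False by (simp add: m_def Suc_nat_eq_nat_zadd1)
    have 1: "zpow X (k + 1) = mpow (matrix_inv X) m"
    proof (cases "k = -1")
      case True
      then show ?thesis by (simp add: zpow_def m_def)
    next
      case False
      then have "\<not> 0 \<le> k + 1" using \<open>\<not> 0 \<le> k\<close> by simp
      then show ?thesis by (simp only: zpow_def m_def if_False)
    qed
    have k: "zpow X k = mpow (matrix_inv X) (Suc m)" using False by (simp only: zpow_def m if_False)
    have "X ** zpow X k = mpow (matrix_inv X) m"
      by (simp add: k matrix_mul_assoc matrix_inv_mult[OF X])
    moreover have "zpow X k ** X = mpow (matrix_inv X) m"
      unfolding k mpow_Suc2 by (simp add: matrix_inv_mult[OF X] flip: matrix_mul_assoc)
    ultimately show ?thesis using 1 by simp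
  qed
  then show "zpow X (k + 1) = X ** zpow X k" "zpow X (k + 1) = zpow X k ** X" by auto
qed

lemma mpow_closed: "P (mat 1) \<Longrightarrow> P X \<Longrightarrow> (\<And>Y Z. P Y \<Longrightarrow> P Z \<Longrightarrow> P (Y ** Z)) \<Longrightarrow> P (mpow X m)"
  by (induction m) auto

lemma zpow_closed:
  assumes "P (mat 1)" "P X" "P (matrix_inv X)" "\<And>Y Z. P Y \<Longrightarrow> P Z \<Longrightarrow> P (Y ** Z)"
  shows "P (zpow X k)"
  unfolding zpow_def using mpow_closed[of P] assms by auto

text \<open>With J the sign matrix, the frame between k and k + 1 is J^k G(t - k) M^(-k), where G
  runs from the identity to J M^(-1). At the integer k both adjacent pieces equal J^k M^(-k), and on
  the plateaus of G they are constant, so they join smoothly. Shifting t by one inserts a factor J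
  on the left and M^(-1) on the right, which is the recursion.\<close>

lemma periodic_frame_exists:
  fixes M :: "real^'n^'n"
  assumes M: "invertible M" "fixes_coords K M"
  obtains C :: "real \<Rightarrow> real^'n^'n" and s where "smooth_on UNIV C" "\<And>t. invertible (C t)" "\<And>t. fixes_coords K (C t)"
    "\<And>i. \<bar>s i\<bar> = 1" "\<And>i. i \<in> K \<Longrightarrow> s i = 1" "\<And>t. C (t + 1) ** M = diag_matrix s ** C t"
proof -
  obtain s where s: "\<forall>i. \<bar>s i\<bar> = 1" "\<forall>i\<in>K. s i = 1" "smooth_path_to K M (diag_matrix s)"
    using smooth_path_to_signs[OF M] by blast
  let ?J = "diag_matrix s" and ?M' = "matrix_inv M"
  have J: "invertible ?J" "fixes_coords K ?J" using smooth_path_to_ends[OF s(3)] by auto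
  have M': "invertible ?M'" "fixes_coords K ?M'"
    by (rule invertible_matrix_inv[OF M(1)], rule fixes_coords_inverse[OF M(2,1)])
  have "smooth_path_to K (M ** ?M') (?J ** ?M')"
    by (intro smooth_path_to_mult s(3) smooth_path_to_const M')
  then obtain G :: "real \<Rightarrow> real^'n^'n" where G: "smooth_on UNIV G" "\<forall>t. invertible (G t) \<and> fixes_coords K (G t)"
    "\<forall>t\<le>1/3. G t = M ** ?M'" "\<forall>t\<ge>2/3. G t = ?J ** ?M'"
    by (rule smooth_path_toE)
  define C where "C t = zpow ?J \<lfloor>t\<rfloor> ** G (t - of_int \<lfloor>t\<rfloor>) ** zpow ?M' \<lfloor>t\<rfloor>" for t
  define P where "P Y \<longleftrightarrow> invertible Y \<and> fixes_coords K Y" for Y :: "real^'n^'n"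
  have Pm: "P (mat 1)" "\<And>Y Z. P Y \<Longrightarrow> P Z \<Longrightarrow> P (Y ** Z)"
    by (auto simp: P_def fixes_coords_mat1 fixes_coords_mult invertible_mult intro: invertible_def[THEN iffD2] exI[of _ "mat 1"])
  have Pi: "P Y \<Longrightarrow> P (matrix_inv Y)" for Y
    by (simp add: P_def invertible_matrix_inv fixes_coords_inverse)
  have "P (C t)" for t
    unfolding C_def using J M M' G(2)
    by (intro Pm(2) zpow_closed[of P] Pm(1) Pi) (auto simp: P_def)
  then have C1: "\<And>t. invertible (C t)" "\<And>t. fixes_coords K (C t)" by (auto simp: P_def)
  have rec: "C (t + 1) ** M = ?J ** C t" for t
  proof -
    have "\<lfloor>t + 1\<rfloor> = \<lfloor>t\<rfloor> + 1" by simp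
    then have "C (t + 1) = ?J ** zpow ?J \<lfloor>t\<rfloor> ** G (t - of_int \<lfloor>t\<rfloor>) ** (zpow ?M' \<lfloor>t\<rfloor> ** ?M')"
      unfolding C_def using zpow_Suc(1)[OF J(1), of "\<lfloor>t\<rfloor>"] zpow_Suc(2)[OF M'(1), of "\<lfloor>t\<rfloor>"] by simp
    then show ?thesis
      by (simp add: C_def matrix_inv_mult[OF M(1)] flip: matrix_mul_assoc)
  qed
  have piece: "smooth_on UNIV (\<lambda>t. zpow ?J k ** G (t - of_int k) ** zpow ?M' k)" for k
    by (intro smooth_on_matrix_mult smooth_on_const smooth_on_compose_UNIV[OF _ G(1)] smooth_on_diff smooth_on_ident open_UNIV)
  have "smooth_on UNIV C"
  proof (rule smooth_on_locally)
    fix t0 :: real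
    let ?k = "\<lfloor>t0\<rfloor>"
    show "\<exists>T. open T \<and> t0 \<in> T \<and> smooth_on T C"
    proof (cases "t0 = of_int ?k")
      case False
      let ?T = "{of_int ?k <..< of_int ?k + 1} :: real set"
      have "of_int ?k \<le> t0" "t0 < of_int ?k + 1" by linarith+
      then have "t0 \<in> ?T" using False unfolding greaterThanLessThan_iff by linarith
      moreover have "smooth_on ?T C"
      proof (rule smooth_on_cong[OF _ smooth_on_subset[OF piece[of ?k]]])
        fix t :: real assume "t \<in> ?T"
        then have "\<lfloor>t\<rfloor> = ?k" by (simp add: floor_eq_iff)
        then show "zpow ?J ?k ** G (t - of_int ?k) ** zpow ?M' ?k = C t" by (simp add: C_def)
      qed auto
      ultimately show ?thesis by (intro exI[of _ ?T]) auto
    next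
      case True
      let ?T = "{of_int ?k - 1/3 <..< of_int ?k + 1/3} :: real set"
      have "t0 \<in> ?T" using True by simp
      moreover have "smooth_on ?T C"
      proof (rule smooth_on_cong[OF _ smooth_on_const[where c = "zpow ?J ?k ** zpow ?M' ?k"]])
        fix t :: real assume t: "t \<in> ?T"
        show "zpow ?J ?k ** zpow ?M' ?k = C t"
        proof (cases "t \<ge> of_int ?k")
          case True
          then have "\<lfloor>t\<rfloor> = ?k" using t by (simp add: floor_eq_iff)
          moreover have "G (t - of_int ?k) = mat 1" using G(3) t by (simp add: matrix_inv_mult[OF M(1)])
          ultimately show ?thesis by (simp add: C_def)
        next
          case False
          have fl: "\<lfloor>t\<rfloor> = ?k - 1" using t False by (simp add: floor_eq_iff)
          moreover have "G (t - of_int (?k - 1)) = ?J ** ?M'" using G(4) t by simp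
          ultimately have "C t = zpow ?J (?k - 1) ** (?J ** ?M') ** zpow ?M' (?k - 1)" by (simp add: C_def)
          also have "\<dots> = (zpow ?J (?k - 1) ** ?J) ** (?M' ** zpow ?M' (?k - 1))" by (simp add: matrix_mul_assoc)
          also have "\<dots> = zpow ?J ?k ** zpow ?M' ?k"
            using zpow_Suc(2)[OF J(1), of "?k - 1"] zpow_Suc(1)[OF M'(1), of "?k - 1"] by simp
          finally show ?thesis by simp
        qed
      qed auto
      ultimately show ?thesis by (intro exI[of _ ?T]) auto
    qed
  qed
  from that[OF this C1 _ _ rec] s show ?thesis by simp
qed

section \<open>Complete Anosov metrics for drift maps\<close>

text \<open>In the coordinates \<open>xi\<close> below, the affine map is the translation by one in direction \<open>i0\<close>, up to
  signs of the other coordinates. The coframe \<open>frame\<close> consists of the differentials of these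
  coordinates, except that an oscillating multiple of the drift form \<open>l\<close> is subtracted from the
  \<open>i1\<close>-th one to keep paths of finite length from escaping through small values of \<open>height\<close>.\<close>

locale drift_frame =
  fixes A :: "real^'n^'n" and v e l y0 :: "real^'n" and C :: "real \<Rightarrow> real^'n^'n" and s :: "'n \<Rightarrow> real"
    and i0 i1 :: 'n and S :: "'n set"
  assumes A: "invertible A" and Ae: "A *v e = e" and lA: "\<And>x. l \<bullet> (A *v x) = l \<bullet> x" and le: "l \<bullet> e = 1"
    and y0: "A *v y0 + v - y0 = e"
    and C_smooth: "smooth_on UNIV C" and C_inv: "\<And>t. invertible (C t)"
    and Ce: "\<And>t. C t *v e = axis i0 1" and Cl: "\<And>t x. (C t *v x) $ i0 = l \<bullet> x"
    and s1: "\<And>i. \<bar>s i\<bar> = 1" and Crec: "\<And>t x. C (t + 1) *v (A *v x) = diag_matrix s *v (C t *v x)"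
    and i01: "i1 \<noteq> i0" and S: "i1 \<in> S" "i0 \<notin> S"
begin

abbreviation "f \<equiv> affine_map A v"

definition height :: "real^'n \<Rightarrow> real" where
  "height x = l \<bullet> (x - y0)"

text \<open>The frame turns with the height, so that the recursion of \<open>C\<close> replaces the
  linear part of the map by the diagonal sign matrix. The origin \<open>y0\<close> is a point which
  the map displaces by exactly \<open>e\<close>.\<close>

definition xi :: "real^'n \<Rightarrow> real^'n" where
  "xi x = C (height x) *v (x - y0)"

lemma f_minus: "f x - y0 = A *v (x - y0) + e"
  using y0 by (simp add: affine_map_def matrix_vector_mult_diff_distrib algebra_simps)

lemma height_f: "height (f x) = height x + 1"
  by (simp add: height_def f_minus inner_add_right lA le)

lemma xi_i0: "xi x $ i0 = height x"
  by (simp add: xi_def Cl height_def)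

lemma xi_f: "xi (f x) $ j = s j * xi x $ j + (if j = i0 then 1 else 0)"
proof -
  have "xi (f x) = diag_matrix s *v (C (height x) *v (x - y0)) + axis i0 1"
    by (simp add: xi_def height_f f_minus matrix_vector_right_distrib Crec Ce)
  then show ?thesis by (simp add: diag_matrix_vec xi_def axis_def)
qed

lemma smooth_height: "smooth_on UNIV height"
  unfolding height_def
  by (rule smooth_on_bounded_linear_comp[OF open_UNIV bounded_linear_inner_right])
    (intro smooth_on_diff smooth_on_ident smooth_on_const open_UNIV)

lemma smooth_xi: "smooth_on UNIV xi"
  unfolding xi_def
  by (intro smooth_on_matrix_vector_mult smooth_on_compose_UNIV[OF _ C_smooth] smooth_height
      smooth_on_diff smooth_on_ident smooth_on_const open_UNIV)

definition X :: "real^'n \<Rightarrow> real^'n \<Rightarrow> real^'n" where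
  "X x = frechet_derivative xi (at x)"

lemma xi_derivative: "(xi has_derivative X x) (at x)"
  unfolding X_def by (rule smooth_on_imp_has_derivative[OF smooth_xi UNIV_I])

lemma xi_nth_derivative: "((\<lambda>x. xi x $ j) has_derivative (\<lambda>w. X x w $ j)) (at x)"
  by (rule bounded_linear.has_derivative[OF bounded_linear_vec_nth xi_derivative])

lemma height_derivative: "(height has_derivative (\<lambda>w. l \<bullet> w)) (at x)"
  unfolding height_def by (auto intro!: derivative_eq_intros)

lemma X_i0: "X x w $ i0 = l \<bullet> w"
proof -
  have "(height has_derivative (\<lambda>w. X x w $ i0)) (at x)"
    using xi_nth_derivative[of i0 x] by (simp add: xi_i0)
  from has_derivative_unique[OF this height_derivative] show ?thesis by (rule fun_cong)
qed

lemma linear_X: "linear (X x)"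
  using xi_derivative has_derivative_linear by blast

text \<open>Within a level set of the height the matrix \<open>C (height x)\<close> is constant, so
  its derivative does not contribute. Such directions suffice for the invertibility of
  \<open>frame\<close>, because any vector in its kernel is tangent to a level set.\<close>

lemma X_level:
  assumes "l \<bullet> w = 0"
  shows "X x w = C (height x) *v w"
proof -
  have "((\<lambda>h::real. x + h *\<^sub>R w) has_derivative (\<lambda>h. h *\<^sub>R w)) (at 0)"
    by (auto intro!: derivative_eq_intros)
  moreover have "(xi has_derivative X x) (at (x + 0 *\<^sub>R w))" using xi_derivative by simp
  ultimately have 1: "((\<lambda>h::real. xi (x + h *\<^sub>R w)) has_derivative (\<lambda>h. X x (h *\<^sub>R w))) (at 0)"
    by (rule has_derivative_compose)
  have "xi (x + h *\<^sub>R w) = xi x + h *\<^sub>R (C (height x) *v w)" for h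
  proof -
    have "height (x + h *\<^sub>R w) = height x" using assms by (simp add: height_def algebra_simps inner_simps)
    moreover have "x + h *\<^sub>R w - y0 = (x - y0) + h *\<^sub>R w" by simp
    ultimately show ?thesis unfolding xi_def by (simp only: matrix_vector_right_distrib matrix_vector_mult_scaleR)
  qed
  then have 2: "((\<lambda>h::real. xi (x + h *\<^sub>R w)) has_derivative (\<lambda>h. h *\<^sub>R (C (height x) *v w))) (at 0)"
    by (auto intro!: derivative_eq_intros)
  from has_derivative_unique[OF 1 2] have "X x (1 *\<^sub>R w) = 1 *\<^sub>R (C (height x) *v w)" by (rule fun_cong)
  then show ?thesis by simp
qed

lemma X_f: "X (f x) (A *v w) $ j = s j * X x w $ j"
proof -
  have "(f has_derivative (\<lambda>w. A *v w)) (at x)"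
    using smooth_on_imp_has_derivative[OF smooth_on_affine_map UNIV_I] by (metis frechet_derivative_affine_map)
  from has_derivative_compose[OF this xi_nth_derivative[of j "f x"]]
  have 1: "((\<lambda>x. xi (f x) $ j) has_derivative (\<lambda>w. X (f x) (A *v w) $ j)) (at x)" .
  have "((\<lambda>x. s j * xi x $ j + (if j = i0 then 1 else 0)) has_derivative (\<lambda>w. s j * X x w $ j + 0)) (at x)"
    by (intro has_derivative_add has_derivative_const has_derivative_mult_right xi_nth_derivative)
  then have 2: "((\<lambda>x. xi (f x) $ j) has_derivative (\<lambda>w. s j * X x w $ j)) (at x)"
    by (simp add: xi_f)
  from has_derivative_unique[OF 1 2] show ?thesis by (rule fun_cong)
qed

text \<open>A unit step of height is a full period of the cosine if coordinate \<open>i1\<close>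
  keeps its sign under the map, and half a period if it is reversed, so that the twist transforms
  with the same sign as that coordinate.\<close>

definition om :: real where
  "om = (if s i1 = 1 then 2 * pi else pi)"

text \<open>With xi the coordinate \<open>i1\<close>, the row \<open>i1\<close> is 1 + xi^2 times
  the differential of arctan xi - pi sin(om height); this dictates the form of the subtracted
  term.\<close>

definition frame :: "real^'n \<Rightarrow> real^'n^'n" where
  "frame x = (\<chi> j q. X x (axis q 1) $ j
     - (if j = i1 then pi * om * cos (om * height x) * (1 + (xi x $ i1)\<^sup>2) * l $ q else 0))"

lemma om: "pi \<le> om" "om > 0" "cos (om * (t + 1)) = s i1 * cos (om * t)"
proof -
  show "pi \<le> om" "om > 0" using pi_gt_zero by (auto simp: om_def)
  have "s i1 = 1 \<or> s i1 = -1" using s1[of i1] by linarith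
  then show "cos (om * (t + 1)) = s i1 * cos (om * t)"
  proof
    assume "s i1 = 1"
    then have "om * (t + 1) = om * t + 2 * pi" by (simp add: om_def algebra_simps)
    then have "cos (om * (t + 1)) = cos (om * t)" by (simp only: cos_periodic)
    then show ?thesis using \<open>s i1 = 1\<close> by simp
  next
    assume "s i1 = -1"
    then have "om * (t + 1) = om * t + pi" by (simp add: om_def algebra_simps)
    then have "cos (om * (t + 1)) = - cos (om * t)" by (simp only: cos_periodic_pi)
    then show ?thesis using \<open>s i1 = -1\<close> by simp
  qed
qed

lemma frame_vec: "(frame x *v w) $ j = X x w $ j
   - (if j = i1 then pi * om * cos (om * height x) * (1 + (xi x $ i1)\<^sup>2) * (l \<bullet> w) else 0)"
proof -
  have "w = (\<Sum>q\<in>UNIV. w $ q *\<^sub>R axis q 1)"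
    by (simp add: vec_eq_iff axis_def if_distrib cong: if_cong)
  then have "X x w = X x (\<Sum>q\<in>UNIV. w $ q *\<^sub>R axis q 1)" by simp
  also have "\<dots> = (\<Sum>q\<in>UNIV. w $ q *\<^sub>R X x (axis q 1))"
    by (simp add: linear_sum[OF linear_X] linear_cmul[OF linear_X])
  finally have "X x w $ j = (\<Sum>q\<in>UNIV. X x (axis q 1) $ j * w $ q)" by (simp add: mult.commute)
  then show ?thesis
    by (simp add: frame_def matrix_vector_mult_def left_diff_distrib sum_subtractf inner_vec_def sum_distrib_left mult.assoc)
qed

lemma smooth_frame: "smooth_on UNIV frame"
proof (intro smooth_on_matrix open_UNIV)
  fix j q
  have 1: "smooth_on UNIV (\<lambda>x. X x (axis q 1) $ j)"
    unfolding X_def by (intro smooth_on_vec_nth smooth_on_frechet_derivative smooth_xi open_UNIV)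
  have 2: "smooth_on UNIV (\<lambda>x. pi * om * cos (om * height x) * (1 + (xi x $ i1)\<^sup>2) * l $ q)"
    by (intro smooth_on_mult smooth_on_const smooth_on_compose_UNIV[OF _ smooth_on_cos] smooth_height
        smooth_on_add smooth_on_power smooth_on_vec_nth smooth_xi open_UNIV)
  show "smooth_on UNIV (\<lambda>x. frame x $ j $ q)"
    unfolding frame_def vec_lambda_beta
    by (cases "j = i1") (use smooth_on_diff[OF open_UNIV 1 2] 1 in simp_all)
qed

lemma invertible_frame: "invertible (frame x)"
proof -
  have "w = 0" if w: "frame x *v w = 0" for w
  proof -
    have "l \<bullet> w = 0" using arg_cong[OF w, of "\<lambda>z. z $ i0"] i01 by (simp add: frame_vec X_i0)
    then have "X x w $ j = 0" for j using arg_cong[OF w, of "\<lambda>z. z $ j"] by (simp add: frame_vec)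
    then have "C (height x) *v w = 0" using X_level[OF \<open>l \<bullet> w = 0\<close>, of x] by (simp add: vec_eq_iff)
    then show "w = 0" using matrix_inv_vec(2)[OF C_inv, of "height x" w] by simp
  qed
  then show ?thesis using invertible_left_inverse matrix_left_invertible_ker by blast
qed

lemma s_sq: "(s j)\<^sup>2 = 1"
  using s1[of j] by (metis one_power2 power2_abs)

lemma xi_i1_sq: "(xi (f x) $ i1)\<^sup>2 = (xi x $ i1)\<^sup>2"
  using i01 by (simp add: xi_f power_mult_distrib s_sq)

lemma frame_f: "(frame (f x) *v (A *v w)) $ j = s j * (frame x *v w) $ j"
  unfolding frame_vec X_f xi_i1_sq height_f lA om(3) by (simp add: algebra_simps)

text \<open>The extra factor at \<open>i0\<close> is invariant under the map and so leaves the rates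
  unchanged. It matches the coefficient of the twist in \<open>frame\<close>, which grows
  quadratically in coordinate \<open>i1\<close>, and so makes the twist controllable by the length
  at bounded height.\<close>

definition weight :: "'n \<Rightarrow> real^'n \<Rightarrow> real" where
  "weight j x = (if j = i0 then exp (2 * height x) * (1 + (xi x $ i1)\<^sup>2)\<^sup>2
     else if j \<in> S then exp (-2 * height x) else exp (2 * height x))"

lemma weight_pos: "weight j x > 0"
proof -
  have "1 + (xi x $ i1)\<^sup>2 > 0" by (rule add_pos_nonneg) auto
  then show ?thesis by (simp add: weight_def)
qed

lemma smooth_weight: "smooth_on UNIV (weight j)"
proof -
  have 1: "smooth_on UNIV (\<lambda>x. exp (c * height x))" for c
    by (intro smooth_on_compose_UNIV[OF _ smooth_on_exp] smooth_on_mult smooth_on_const smooth_height open_UNIV)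
  have 2: "smooth_on UNIV (\<lambda>x. exp (2 * height x) * (1 + (xi x $ i1)\<^sup>2)\<^sup>2)"
    by (intro smooth_on_mult 1 smooth_on_power smooth_on_add smooth_on_const smooth_on_vec_nth smooth_xi open_UNIV)
  show ?thesis unfolding weight_def[abs_def]
    by (cases "j = i0"; cases "j \<in> S") (use 1[of 2] 1[of "-2"] 2 in simp_all)
qed

lemma weight_f: "weight j (f x) = (if j \<in> S then exp (-2) else exp 2) * weight j x"
proof -
  have e: "exp (-2 * (height x + 1)) = exp (-2) * exp (-2 * height x)"
    "exp (2 * (height x + 1)) = exp 2 * exp (2 * height x)"
    by (simp_all add: algebra_simps flip: exp_add)
  show ?thesis unfolding weight_def height_f xi_i1_sq e using S by auto
qed

definition metric :: "real^'n \<Rightarrow> real^'n^'n" where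
  "metric = frame_metric weight frame"

lemma riemannian_metric: "riemannian_metric metric"
  unfolding metric_def
  by (rule riemannian_metric_frame_metric[OF smooth_frame invertible_frame smooth_weight weight_pos])

lemma splitting: "anosov_splitting metric f (coordinate_bundle frame S) (coordinate_bundle frame (- S))"
  unfolding metric_def
  by (rule anosov_splitting_frame_metric[OF A smooth_frame invertible_frame smooth_weight weight_pos s1 frame_f weight_f])

lemma dim_bundle: "dim (coordinate_bundle frame S x) = card S"
  by (rule continuous_subbundle_coordinate_bundle(2)[OF smooth_on_imp_continuous_on[OF smooth_frame] invertible_frame])

section \<open>Estimates and completeness for the twisted metric\<close>

lemma weight_le_rnorm:
  assumes "b \<ge> 0" "b\<^sup>2 \<le> weight j x"
  shows "b * \<bar>(frame x *v w) $ j\<bar> \<le> rnorm metric x w"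
proof -
  have "(b * \<bar>(frame x *v w) $ j\<bar>)\<^sup>2 \<le> weight j x * ((frame x *v w) $ j)\<^sup>2"
    using assms by (simp add: power_mult_distrib mult_right_mono)
  also have "\<dots> \<le> (\<Sum>j\<in>UNIV. weight j x * ((frame x *v w) $ j)\<^sup>2)"
    by (rule member_le_sum) (auto intro: mult_nonneg_nonneg less_imp_le[OF weight_pos])
  finally show ?thesis
    unfolding rnorm_def metric_def inner_frame_metric by (rule real_le_rsqrt)
qed

lemma exp_sq: "(exp (t::real))\<^sup>2 = exp (2 * t)"
  by (simp add: power2_eq_square flip: exp_add)

lemma bound_i0: "exp (height x) * (1 + (xi x $ i1)\<^sup>2) * \<bar>l \<bullet> w\<bar> \<le> rnorm metric x w"
  using weight_le_rnorm[of "exp (height x) * (1 + (xi x $ i1)\<^sup>2)" i0 x w] i01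
  by (simp add: weight_def frame_vec X_i0 power_mult_distrib exp_sq)

lemma bound_height: "exp (height x) * \<bar>l \<bullet> w\<bar> \<le> rnorm metric x w"
proof -
  have "exp (height x) * 1 * \<bar>l \<bullet> w\<bar> \<le> exp (height x) * (1 + (xi x $ i1)\<^sup>2) * \<bar>l \<bullet> w\<bar>"
    by (intro mult_right_mono mult_left_mono) auto
  from order_trans[OF this bound_i0] show ?thesis by (simp only: mult_1_right)
qed

lemma bound_i1: "\<bar>(frame x *v w) $ i1\<bar> \<le> exp (height x) * rnorm metric x w"
proof -
  have "exp (- height x) * \<bar>(frame x *v w) $ i1\<bar> \<le> rnorm metric x w"
    using weight_le_rnorm[of "exp (- height x)" i1 x w] i01 S by (simp add: weight_def exp_sq)
  then show ?thesis by (simp add: exp_minus field_simps)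
qed

lemma bound_other:
  assumes "j \<noteq> i0" "j \<noteq> i1"
  shows "\<bar>X x w $ j\<bar> \<le> exp \<bar>height x\<bar> * rnorm metric x w"
proof -
  have "(exp (- \<bar>height x\<bar>))\<^sup>2 \<le> weight j x" using assms by (auto simp: exp_sq weight_def)
  from weight_le_rnorm[OF _ this, of w] have "exp (- \<bar>height x\<bar>) * \<bar>X x w $ j\<bar> \<le> rnorm metric x w"
    using assms by (simp add: frame_vec)
  then show ?thesis by (simp add: exp_minus field_simps)
qed

text \<open>As long as the height is bounded, every coordinate is Lipschitz along paths. For
  \<open>i1\<close> the differential is recovered by adding the twist back to the covector of the
  frame; the quadratic coefficient is absorbed by the weight at \<open>i0\<close>.\<close>

lemma bound_X: "\<bar>X x w $ j\<bar> \<le> (1 + pi * om) * exp \<bar>height x\<bar> * rnorm metric x w"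
proof -
  let ?R = "rnorm metric x w"
  have R: "?R \<ge> 0" by (rule rnorm_nonneg[OF riemannian_metric])
  have po: "pi * om > 0" using om by simp
  have ee: "exp (- height x) \<le> exp \<bar>height x\<bar>" "exp (height x) \<le> exp \<bar>height x\<bar>" by auto
  consider "j = i0" | "j = i1" | "j \<noteq> i0" "j \<noteq> i1" by blast
  then have "\<bar>X x w $ j\<bar> \<le> exp \<bar>height x\<bar> * ?R + (pi * om) * (exp \<bar>height x\<bar> * ?R)"
  proof cases
    case 1
    have "\<bar>l \<bullet> w\<bar> \<le> exp (- height x) * ?R" using bound_height[of x w] by (simp add: exp_minus field_simps)
    also have "\<dots> \<le> exp \<bar>height x\<bar> * ?R" using ee R by (intro mult_right_mono) auto
    finally show ?thesis using 1 po R by (simp add: X_i0 add_increasing2)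
  next
    case 2
    have "(1 + (xi x $ i1)\<^sup>2) * \<bar>l \<bullet> w\<bar> \<le> exp (- height x) * ?R"
      using bound_i0[of x w] by (simp add: exp_minus field_simps)
    also have "\<dots> \<le> exp \<bar>height x\<bar> * ?R" using ee R by (intro mult_right_mono) auto
    finally have 3: "(1 + (xi x $ i1)\<^sup>2) * \<bar>l \<bullet> w\<bar> \<le> exp \<bar>height x\<bar> * ?R" .
    have "\<bar>pi * om * cos (om * height x) * (1 + (xi x $ i1)\<^sup>2) * (l \<bullet> w)\<bar>
       = (pi * om * \<bar>cos (om * height x)\<bar>) * ((1 + (xi x $ i1)\<^sup>2) * \<bar>l \<bullet> w\<bar>)"
      using om by (simp add: abs_mult abs_of_nonneg)
    also have "\<dots> \<le> (pi * om * 1) * (exp \<bar>height x\<bar> * ?R)"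
    proof (rule mult_mono)
      show "pi * om * \<bar>cos (om * height x)\<bar> \<le> pi * om * 1" using po by (intro mult_left_mono) auto
    qed (use 3 po less_imp_le[OF om(2)] in auto)
    finally have 4: "\<bar>pi * om * cos (om * height x) * (1 + (xi x $ i1)\<^sup>2) * (l \<bullet> w)\<bar> \<le> (pi * om) * (exp \<bar>height x\<bar> * ?R)" by simp
    have "exp (height x) * ?R \<le> exp \<bar>height x\<bar> * ?R" using ee R by (intro mult_right_mono) auto
    with bound_i1[of x w] have "\<bar>(frame x *v w) $ i1\<bar> \<le> exp \<bar>height x\<bar> * ?R" by linarith
    moreover have "X x w $ i1 = (frame x *v w) $ i1 + pi * om * cos (om * height x) * (1 + (xi x $ i1)\<^sup>2) * (l \<bullet> w)"
      by (simp add: frame_vec)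
    ultimately show ?thesis using 4 unfolding 2 by linarith
  next
    case 3
    have "0 \<le> (pi * om) * (exp \<bar>height x\<bar> * ?R)" using less_imp_le[OF om(2)] R by (intro mult_nonneg_nonneg) auto
    then show ?thesis using bound_other[OF 3, of x w] by linarith
  qed
  then show ?thesis by (simp add: algebra_simps)
qed

text \<open>By the choice of the \<open>i1\<close>-th covector, \<open>phase\<close> varies slowly, relative to length, where
  \<open>height\<close> is very negative. But \<open>arctan\<close> is confined to an interval of length \<open>pi\<close> while the sine
  term swings by \<open>2 * pi\<close> whenever \<open>height\<close> drops by two, so such drops are expensive.\<close>

definition phase :: "real^'n \<Rightarrow> real" where
  "phase x = arctan (xi x $ i1) - pi * sin (om * height x)"

lemma phase_derivative: "(phase has_derivative (\<lambda>w. (frame x *v w) $ i1 / (1 + (xi x $ i1)\<^sup>2))) (at x)"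
proof -
  have p: "1 + (xi x $ i1)\<^sup>2 \<noteq> 0" by (smt (verit) zero_le_power2)
  have 1: "((\<lambda>x. arctan (xi x $ i1)) has_derivative (\<lambda>w. X x w $ i1 / (1 + (xi x $ i1)\<^sup>2))) (at x)"
    using has_derivative_compose[OF xi_nth_derivative[of i1 x] DERIV_arctan[of "xi x $ i1", unfolded has_field_derivative_def]]
    by (simp add: divide_inverse mult.commute)
  have 2: "((\<lambda>x. sin (om * height x)) has_derivative (\<lambda>w. cos (om * height x) * (om * (l \<bullet> w)))) (at x)"
    using has_derivative_compose[OF has_derivative_mult_right[OF height_derivative, of om]
      DERIV_sin[of "om * height x", unfolded has_field_derivative_def]] by simp
  have "(phase has_derivative (\<lambda>w. X x w $ i1 / (1 + (xi x $ i1)\<^sup>2) - pi * (cos (om * height x) * (om * (l \<bullet> w))))) (at x)"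
    unfolding phase_def[abs_def] by (intro has_derivative_diff 1 has_derivative_mult_right 2)
  moreover have "X x w $ i1 / (1 + (xi x $ i1)\<^sup>2) - pi * (cos (om * height x) * (om * (l \<bullet> w)))
      = (frame x *v w) $ i1 / (1 + (xi x $ i1)\<^sup>2)" for w
    using p by (simp add: frame_vec field_simps)
  ultimately show ?thesis by simp
qed

text \<open>Since \<open>om\<close> is at least pi, an interval of length 2 contains a full
  period.\<close>

lemma sin_extremes:
  obtains T T' where "y \<le> T" "T \<le> y + 2" "sin (om * T) = 1" "y \<le> T'" "T' \<le> y + 2" "sin (om * T') = - 1"
proof -
  have ex: "\<exists>T. y \<le> T \<and> T \<le> y + 2 \<and> (\<exists>m::int. om * T = a + 2 * pi * of_int m)" for a
  proof -
    define m where "m = \<lceil>(om * y - a) / (2 * pi)\<rceil>"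
    let ?T = "(a + 2 * pi * of_int m) / om"
    have "(om * y - a) / (2 * pi) \<le> of_int m" "of_int m < (om * y - a) / (2 * pi) + 1"
      unfolding m_def by linarith+
    then have 1: "om * y \<le> a + 2 * pi * of_int m" "a + 2 * pi * of_int m \<le> om * y + 2 * pi"
      using pi_gt_zero by (simp_all add: field_simps)
    have "y \<le> ?T" using 1(1) om(2) by (simp add: field_simps)
    moreover have "om * y + 2 * pi \<le> (y + 2) * om" using om(1) by (simp add: algebra_simps)
    then have "?T \<le> y + 2" using 1(2) om(2) by (simp add: field_simps)
    moreover have "om * ?T = a + 2 * pi * of_int m" using om(2) by simp
    ultimately show ?thesis by blast
  qed
  obtain T m where T: "y \<le> T" "T \<le> y + 2" "om * T = pi / 2 + 2 * pi * of_int (m::int)" using ex by blast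
  obtain T' m' where T': "y \<le> T'" "T' \<le> y + 2" "om * T' = - (pi / 2) + 2 * pi * of_int (m'::int)" using ex by blast
  have "sin (om * T) = 1" "sin (om * T') = - 1"
    unfolding T(3) T'(3) sin_add sin_int_2pin cos_int_2pin by simp_all
  then show ?thesis using that T T' by blast
qed

text \<open>The weight at \<open>i0\<close> is at least exp(2 height), so exp(height) is 1-Lipschitz
  with respect to length; in this sense the upper end is infinitely far away.\<close>

lemma height_upper:
  assumes \<gamma>: "finite_length_path metric \<gamma>" "integral {0..1} (speed metric \<gamma>) \<le> L" "b \<in> {0..1}"
  shows "exp (height (\<gamma> b)) \<le> exp (height (\<gamma> 0)) + L"
proof -
  have "norm (exp (height (\<gamma> b)) - exp (height (\<gamma> 0))) \<le> 1 * integral {0..1} (speed metric \<gamma>)"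
  proof (rule path_Lipschitz_bound[OF riemannian_metric \<gamma>(1), of 0 b 1 "\<lambda>x. exp (height x)" "\<lambda>x w. exp (height x) * (l \<bullet> w)"])
    show "((\<lambda>x. exp (height x)) has_derivative (\<lambda>w. exp (height (\<gamma> t)) * (l \<bullet> w))) (at (\<gamma> t))" for t
      using has_derivative_compose[OF height_derivative DERIV_exp[unfolded has_field_derivative_def]] .
    show "norm (exp (height (\<gamma> t)) * (l \<bullet> w)) \<le> 1 * rnorm metric (\<gamma> t) w" for t w
      using bound_height[of "\<gamma> t" w] by (simp add: abs_mult)
  qed (use \<gamma>(3) in auto)
  then show ?thesis using \<gamma>(2) by (simp add: abs_le_iff)
qed

text \<open>Covector \<open>i1\<close> has weight exp(-2 height), so below height \<open>T\<close>
  the phase varies by at most \<open>exp T\<close> times the length, a factor that becomes small as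
  \<open>T\<close> decreases.\<close>

lemma phase_Lipschitz:
  assumes \<gamma>: "finite_length_path metric \<gamma>" "0 \<le> a" "b \<le> 1"
    and T: "\<And>t. t \<in> {a..b} \<Longrightarrow> height (\<gamma> t) \<le> T" and cd: "c \<in> {a..b}" "d \<in> {a..b}"
  shows "\<bar>phase (\<gamma> c) - phase (\<gamma> d)\<bar> \<le> exp T * integral {0..1} (speed metric \<gamma>)"
proof -
  have *: "norm (phase (\<gamma> d) - phase (\<gamma> c)) \<le> exp T * integral {0..1} (speed metric \<gamma>)"
    if cd: "c \<in> {a..b}" "d \<in> {a..b}" "c \<le> d" for c d
  proof (rule path_Lipschitz_bound[OF riemannian_metric \<gamma>(1) _ _ _ _ phase_derivative])
    fix t w assume t: "t \<in> {c..d}"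
    let ?x = "\<gamma> t"
    have "norm ((frame ?x *v w) $ i1 / (1 + (xi ?x $ i1)\<^sup>2)) \<le> \<bar>(frame ?x *v w) $ i1\<bar>"
    proof -
      have "1 \<le> 1 + (xi ?x $ i1)\<^sup>2" by simp
      then have "\<bar>(frame ?x *v w) $ i1\<bar> / (1 + (xi ?x $ i1)\<^sup>2) \<le> \<bar>(frame ?x *v w) $ i1\<bar> / 1"
        by (intro divide_left_mono) (auto intro: add_pos_nonneg)
      then show ?thesis by simp
    qed
    also have "\<dots> \<le> exp (height ?x) * rnorm metric ?x w" by (rule bound_i1)
    also have "\<dots> \<le> exp T * rnorm metric ?x w"
      using T[of t] t cd by (intro mult_right_mono rnorm_nonneg[OF riemannian_metric]) auto
    finally show "norm ((frame ?x *v w) $ i1 / (1 + (xi ?x $ i1)\<^sup>2)) \<le> exp T * rnorm metric ?x w" .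
  qed (use cd \<gamma> in auto)
  show ?thesis
  proof (cases "c \<le> d")
    case True
    then show ?thesis using *[OF cd True] by (simp add: abs_minus_commute)
  next
    case False
    then show ?thesis using *[OF cd(2,1)] by simp
  qed
qed

text \<open>\<open>T0\<close> is so low that a path of length at most \<open>L\<close> changes the
  phase by less than pi while it stays below \<open>T0\<close>. A further descent by 2 would pass a
  maximum and a minimum of the sine and change the phase by more than pi.\<close>

lemma height_lower:
  assumes \<gamma>: "finite_length_path metric \<gamma>" "integral {0..1} (speed metric \<gamma>) \<le> L" "b \<in> {0..1}"
    and T0: "T0 \<le> height (\<gamma> 0)" "exp T0 * L < pi"
  shows "T0 - 2 \<le> height (\<gamma> b)"
proof (rule ccontr)
  assume "\<not> T0 - 2 \<le> height (\<gamma> b)"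
  then have ub: "height (\<gamma> b) < T0 - 2" by simp
  let ?u = "\<lambda>t. height (\<gamma> t)"
  have "continuous_on {0..1} \<gamma>"
    using \<gamma>(1) by (auto simp: finite_length_path_def valid_path_def piecewise_C1_differentiable_on_def)
  then have cont: "continuous_on {0..1} ?u"
    unfolding height_def by (intro continuous_intros)
  have ivt: "\<exists>z\<in>{x..y}. ?u z = T" if xy: "0 \<le> x" "x \<le> y" "y \<le> 1" "?u y \<le> T" "T \<le> ?u x" for x y T
  proof -
    have "continuous_on {x..y} ?u" using cont by (rule continuous_on_subset) (use xy in auto)
    from IVT2'[OF xy(4,5,2) this] show ?thesis by auto
  qed
  \<comment> \<open>Its largest element is the last time at height \<open>T0\<close>; from there up
    to \<open>b\<close> the path does not rise above \<open>T0\<close>.\<close>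
  define Z where "Z = {t\<in>{0..b}. ?u t = T0}"
  have "closed Z" unfolding Z_def
    using continuous_on_subset[OF cont, of "{0..b}"] \<gamma>(3)
    by (intro continuous_closed_preimage_constant) auto
  then have "compact Z" by (auto simp: compact_eq_bounded_closed Z_def intro: bounded_subset[of "{0..b}"])
  moreover have "Z \<noteq> {}" using ivt[of 0 b T0] \<gamma>(3) ub T0(1) by (auto simp: Z_def)
  ultimately obtain a where a: "a \<in> Z" "\<And>t. t \<in> Z \<Longrightarrow> t \<le> a" using compact_attains_sup[of Z] by metis
  have a0: "0 \<le> a" "a \<le> b" "?u a = T0" using a(1) by (auto simp: Z_def)
  have uT: "?u t \<le> T0" if t: "t \<in> {a..b}" for t
  proof (rule ccontr)
    assume ut: "\<not> ?u t \<le> T0"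
    then obtain z where z: "z \<in> {t..b}" "?u z = T0" using ivt[of t b T0] a0 t \<gamma>(3) ub by auto
    then have "z \<in> Z" using t a0 by (auto simp: Z_def)
    then have "t = a" using a(2)[of z] z t by auto
    then show False using ut a0 by simp
  qed
  obtain T T' where T: "T0 - 2 \<le> T" "T \<le> T0 - 2 + 2" "sin (om * T) = 1" "T0 - 2 \<le> T'" "T' \<le> T0 - 2 + 2" "sin (om * T') = - 1"
    by (rule sin_extremes[of "T0 - 2"])
  obtain c where c: "c \<in> {a..b}" "?u c = T" using ivt[of a b T] a0 T \<gamma>(3) ub by auto
  obtain d where d: "d \<in> {a..b}" "?u d = T'" using ivt[of a b T'] a0 T \<gamma>(3) ub by auto
  \<comment> \<open>The sine term contributes 2 pi, while the two arctangents differ by less than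
    pi.\<close>
  have "phase (\<gamma> d) - phase (\<gamma> c) > pi"
    using T c(2) d(2) arctan_lbound[of "xi (\<gamma> d) $ i1"] arctan_ubound[of "xi (\<gamma> c) $ i1"] by (simp add: phase_def)
  moreover have "\<bar>phase (\<gamma> c) - phase (\<gamma> d)\<bar> \<le> exp T0 * integral {0..1} (speed metric \<gamma>)"
    by (rule phase_Lipschitz[OF \<gamma>(1) a0(1) _ uT c(1) d(1)]) (use \<gamma>(3) in auto)
  moreover have "exp T0 * integral {0..1} (speed metric \<gamma>) \<le> exp T0 * L" using \<gamma>(2) by simp
  ultimately show False using T0(2) by linarith
qed

lemma complete: "complete_riemannian_metric metric"
proof (rule complete_riemannian_metricI[OF riemannian_metric])
  fix p and L :: real
  define L' where "L' = \<bar>L\<bar>"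
  \<comment> \<open>The logarithm makes \<open>exp T0 * L'\<close> at most
    \<open>L' / (L' + 1)\<close>, below the threshold pi of \<open>height_lower\<close>.\<close>
  define T0 where "T0 = min (height p) (- ln (L' + 1))"
  define T2 where "T2 = ln (exp (height p) + L')"
  have L': "L' \<ge> 0" "L \<le> L'" by (auto simp: L'_def)
  have T0: "T0 \<le> height p" "exp T0 * L' < pi"
  proof -
    show "T0 \<le> height p" by (simp add: T0_def)
    have "exp T0 \<le> exp (- ln (L' + 1))" by (simp add: T0_def)
    also have "\<dots> = 1 / (L' + 1)" using L' by (simp add: exp_minus inverse_eq_divide)
    finally have "exp T0 * L' \<le> 1 / (L' + 1) * L'" using L' by (intro mult_right_mono) auto
    also have "\<dots> < 1" using L' by (simp add: field_simps)
    also have "1 < pi" using pi_gt3 by simp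
    finally show "exp T0 * L' < pi" .
  qed
  define H where "H = \<bar>T0 - 2\<bar> + \<bar>T2\<bar>"
  define M where "M = (1 + pi * om) * exp H"
  have M: "M \<ge> 0" using om by (simp add: M_def)
  define R where "R = (\<Sum>j\<in>UNIV. \<bar>xi p $ j\<bar> + M * L')"
  \<comment> \<open>With the height confined to a compact interval the matrices \<open>C t\<close>
    are uniformly invertible; the minimum found here converts a bound on \<open>xi\<close> into a
    bound on the point.\<close>
  let ?K = "{-H..H} \<times> sphere (0::real^'n) 1" and ?q = "\<lambda>z. norm (C (fst z) *v snd z)"
  have "continuous_on UNIV C" by (rule smooth_on_imp_continuous_on[OF C_smooth])
  then have "continuous_on ?K (\<lambda>z. C (fst z))" by (rule continuous_on_compose2) (auto intro: continuous_intros)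
  then have cont: "continuous_on ?K ?q"
    by (intro continuous_on_norm continuous_on_matrix_vector_mult continuous_on_snd continuous_on_id)
  have "H \<ge> 0" by (simp add: H_def)
  then have ne: "?K \<noteq> {}" by auto
  have comp: "compact ?K" by (intro compact_Times compact_Icc compact_sphere)
  obtain z where z: "z \<in> ?K" "\<forall>y\<in>?K. ?q z \<le> ?q y" using continuous_attains_inf[OF comp ne cont] by auto
  define m where "m = ?q z"
  have "snd z \<noteq> 0" using z(1) by auto
  then have "C (fst z) *v snd z \<noteq> 0" using matrix_inv_vec(2)[OF C_inv, of "fst z" "snd z"] by auto
  then have m: "m > 0" by (simp add: m_def)
  have Cm: "m * norm w \<le> norm (C t *v w)" if t: "\<bar>t\<bar> \<le> H" for t w
  proof (cases "w = 0")
    case False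
    have "(t, w /\<^sub>R norm w) \<in> ?K" using t False by auto
    then have "m \<le> ?q (t, w /\<^sub>R norm w)" using z(2) unfolding m_def by blast
    then show ?thesis using False by (simp add: matrix_vector_mult_scaleR field_simps)
  qed simp
  have "norm (pathfinish \<gamma>) \<le> norm y0 + R / m"
    if \<gamma>: "finite_length_path metric \<gamma>" "pathstart \<gamma> = p" "integral {0..1} (speed metric \<gamma>) \<le> L" for \<gamma>
  proof -
    have int: "integral {0..1} (speed metric \<gamma>) \<le> L'" using \<gamma>(3) L' by simp
    have p: "\<gamma> 0 = p" using \<gamma>(2) by (simp add: pathstart_def)
    have h: "\<bar>height (\<gamma> t)\<bar> \<le> H" if t: "t \<in> {0..1}" for t
    proof -
      have "T0 - 2 \<le> height (\<gamma> t)" by (rule height_lower[OF \<gamma>(1) int t]) (use T0 p in auto)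
      moreover have "exp (height (\<gamma> t)) \<le> exp (height p) + L'" using height_upper[OF \<gamma>(1) int t] p by simp
      then have "height (\<gamma> t) \<le> T2" unfolding T2_def
        using L' by (subst ln_ge_iff) (auto intro: add_pos_nonneg)
      ultimately show ?thesis by (auto simp: H_def)
    qed
    have xj: "\<bar>xi (\<gamma> 1) $ j\<bar> \<le> \<bar>xi p $ j\<bar> + M * L'" for j
    proof -
      have "norm (xi (\<gamma> 1) $ j - xi (\<gamma> 0) $ j) \<le> M * integral {0..1} (speed metric \<gamma>)"
      proof (rule path_Lipschitz_bound[OF riemannian_metric \<gamma>(1) _ _ _ M xi_nth_derivative])
        fix t w assume t: "t \<in> {0..1::real}"
        have "\<bar>X (\<gamma> t) w $ j\<bar> \<le> (1 + pi * om) * exp \<bar>height (\<gamma> t)\<bar> * rnorm metric (\<gamma> t) w" by (rule bound_X)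
        also have "\<dots> \<le> M * rnorm metric (\<gamma> t) w"
          unfolding M_def using h[OF t] om by (intro mult_right_mono mult_left_mono rnorm_nonneg[OF riemannian_metric]) auto
        finally show "norm (X (\<gamma> t) w $ j) \<le> M * rnorm metric (\<gamma> t) w" by simp
      qed auto
      also have "\<dots> \<le> M * L'" using int M by (intro mult_left_mono)
      finally show ?thesis using p by simp
    qed
    have "m * norm (\<gamma> 1 - y0) \<le> norm (xi (\<gamma> 1))"
      using Cm[OF h[of 1], of "\<gamma> 1 - y0"] by (simp add: xi_def)
    also have "\<dots> \<le> (\<Sum>j\<in>UNIV. \<bar>xi (\<gamma> 1) $ j\<bar>)" by (rule norm_le_l1_cart)
    also have "\<dots> \<le> R" unfolding R_def by (intro sum_mono xj)
    finally have "norm (\<gamma> 1 - y0) \<le> R / m" using m by (simp add: field_simps)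
    moreover have "norm (\<gamma> 1) \<le> norm y0 + norm (\<gamma> 1 - y0)" using norm_triangle_ineq[of y0 "\<gamma> 1 - y0"] by simp
    ultimately show ?thesis by (simp add: pathfinish_def)
  qed
  then show "\<exists>B. \<forall>\<gamma>. finite_length_path metric \<gamma> \<and> pathstart \<gamma> = p \<and> integral {0..1} (speed metric \<gamma>) \<le> L
      \<longrightarrow> norm (pathfinish \<gamma>) \<le> B" by (intro exI[of _ "norm y0 + R / m"]) auto
qed

end

section \<open>From eigenvectors to the drift frame\<close>

lemma adapted_coordinates:
  fixes e l :: "real^'n"
  assumes le: "l \<bullet> e = 1"
  obtains B :: "real^'n^'n" and i0 where "invertible B" "B *v e = axis i0 1" "\<forall>x. (B *v x) $ i0 = l \<bullet> x"
proof -
  let ?E = "span {e}" and ?F = "{x. l \<bullet> x = 0}"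
  have e0: "e \<noteq> 0" using le by auto
  have E: "subspace ?E" "subspace ?F" by (simp_all add: subspace_hyperplane)
  have "x = 0" if "x \<in> ?E" "x \<in> ?F" for x
  proof -
    from that(1) obtain k where "x = k *\<^sub>R e" by (auto simp: span_singleton)
    then show "x = 0" using that(2) le by simp
  qed
  then have int: "?E \<inter> ?F = {0}" using E by (auto simp: subspace_0)
  have dec: "x - (l \<bullet> x) *\<^sub>R e \<in> ?F" "(l \<bullet> x) *\<^sub>R e \<in> ?E" for x
    using le by (simp_all add: inner_diff_right span_base span_scale)
  have "\<exists>a b. x = a + b \<and> a \<in> ?E \<and> b \<in> ?F" for x
    using dec[of x] by (intro exI[of _ "(l \<bullet> x) *\<^sub>R e"] exI[of _ "x - (l \<bullet> x) *\<^sub>R e"]) simp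
  then have sum: "{a + b | a b. a \<in> ?E \<and> b \<in> ?F} = UNIV" by auto
  obtain P :: "real^'n^'n" and S where S: "card S = dim ?E" and P: "invertible P"
    and PE: "\<forall>j\<in>S. P *v axis j 1 \<in> ?E" and "\<forall>j\<in>-S. P *v axis j 1 \<in> ?F"
    and "\<forall>x\<in>?E. \<forall>i\<in>-S. (matrix_inv P *v x) $ i = 0" and QF: "\<forall>x\<in>?F. \<forall>i\<in>S. (matrix_inv P *v x) $ i = 0"
    by (rule adapted_basis_matrix[OF E int sum], rule that)
  have "dim ?E = 1" using e0 by (simp add: dim_singleton)
  then obtain i0 where i0: "S = {i0}" using S card_1_singletonE by metis
  obtain k where k: "P *v axis i0 1 = k *\<^sub>R e" using PE i0 by (auto simp: span_singleton)
  have Qe: "k *\<^sub>R (matrix_inv P *v e) = axis i0 1"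
    using matrix_inv_vec(2)[OF P, of "axis i0 1"] by (simp add: k matrix_vector_mult_scaleR)
  then have k0: "k \<noteq> 0" by (auto simp: axis_eq_0_iff[symmetric])
  \<comment> \<open>The chosen basis vector of the line through \<open>e\<close> is the multiple
    \<open>k *\<^sub>R e\<close>; rescaling this coordinate by \<open>k\<close> sends
    \<open>e\<close> itself to the axis vector.\<close>
  let ?d = "(\<lambda>_. 1)(i0 := k)"
  define B where "B = diag_matrix ?d ** matrix_inv P"
  have B: "(B *v x) $ i = ?d i * (matrix_inv P *v x) $ i" for x i
    unfolding B_def matrix_vector_mul_assoc[symmetric] diag_matrix_vec ..
  have Qi: "k * (matrix_inv P *v e) $ i = (if i = i0 then 1 else 0)" for i
    using arg_cong[OF Qe, of "\<lambda>z. z $ i"] by (simp add: axis_def eq_commute)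
  have Be: "B *v e = axis i0 1"
  proof -
    have "(B *v e) $ i = axis i0 1 $ i" for i
      using Qi[of i] k0 by (cases "i = i0") (auto simp: B axis_def)
    then show ?thesis by (simp add: vec_eq_iff)
  qed
  have "(B *v x) $ i0 = l \<bullet> x" for x
  proof -
    have "(matrix_inv P *v (x - (l \<bullet> x) *\<^sub>R e)) $ i0 = 0" using QF dec(1)[of x] i0 by blast
    then have "(matrix_inv P *v x) $ i0 = (l \<bullet> x) * (matrix_inv P *v e) $ i0"
      by (simp add: matrix_vector_mult_diff_distrib matrix_vector_mult_scaleR)
    then show ?thesis using Qi[of i0] by (simp add: B mult.left_commute)
  qed
  moreover have "invertible B"
    unfolding B_def by (intro invertible_mult invertible_diag_matrix invertible_matrix_inv P) (use k0 in auto)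
  ultimately show ?thesis using that Be by blast
qed

lemma drift_index_exists:
  fixes A :: "real^'n^'n" and e l v :: "real^'n"
  assumes A: "invertible A" and Ae: "A *v e = e" and lA: "\<And>x. l \<bullet> (A *v x) = l \<bullet> x" and le: "l \<bullet> e = 1"
    and lv: "l \<bullet> v = 1" and ker: "\<And>x. l \<bullet> x = 0 \<Longrightarrow> \<exists>z. A *v z - z = x"
    and k: "k \<in> {1..CARD('n) - 1}"
  obtains g Es Eu where "complete_riemannian_metric g" "anosov_splitting g (affine_map A v) Es Eu" "\<forall>x. dim (Es x) = k"
proof -
  \<comment> \<open>Both vectors have drift 1 under \<open>l\<close>, so their difference lies in
    the range of A - 1, and some point \<open>y0\<close> is displaced by exactly
    \<open>e\<close>.\<close>
  have "l \<bullet> (e - v) = 0" using le lv by (simp add: inner_diff_right)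
  then obtain y0 where "A *v y0 - y0 = e - v" using ker by blast
  then have y0: "A *v y0 + v - y0 = e" by (simp add: algebra_simps)
  obtain B :: "real^'n^'n" and i0 where B: "invertible B" "B *v e = axis i0 1" "\<forall>x. (B *v x) $ i0 = l \<bullet> x"
    using adapted_coordinates[OF le] .
  \<comment> \<open>In these coordinates the linear part fixes coordinate \<open>i0\<close>: its row
    because \<open>l\<close> is a left eigenvector, its column because \<open>e\<close> is a right
    one.\<close>
  define M where "M = B ** A ** matrix_inv B"
  have Mvec: "M *v (B *v x) = B *v (A *v x)" for x
  proof -
    have "M *v (B *v x) = B *v (A *v (matrix_inv B *v (B *v x)))"
      unfolding M_def by (simp only: matrix_vector_mul_assoc matrix_mul_assoc)
    then show ?thesis by (simp only: matrix_inv_vec[OF B(1)])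
  qed
  have M: "invertible M" unfolding M_def by (intro invertible_mult invertible_matrix_inv A B)
  have nth: "N $ i $ j = (N *v axis j 1) $ i" for N :: "real^'n^'n" and i j
    by (simp add: matrix_vector_mult_def axis_def if_distrib cong: if_cong)
  have "M $ i0 $ j = (if i0 = j then 1 else 0)" for j
  proof -
    obtain x where x: "axis j 1 = B *v x" using matrix_inv_vec(1)[OF B(1)] by metis
    have "M $ i0 $ j = (axis j 1 :: real^'n) $ i0"
      unfolding nth[of M] x Mvec using B(3) lA by simp
    then show ?thesis by (simp add: axis_def)
  qed
  moreover have "M $ j $ i0 = (if i0 = j then 1 else 0)" for j
  proof -
    have "M *v axis i0 1 = axis i0 1" using Mvec[of e] by (simp add: B(2) Ae)
    then show ?thesis unfolding nth[of M] by (simp add: axis_def eq_commute)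
  qed
  ultimately have fM: "fixes_coords {i0} M" by (simp add: fixes_coords_def)
  obtain C :: "real \<Rightarrow> real^'n^'n" and s where C: "smooth_on UNIV C" and C_inv: "\<And>t. invertible (C t)"
    and Cf: "\<And>t. fixes_coords {i0} (C t)" and s: "\<And>i. \<bar>s i\<bar> = 1"
    and Crec: "\<And>t. C (t + 1) ** M = diag_matrix s ** C t"
    by (rule periodic_frame_exists[OF M fM]) (rule that; simp)
  \<comment> \<open>Leaving out \<open>i0\<close> requires \<open>k\<close> to be at most
    \<open>CARD('n) - 1\<close>; the twist takes place in a member of \<open>S0\<close>, which
    requires \<open>k\<close> to be at least 1.\<close>
  obtain S0 where S0: "S0 \<subseteq> UNIV - {i0}" "card S0 = k"
    using obtain_subset_with_card_n[of k "UNIV - {i0}"] k by (auto simp: card_Diff_singleton)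
  then obtain i1 where i1: "i1 \<in> S0" using k by fastforce
  interpret D: drift_frame A v e l y0 "\<lambda>t. C t ** B" s i0 i1 S0
  proof
    show "smooth_on UNIV (\<lambda>t. C t ** B)" by (intro smooth_on_matrix_mult C smooth_on_const open_UNIV)
    show "invertible (C t ** B)" for t by (intro invertible_mult C_inv B(1))
    have Ci: "C t $ j $ i0 = (if i0 = j then 1 else 0)" "C t $ i0 $ j = (if i0 = j then 1 else 0)" for t j
      using Cf[of t] by (simp_all add: fixes_coords_def)
    have "(C t *v axis i0 1) $ j = axis i0 1 $ j" for t j
      unfolding nth[symmetric] Ci(1) by (auto simp: axis_def)
    then have "C t *v axis i0 1 = axis i0 1" for t by (simp add: vec_eq_iff)
    then show "(C t ** B) *v e = axis i0 1" for t
      by (simp add: B(2) flip: matrix_vector_mul_assoc)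
    show "((C t ** B) *v x) $ i0 = l \<bullet> x" for t x
    proof -
      have "(C t *v (B *v x)) $ i0 = (B *v x) $ i0"
        unfolding matrix_vector_mult_def[of "C t"] by (simp add: Ci(2) sum_delta_mult)
      then show ?thesis using B(3) by (simp add: matrix_vector_mul_assoc)
    qed
    show "(C (t + 1) ** B) *v (A *v x) = diag_matrix s *v ((C t ** B) *v x)" for t x
    proof -
      have "(C (t + 1) ** B) *v (A *v x) = (C (t + 1) ** M) *v (B *v x)"
        unfolding matrix_vector_mul_assoc[symmetric] Mvec ..
      then show ?thesis unfolding Crec by (simp add: matrix_vector_mul_assoc matrix_mul_assoc)
    qed
  qed (use A Ae lA le y0 s S0 i1 in auto)
  show ?thesis using that[OF D.complete D.splitting] D.dim_bundle S0(2) by simp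
qed

section \<open>Simple eigenvalue one\<close>

lemma complex_matrix_diff: "complex_matrix (A - B) = complex_matrix A - complex_matrix B"
  by (simp add: complex_matrix_def vec_eq_iff)

lemma complex_matrix_mat: "complex_matrix (mat c) = mat (complex_of_real c)"
  by (simp add: complex_matrix_def mat_def vec_eq_iff)

lemma det_complex_matrix: "det (complex_matrix A) = complex_of_real (det A)"
  by (simp add: det_def complex_matrix_def)

lemma poly_charpoly_of_real: "poly (charpoly (complex_matrix A)) (complex_of_real x) = complex_of_real (det (mat x - A))"
  by (simp add: poly_charpoly det_complex_matrix flip: complex_matrix_mat complex_matrix_diff)

text \<open>Choosing the eigenvector as a column of \<open>P\<close>, the factor \<open>X - 1\<close> of the characteristic
  polynomial can be pulled out of that column; simplicity says that what remains is invertible at 1.\<close>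

lemma simple_eigenvalue_complement:
  fixes A :: "real^'n^'n"
  assumes e: "A *v e = e" "e \<noteq> 0" and ord: "order 1 (charpoly (complex_matrix A)) = 1"
  shows "\<exists>c z. x = c *\<^sub>R e + (z - A *v z)"
proof -
  obtain i0 where i0: "e $ i0 \<noteq> 0" using e(2) by (auto simp: vec_eq_iff)
  \<comment> \<open>The standard basis with one vector exchanged for \<open>e\<close>; choosing a
    nonzero coordinate of \<open>e\<close> keeps it a basis.\<close>
  define P :: "real^'n^'n" where "P = (\<chi> i j. if j = i0 then e $ i else mat 1 $ i $ j)"
  have "det P = e $ i0 * det (mat 1 :: real^'n^'n)"
    using cramer_lemma[of i0 "mat 1 :: real^'n^'n" e, unfolded matrix_vector_mul_lid] by (simp add: P_def)
  then have detP: "det P \<noteq> 0" using i0 by simp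
  let ?XA = "mat [:0, 1:] - poly_matrix A"
  \<comment> \<open>Column \<open>i0\<close> of (X - A) P is X - 1 times the constant vector
    \<open>e\<close>; \<open>N\<close> is the product with that factor removed, and \<open>D\<close>
    puts it back.\<close>
  define N where "N = (\<chi> i j. if j = i0 then [:complex_of_real (e $ i):] else (?XA ** poly_matrix P) $ i $ j)"
  define D :: "complex poly^'n^'n" where "D = (\<chi> i j. if i = j then (if i = i0 then [:-1, 1:] else 1) else 0)"
  have col: "(?XA ** poly_matrix P) $ i $ i0 = [:complex_of_real (e $ i):] * [:-1, 1:]" for i
  proof -
    have "(?XA ** poly_matrix P) $ i $ i0
        = (\<Sum>k\<in>UNIV. ((if i = k then [:0, 1:] else 0) - [:complex_of_real (A $ i $ k):]) * [:complex_of_real (e $ k):])"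
      by (simp add: matrix_matrix_mult_def mat_def poly_matrix_def P_def)
    also have "\<dots> = (\<Sum>k\<in>UNIV. (if i = k then [:0, 1:] else 0) * [:complex_of_real (e $ k):]
        - [:complex_of_real (A $ i $ k * e $ k):])"
      by (rule sum.cong[OF refl]) (simp only: left_diff_distrib, simp add: mult.commute)
    also have "\<dots> = (\<Sum>k\<in>UNIV. (if i = k then [:0, 1:] else 0) * [:complex_of_real (e $ k):])
        - (\<Sum>k\<in>UNIV. [:complex_of_real (A $ i $ k * e $ k):])"
      by (rule sum_subtractf)
    also have "\<dots> = [:0, 1:] * [:complex_of_real (e $ i):] - [:complex_of_real ((A *v e) $ i):]"
      by (simp only: sum_delta_mult sum_pCons_0) (simp add: matrix_vector_mult_def)
    finally show ?thesis by (simp add: e(1))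
  qed
  have "(N ** D) $ i $ j = (?XA ** poly_matrix P) $ i $ j" for i j
  proof -
    have "(N ** D) $ i $ j = (\<Sum>k\<in>UNIV. (if j = k then (if j = i0 then [:-1, 1:] else 1) else 0) * N $ i $ k)"
      unfolding matrix_matrix_mult_def vec_lambda_beta by (rule sum.cong) (auto simp: D_def mult.commute)
    also have "\<dots> = (if j = i0 then [:-1, 1:] else 1) * N $ i $ j" by (rule sum_delta_mult)
    also have "\<dots> = (?XA ** poly_matrix P) $ i $ j" by (simp add: N_def col mult.commute)
    finally show ?thesis .
  qed
  then have ND: "N ** D = ?XA ** poly_matrix P" by (simp add: vec_eq_iff)
  have "det D = (\<Prod>i\<in>UNIV. D $ i $ i)" by (rule det_diagonal) (simp add: D_def)
  also have "\<dots> = (\<Prod>i\<in>UNIV. if i = i0 then [:-1, 1:] else 1)" by (simp add: D_def)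
  also have "\<dots> = [:-1, 1:]" by simp
  finally have detD: "det D = [:-1, 1:]" .
  obtain q where q: "charpoly (complex_matrix A) = [:-1, 1:] ^ 1 * q" "\<not> [:-1, 1:] dvd q"
    using order_decomp[OF charpoly_monic(3), of "complex_matrix A" 1] ord by auto
  have "[:-1, 1:] * (q * det (poly_matrix P)) = [:-1, 1:] * det N"
  proof -
    have "det N * [:-1, 1:] = charpoly (complex_matrix A) * det (poly_matrix P)"
      using arg_cong[OF ND, of det] by (simp only: det_mul detD charpoly_complex_matrix)
    then show ?thesis by (simp only: q(1) power_one_right mult.commute mult.left_commute mult.assoc)
  qed
  then have "q * det (poly_matrix P) = det N" by (metis mult_cancel_left pCons_eq_0_iff one_neq_zero)
  then have "poly (det N) 1 = poly q 1 * poly (det (poly_matrix P)) 1" by (metis poly_mult)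
  moreover have "poly q 1 \<noteq> 0" using q(2) by (simp add: poly_eq_0_iff_dvd)
  moreover have "poly (det (poly_matrix P)) 1 = complex_of_real (det P)"
  proof -
    have "(\<chi> i j. poly (poly_matrix P $ i $ j) 1) = complex_matrix P"
      by (simp add: vec_eq_iff poly_matrix_def complex_matrix_def)
    then show ?thesis by (simp add: poly_det det_complex_matrix)
  qed
  ultimately have N1: "poly (det N) 1 \<noteq> 0" using detP by simp
  \<comment> \<open>The value of \<open>N\<close> at 1. Its columns are \<open>e\<close> and vectors
    in the range of 1 - A, so its invertibility gives the decomposition.\<close>
  define Q :: "real^'n^'n" where "Q = (\<chi> i j. if j = i0 then e $ i else ((mat 1 - A) ** P) $ i $ j)"
  have "(\<chi> i j. poly (N $ i $ j) 1) = complex_matrix Q"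
    by (auto simp: vec_eq_iff N_def Q_def complex_matrix_def matrix_matrix_mult_def poly_sum poly_matrix_def mat_def
        intro!: sum.cong)
  then have "det Q \<noteq> 0" using N1 by (simp add: poly_det det_complex_matrix)
  then have "invertible Q" by (simp add: invertible_det_nz)
  then have x: "Q *v (matrix_inv Q *v x) = x" by (rule matrix_inv_vec)
  define y where "y = matrix_inv Q *v x"
  define y' where "y' = (\<chi> j. if j = i0 then 0 else y $ j)"
  have "Q *v y = y $ i0 *\<^sub>R e + ((mat 1 - A) ** P) *v y'"
  proof -
    have "(\<Sum>j\<in>UNIV. Q $ i $ j * y $ j) = y $ i0 * e $ i + (\<Sum>j\<in>UNIV. ((mat 1 - A) ** P) $ i $ j * y' $ j)" for i
    proof -
      have "(\<Sum>j\<in>UNIV. Q $ i $ j * y $ j)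
        = (\<Sum>j\<in>UNIV. (if i0 = j then e $ i else 0) * y $ j + ((mat 1 - A) ** P) $ i $ j * y' $ j)"
        by (rule sum.cong) (auto simp: Q_def y'_def)
      then show ?thesis by (simp only: sum.distrib sum_delta_mult) simp
    qed
    then show ?thesis by (simp add: vec_eq_iff matrix_vector_mult_def)
  qed
  also have "((mat 1 - A) ** P) *v y' = P *v y' - A *v (P *v y')"
    by (simp add: matrix_vector_mult_diff_rdistrib flip: matrix_vector_mul_assoc)
  finally show ?thesis using x unfolding y_def by metis
qed

text \<open>The range of 1 - A is a proper subspace, and a vector orthogonal to it is a left
  eigenvector. By \<open>simple_eigenvalue_complement\<close> it cannot annihilate \<open>e\<close>,
  so it can be normalised, and its kernel is that range.\<close>

lemma simple_eigenvalue_vectors: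
  fixes A :: "real^'n^'n"
  assumes ord: "order 1 (charpoly (complex_matrix A)) = 1"
  obtains e l where "A *v e = e" "\<forall>x. l \<bullet> (A *v x) = l \<bullet> x" "l \<bullet> e = 1" "\<forall>x. l \<bullet> x = 0 \<longrightarrow> (\<exists>z. A *v z - z = x)"
proof -
  have "poly (charpoly (complex_matrix A)) 1 = 0" using ord by (metis order_root zero_neq_one)
  then have "det (mat 1 - A) = 0" using poly_charpoly_of_real[of A 1] by simp
  then obtain e where e0: "e \<noteq> 0" "(mat 1 - A) *v e = 0" using det_eq_0_iff_kernel by blast
  then have Ae: "A *v e = e" by (simp add: matrix_vector_mult_diff_rdistrib)
  note comp = simple_eigenvalue_complement[OF Ae e0(1) ord]
  let ?L = "(*v) (mat 1 - A)"
  let ?R = "range ?L"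
  have R: "subspace ?R" by (intro linear_subspace_image matrix_vector_mul_linear subspace_UNIV)
  have L: "?L z = z - A *v z" for z by (simp add: matrix_vector_mult_diff_rdistrib)
  have "?R \<noteq> UNIV"
  proof
    assume "?R = UNIV"
    then have "inj ?L" using linear_surjective_imp_injective[OF matrix_vector_mul_linear] by blast
    then show False using e0 linear_injective_0[OF matrix_vector_mul_linear, of "mat 1 - A"] by blast
  qed
  then have "dim ?R < DIM(real^'n)"
    using R dim_eq_full[of ?R] dim_subset_UNIV[of ?R] span_eq_iff[of ?R] by (metis le_neq_implies_less)
  then obtain k where k: "k \<noteq> 0" "\<And>y. y \<in> span ?R \<Longrightarrow> orthogonal k y"
    using orthogonal_to_subspace_exists by blast
  have kL: "k \<bullet> (z - A *v z) = 0" for z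
    using k(2)[OF span_base, of "?L z"] by (simp add: L orthogonal_def)
  have ke: "k \<bullet> e \<noteq> 0"
  proof
    assume "k \<bullet> e = 0"
    then have "k \<bullet> x = 0" for x using comp[of x] kL by (metis add_cancel_right_right inner_add_right inner_scaleR_right mult_zero_right)
    then show False using k(1) by (metis inner_eq_zero_iff)
  qed
  define l where "l = (1 / (k \<bullet> e)) *\<^sub>R k"
  have l: "l \<bullet> x = (k \<bullet> x) / (k \<bullet> e)" for x by (simp add: l_def)
  show ?thesis
  proof (rule that[OF Ae])
    show "\<forall>x. l \<bullet> (A *v x) = l \<bullet> x" using kL by (simp add: l inner_diff_right)
    show "l \<bullet> e = 1" using ke by (simp add: l)
    show "\<forall>x. l \<bullet> x = 0 \<longrightarrow> (\<exists>z. A *v z - z = x)"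
    proof (intro allI impI)
      fix x assume lx: "l \<bullet> x = 0"
      obtain c z where x: "x = c *\<^sub>R e + (z - A *v z)" using comp by blast
      have "k \<bullet> x = 0" using lx ke by (simp add: l)
      then have "c = 0" using ke kL[of z] by (simp add: x inner_add_right)
      then have "A *v (- z) - (- z) = x" by (simp add: x linear_neg[OF matrix_vector_mul_linear])
      then show "\<exists>z. A *v z - z = x" by blast
    qed
  qed
qed

lemma index_spectrum_drift:
  fixes A :: "real^'n^'n"
  assumes n: "CARD('n) \<ge> 2" and A: "invertible A" and ord: "order 1 (charpoly (complex_matrix A)) = 1"
    and v: "v \<notin> range (\<lambda>x. (mat 1 - A) *v x)"
  shows "index_spectrum (affine_map A v) = {1..CARD('n) - 1}" "(A, v) \<in> anosov_pairs"
proof -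
  obtain e l where e: "A *v e = e" and lA: "\<forall>x. l \<bullet> (A *v x) = l \<bullet> x" and le: "l \<bullet> e = 1"
    and ker: "\<forall>x. l \<bullet> x = 0 \<longrightarrow> (\<exists>z. A *v z - z = x)"
    using simple_eigenvalue_vectors[OF ord] .
  have lv: "l \<bullet> v \<noteq> 0"
  proof
    assume "l \<bullet> v = 0"
    then obtain z where z: "A *v z - z = v" using ker by blast
    have "v = (mat 1 - A) *v (- z)" by (simp add: z[symmetric] matrix_vector_mult_diff_rdistrib linear_neg[OF matrix_vector_mul_linear])
    then show False using v by blast
  qed
  have nofix: "affine_map A v z \<noteq> z" for z
  proof
    assume "affine_map A v z = z"
    then have "v = (mat 1 - A) *v z" by (simp add: affine_map_def matrix_vector_mult_diff_rdistrib algebra_simps)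
    then show False using v by blast
  qed
  have ex: "\<exists>g Es Eu. complete_riemannian_metric g \<and> anosov_splitting g (affine_map A v) Es Eu \<and> (\<forall>x. dim (Es x) = k)"
    if k: "k \<in> {1..CARD('n) - 1}" for k
  proof -
    \<comment> \<open>The rescaling gives \<open>v\<close> the drift 1 and keeps the pairing of the
      two eigenvectors equal to 1.\<close>
    let ?e = "(l \<bullet> v) *\<^sub>R e" and ?l = "(1 / (l \<bullet> v)) *\<^sub>R l"
    have 1: "A *v ?e = ?e" by (simp add: matrix_vector_mult_scaleR e)
    have 2: "?l \<bullet> (A *v x) = ?l \<bullet> x" for x using lA by simp
    have 3: "?l \<bullet> ?e = 1" "?l \<bullet> v = 1" using lv le by simp_all
    have 4: "\<exists>z. A *v z - z = x" if "?l \<bullet> x = 0" for x using ker that lv by simp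
    show ?thesis
      by (rule drift_index_exists[OF A 1 2 3 4 k]) blast+
  qed
  have an: "anosov g (affine_map A v)" if "anosov_splitting g (affine_map A v) Es Eu" for g Es Eu
    using that diffeomorphism_affine_map[OF A] by (auto simp: anosov_def)
  show "index_spectrum (affine_map A v) = {1..CARD('n) - 1}"
  proof (intro equalityI subsetI)
    fix k assume "k \<in> index_spectrum (affine_map A v)"
    then obtain g Es Eu where "complete_riemannian_metric g" "anosov_splitting g (affine_map A v) Es Eu" "\<And>x. dim (Es x) = k"
      unfolding index_spectrum_def mem_Collect_eq by metis
    then show "k \<in> {1..CARD('n) - 1}" by (rule index_without_fixed_point[OF A _ _ _ nofix])
  next
    fix k assume "k \<in> {1..CARD('n) - 1}"
    from ex[OF this] an show "k \<in> index_spectrum (affine_map A v)"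
      unfolding index_spectrum_def mem_Collect_eq by blast
  qed
  have "1 \<in> {1..CARD('n) - 1}" using n by simp
  from ex[OF this] an show "(A, v) \<in> anosov_pairs"
    using A unfolding anosov_pairs_def by blast
qed

section \<open>The eigenvalue branch\<close>

lemma pderiv_simple_root:
  fixes p :: "'a::field poly"
  assumes "order a p = 1" "p \<noteq> 0"
  shows "poly (pderiv p) a \<noteq> 0"
proof -
  obtain q where q: "p = [:-a, 1:] ^ 1 * q" "\<not> [:-a, 1:] dvd q"
    using order_decomp[OF assms(2), of a] assms(1) by auto
  have "poly (pderiv p) a = poly q a"
    unfolding q(1) power_one_right pderiv_mult by (simp add: pderiv_pCons)
  then show ?thesis using q(2) by (simp add: poly_eq_0_iff_dvd)
qed

definition char_fun :: "(real^'n^'n) \<times> real \<Rightarrow> real" where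
  "char_fun z = det (mat (snd z) - fst z)"

lemma smooth_char_fun: "smooth_on UNIV (char_fun :: (real^'n^'n) \<times> real \<Rightarrow> real)"
proof -
  have 1: "bounded_linear (\<lambda>z::(real^'n^'n) \<times> real. mat (snd z) - fst z)"
    by (intro linear_conv_bounded_linear[THEN iffD1] linearI) (auto simp: mat_def vec_eq_iff algebra_simps)
  show ?thesis unfolding char_fun_def
    by (intro smooth_on_det smooth_on_bounded_linear 1 open_UNIV)
qed

lemma C_k_on_divide:
  fixes f g :: "'a::real_normed_vector \<Rightarrow> real"
  assumes "open S" "C_k_on k S f" "C_k_on k S g" "\<And>x. x \<in> S \<Longrightarrow> g x \<noteq> 0"
  shows "C_k_on k S (\<lambda>x. f x / g x)"
proof -
  have "smooth_on (-{0}) (\<lambda>x::real. inverse x)"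
    by (rule smooth_on_inverse) (auto intro: smooth_on_ident)
  then have "C_k_on k S (\<lambda>x. inverse (g x))"
    by (intro C_k_on_compose[OF assms(1) _ _ assms(3), of "-{0}"] smooth_onD) (use assms(4) in auto)
  then show ?thesis
    unfolding divide_inverse by (rule C_k_on_bilinear[OF assms(1) bounded_bilinear_mult assms(2)])
qed

lemma C_k_on_Pair:
  fixes f :: "'a::real_normed_vector \<Rightarrow> 'b::real_normed_vector" and g :: "'a \<Rightarrow> 'c::real_normed_vector"
  assumes "open S" "C_k_on k S f" "C_k_on k S g"
  shows "C_k_on k S (\<lambda>x. (f x, g x))"
proof -
  have "C_k_on k S (\<lambda>x. (f x, 0 :: 'c) + (0 :: 'b, g x))"
    by (intro C_k_on_add assms C_k_on_bounded_linear_comp[OF assms(1), of "\<lambda>y. (y, 0)"]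
        C_k_on_bounded_linear_comp[OF assms(1), of "\<lambda>y. (0, y)"] bounded_linear_Pair bounded_linear_ident bounded_linear_zero)
  then show ?thesis by simp
qed

text \<open>Differentiating the equation expresses the derivative of \<open>h\<close> by derivatives
  of \<open>F\<close> at \<open>(x, h x)\<close>. If \<open>h\<close> is of class C^k, so is this
  expression, and \<open>h\<close> is of class C^(k+1); mere differentiability thus bootstraps to
  smoothness.\<close>

lemma implicit_smooth:
  fixes F :: "'a::euclidean_space \<times> real \<Rightarrow> real" and h :: "'a \<Rightarrow> real"
  assumes F: "smooth_on UNIV F" and W: "open W"
    and h: "\<And>x. x \<in> W \<Longrightarrow> h differentiable (at x)"
    and zero: "\<And>x. x \<in> W \<Longrightarrow> F (x, h x) = 0"
    and nz: "\<And>x. x \<in> W \<Longrightarrow> frechet_derivative F (at (x, h x)) (0, 1) \<noteq> 0"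
  shows "smooth_on W h"
proof (rule smooth_onI)
  let ?F' = "\<lambda>z. frechet_derivative F (at z)"
  have F': "(F has_derivative ?F' z) (at z)" for z by (rule smooth_on_imp_has_derivative[OF F UNIV_I])
  define D where "D x w = - ?F' (x, h x) (w, 0) / ?F' (x, h x) (0, 1)" for x w
  have hD: "(h has_derivative D x) (at x)" if x: "x \<in> W" for x
  proof -
    obtain h' where h': "(h has_derivative h') (at x)" using h[OF x] by (auto simp: differentiable_def)
    have "((\<lambda>x. (x, h x)) has_derivative (\<lambda>w. (w, h' w))) (at x)"
      by (intro has_derivative_Pair has_derivative_ident h')
    from has_derivative_compose[OF this F']
    have 1: "((\<lambda>x. F (x, h x)) has_derivative (\<lambda>w. ?F' (x, h x) (w, h' w))) (at x)" .
    have "((\<lambda>x. 0) has_derivative (\<lambda>w. 0)) (at x)" by simp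
    then have 2: "((\<lambda>x. F (x, h x)) has_derivative (\<lambda>w. 0)) (at x)"
      by (rule has_derivative_transform_within_open[OF _ W x]) (simp add: zero)
    have lin: "linear (?F' (x, h x))" using F' has_derivative_linear by blast
    have "h' w = D x w" for w
    proof -
      have "?F' (x, h x) (w, h' w) = ?F' (x, h x) ((w, 0) + h' w *\<^sub>R (0, 1))" by simp
      also have "\<dots> = ?F' (x, h x) (w, 0) + h' w * ?F' (x, h x) (0, 1)"
        by (simp only: linear_add[OF lin] linear_cmul[OF lin] real_scaleR_def)
      finally show ?thesis using fun_cong[OF has_derivative_unique[OF 1 2], of w] nz[OF x]
        by (simp add: D_def field_simps)
    qed
    then have "h' = D x" by auto
    then show ?thesis using h' by simp
  qed
  show "C_k_on k W h" for k
  proof (induction k)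
    case 0
    show ?case using h
      by (auto intro!: continuous_at_imp_continuous_on differentiable_imp_continuous_within)
  next
    case (Suc k)
    show ?case
    proof (rule C_k_on_SucI[OF W hD])
      fix w
      have p: "C_k_on k W (\<lambda>x. (x, h x))" by (intro C_k_on_Pair W C_k_on_ident Suc)
      have c: "C_k_on k W (\<lambda>x. ?F' (x, h x) u)" for u
        by (rule C_k_on_compose[OF W open_UNIV _ p]) (use smooth_on_frechet_derivative[OF F] in \<open>auto simp: smooth_on_def\<close>)
      have "C_k_on k W (\<lambda>x. - ?F' (x, h x) (w, 0))"
        by (rule C_k_on_bounded_linear_comp[OF W bounded_linear_minus[OF bounded_linear_ident] c])
      then show "C_k_on k W (\<lambda>x. D x w)" unfolding D_def by (rule C_k_on_divide[OF W _ c nz])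
    qed
  qed
qed

text \<open>The inverse function theorem for the map sending (x, c) to (x, F(x, c)); on the slice
  with second component 0 the second coordinate of its inverse is the branch.\<close>

lemma implicit_branch:
  fixes F :: "'a::euclidean_space \<times> real \<Rightarrow> real"
  assumes F: "smooth_on UNIV F" and F0: "F (x0, c0) = 0"
    and d0: "frechet_derivative F (at (x0, c0)) (0, 1) \<noteq> 0"
  obtains W h where "open W" "x0 \<in> W" "smooth_on W h" "h x0 = c0" "\<forall>x\<in>W. F (x, h x) = 0"
proof -
  let ?F' = "\<lambda>z. frechet_derivative F (at z)"
  have F': "(F has_derivative ?F' z) (at z)" for z by (rule smooth_on_imp_has_derivative[OF F UNIV_I])
  have bl: "bounded_linear (\<lambda>w. (fst w, ?F' z w))" for z
    by (intro bounded_linear_Pair bounded_linear_fst has_derivative_bounded_linear[OF F'])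
  define H where "H z = (fst z, F z)" for z
  define H' where "H' z = Blinfun (\<lambda>w. (fst w, ?F' z w))" for z
  have H'app: "blinfun_apply (H' z) = (\<lambda>w. (fst w, ?F' z w))" for z
    by (simp add: H'_def bounded_linear_Blinfun_apply[OF bl])
  have derH: "(H has_derivative blinfun_apply (H' z)) (at z)" for z
    unfolding H'app H_def[abs_def] by (intro has_derivative_Pair has_derivative_fst has_derivative_ident F')
  have contH: "continuous_on UNIV H'"
  proof (rule continuous_on_blinfun_componentwise)
    fix b :: "'a \<times> real"
    show "continuous_on UNIV (\<lambda>z. blinfun_apply (H' z) b)"
      unfolding H'app using smooth_on_imp_continuous_on[OF smooth_on_frechet_derivative[OF F, of b]]
      by (intro continuous_on_Pair continuous_on_const)
  qed
  let ?d = "?F' (x0, c0) (0, 1)"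
  have lin: "linear (?F' z)" for z using F' has_derivative_linear by blast
  have dec: "?F' z (a, r) = ?F' z (a, 0) + r * ?F' z (0, 1)" for z a r
  proof -
    have "?F' z (a, r) = ?F' z ((a, 0) + r *\<^sub>R (0, 1))" by simp
    then show ?thesis by (simp only: linear_add[OF lin] linear_cmul[OF lin] real_scaleR_def)
  qed
  \<comment> \<open>The inverse of the derivative at the base point: the first component is copied,
    and the second is solved for by dividing by the partial derivative.\<close>
  define K where "K = Blinfun (\<lambda>w. (fst w, (snd w - ?F' (x0, c0) (fst w, 0)) / ?d))"
  have blK: "bounded_linear (\<lambda>w. (fst w, (snd w - ?F' (x0, c0) (fst w, 0)) / ?d))"
    by (intro bounded_linear_Pair bounded_linear_fst bounded_linear_compose[OF bounded_linear_divide]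
        bounded_linear_sub bounded_linear_snd bounded_linear_compose[OF has_derivative_bounded_linear[OF F']]
        bounded_linear_zero)
  have "K o\<^sub>L H' (x0, c0) = id_blinfun"
  proof (rule blinfun_eqI)
    fix w :: "'a \<times> real"
    have "?F' (x0, c0) w = ?F' (x0, c0) (fst w, 0) + snd w * ?d" using dec[of _ "fst w" "snd w"] by simp
    then show "blinfun_apply (K o\<^sub>L H' (x0, c0)) w = blinfun_apply id_blinfun w"
      using d0 by (simp add: K_def bounded_linear_Blinfun_apply[OF blK] H'app prod_eq_iff)
  qed
  then obtain U' V g g' where U': "open U'" "(x0, c0) \<in> U'" and V: "open V" "H (x0, c0) \<in> V" and hom: "homeomorphism U' V H g"
    and g': "\<And>y. y \<in> V \<Longrightarrow> (g has_derivative g' y) (at y)"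
    and bij: "\<And>y. y \<in> V \<Longrightarrow> bij (blinfun_apply (H' (g y)))"
    by (rule inverse_function_theorem[OF open_UNIV derH contH UNIV_I]) blast
  have Hg: "H (g y) = y" if "y \<in> V" for y using homeomorphism_apply2[OF hom that] .
  define W where "W = (\<lambda>x. (x, 0 :: real)) -` V"
  define h where "h x = snd (g (x, 0))" for x
  have W: "open W" unfolding W_def by (intro open_vimage V continuous_intros)
  have x0: "x0 \<in> W" using V(2) F0 by (simp add: W_def H_def)
  have gx: "g (x, 0) = (x, h x)" "F (x, h x) = 0" if x: "x \<in> W" for x
  proof -
    have H: "H (g (x, 0)) = (x, 0)" using Hg x by (simp add: W_def)
    then have "fst (g (x, 0)) = x" by (simp add: H_def)
    then show 1: "g (x, 0) = (x, h x)" by (simp add: h_def prod_eq_iff)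
    show "F (x, h x) = 0" using H by (simp add: H_def 1)
  qed
  have "h x0 = c0"
    using homeomorphism_apply1[OF hom U'(2)] F0 by (simp add: h_def H_def)
  moreover have "smooth_on W h"
  proof (rule implicit_smooth[OF F W _ gx(2)])
    fix x assume x: "x \<in> W"
    have "(g has_derivative g' (x, 0)) (at (x, 0))" using g' x by (simp add: W_def)
    then have "((\<lambda>x. snd (g (x, 0))) has_derivative (\<lambda>w. snd (g' (x, 0) (w, 0)))) (at x)"
      by (intro has_derivative_snd has_derivative_compose[of "\<lambda>x. (x, 0)" "\<lambda>w. (w, 0)" x UNIV g])
        (auto intro!: derivative_eq_intros)
    then show "h differentiable (at x)" unfolding h_def[abs_def] differentiable_def by blast
    \<comment> \<open>Invertibility of the derivative of \<open>H\<close> persists on the whole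
      neighbourhood; were the partial derivative zero, (0, 1) would lie in its kernel.\<close>
    show "?F' (x, h x) (0, 1) \<noteq> 0"
    proof
      assume 0: "?F' (x, h x) (0, 1) = 0"
      have "inj (blinfun_apply (H' (x, h x)))" using bij[of "(x, 0)"] x gx(1)[OF x] by (simp add: W_def bij_is_inj)
      moreover have "blinfun_apply (H' (x, h x)) (0, 1) = blinfun_apply (H' (x, h x)) (0, 0)"
        using 0 linear_0[OF lin, of "(x, h x)"] by (simp add: H'app zero_prod_def)
      ultimately have "(0 :: 'a, 1 :: real) = (0, 0)" by (rule injD)
      then show False by simp
    qed
  qed
  ultimately show ?thesis using that W x0 gx(2) by blast
qed

lemma eigenvalue_branch:
  fixes A0 :: "real^'n^'n"
  assumes ord: "order 1 (charpoly (complex_matrix A0)) = 1"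
  obtains W and ev :: "real^'n^'n \<Rightarrow> real" where "open W" "A0 \<in> W" "smooth_on W ev" "ev A0 = 1"
    "\<forall>A\<in>W. poly (charpoly (complex_matrix A)) (complex_of_real (ev A)) = 0"
proof -
  let ?chi = "charpoly (complex_matrix A0)"
  have root: "poly ?chi 1 = 0" using ord by (metis order_root zero_neq_one)
  have cf: "complex_of_real (char_fun (A, x)) = poly (charpoly (complex_matrix A)) (complex_of_real x)" for A :: "real^'n^'n" and x
    by (simp add: char_fun_def poly_charpoly_of_real)
  have F0: "char_fun (A0, 1) = 0" using cf[of A0 1] root by (metis of_real_1 of_real_eq_0_iff)
  let ?F' = "frechet_derivative char_fun (at (A0, 1))"
  have F': "(char_fun has_derivative ?F') (at (A0, 1))" by (rule smooth_on_imp_has_derivative[OF smooth_char_fun UNIV_I])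
  \<comment> \<open>The partial derivative in the last variable is the derivative of the
    characteristic polynomial at 1, nonzero at a simple root. The comparison takes place in the
    complex numbers, where that polynomial has its coefficients.\<close>
  have "?F' (0, 1) \<noteq> 0"
  proof
    assume 0: "?F' (0, 1) = 0"
    have lin: "linear ?F'" using F' has_derivative_linear by blast
    have "((\<lambda>x. (A0, x)) has_derivative (\<lambda>w. (0, w))) (at (1::real))" by (auto intro!: derivative_eq_intros)
    from has_derivative_compose[OF this F'] have "((\<lambda>x. char_fun (A0, x)) has_derivative (\<lambda>w. ?F' (0, w))) (at 1)" .
    moreover have "?F' (0, w) = 0" for w
    proof -
      have "?F' (0, w) = ?F' (w *\<^sub>R (0, 1))" by simp
      then show ?thesis by (simp only: linear_cmul[OF lin] 0 scaleR_zero_right)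
    qed
    ultimately have "((\<lambda>x. char_fun (A0, x)) has_derivative (\<lambda>w. 0)) (at 1)" by simp
    from has_derivative_of_real[OF this]
    have 1: "((\<lambda>x. complex_of_real (char_fun (A0, x))) has_derivative (\<lambda>w. 0)) (at 1)" by simp
    have "(poly ?chi has_derivative (*) (poly (pderiv ?chi) 1)) (at (complex_of_real 1))"
      using poly_DERIV[of ?chi 1] by (simp add: has_field_derivative_def)
    from has_derivative_compose[OF has_derivative_of_real[OF has_derivative_ident] this]
    have 2: "((\<lambda>x. complex_of_real (char_fun (A0, x))) has_derivative (\<lambda>w. poly (pderiv ?chi) 1 * of_real w)) (at 1)"
      by (simp add: cf)
    have "poly (pderiv ?chi) 1 * of_real 1 = 0" using fun_cong[OF has_derivative_unique[OF 1 2], of 1] by simp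
    then show False using pderiv_simple_root[OF ord charpoly_monic(3)] by simp
  qed
  then obtain W and h :: "real^'n^'n \<Rightarrow> real" where "open W" "A0 \<in> W" "smooth_on W h" "h A0 = 1" "\<forall>x\<in>W. char_fun (x, h x) = 0"
    by (rule implicit_branch[OF smooth_char_fun F0])
  moreover from this have "\<forall>A\<in>W. poly (charpoly (complex_matrix A)) (complex_of_real (h A)) = 0"
    by (metis cf of_real_0)
  ultimately show ?thesis using that by blast
qed

section \<open>Continuity of the spectrum\<close>

text \<open>Listing the roots as a vector over the index type of the matrix makes them a point of a
  finite dimensional space, where compactness is available.\<close>

lemma charpoly_roots:
  fixes M :: "complex^'n^'n"
  obtains r :: "complex^'n" where "charpoly M = (\<Prod>i\<in>UNIV. [:- (r $ i), 1:])"
proof -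
  obtain R where R: "size R = degree (charpoly M)" "charpoly M = smult (lead_coeff (charpoly M)) (\<Prod>x\<in>#R. [:- x, 1:])"
    using alg_closed_imp_factorization[OF charpoly_monic(3)] by blast
  obtain xs where xs: "mset xs = R" using ex_mset by blast
  have len: "length xs = CARD('n)" using R(1) xs charpoly_monic(1)[of M] by (metis size_mset)
  obtain h where h: "bij_betw h (UNIV :: 'n set) {..<length xs}"
    using ex_bij_betw_finite_nat[of "UNIV :: 'n set"] len by (auto simp: lessThan_atLeast0)
  define r :: "complex^'n" where "r = (\<chi> i. xs ! h i)"
  have "charpoly M = (\<Prod>x\<in>#R. [:- x, 1:])" using R(2) charpoly_monic(2)[of M] by simp
  also have "\<dots> = (\<Prod>x\<leftarrow>xs. [:- x, 1:])" unfolding xs[symmetric] by (metis mset_map prod_mset_prod_list)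
  also have "\<dots> = (\<Prod>k<length xs. [:- (xs ! k), 1:])" by (simp add: prod.list_conv_set_nth atLeast0LessThan)
  also have "\<dots> = (\<Prod>i\<in>UNIV. [:- (xs ! h i), 1:])" by (rule prod.reindex_bij_betw[OF h, symmetric])
  finally show ?thesis using that[of r] by (simp add: r_def)
qed

lemma proots_linear_factors: "proots (\<Prod>i\<in>I. [:- r i, 1:]) = image_mset r (mset_set I)"
  for r :: "'i \<Rightarrow> complex"
proof (induction I rule: infinite_finite_induct)
  case (insert i I)
  have "(\<Prod>i\<in>I. [:- r i, 1:]) \<noteq> 0" using insert(1) by simp
  then have "proots ([:- r i, 1:] * (\<Prod>i\<in>I. [:- r i, 1:])) = proots [:- r i, 1:] + proots (\<Prod>i\<in>I. [:- r i, 1:])"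
    by (intro proots_mult) auto
  then show ?case using insert by simp
qed simp_all

text \<open>Keeps the root vectors of a bounded sequence of matrices in a compact set.\<close>

lemma complex_eigenvalue_bound:
  obtains K where "K > 0" "\<forall>A :: real^'n^'n. \<forall>c\<in>spectrum A. cmod c \<le> norm A * K"
proof -
  have "bilinear ((*v) :: complex^'n^'n \<Rightarrow> complex^'n \<Rightarrow> complex^'n)"
    by (auto simp: bilinear_def linear_iff matrix_vector_mult_def vec_eq_iff sum.distrib algebra_simps scaleR_sum_right)
  then have "bounded_bilinear ((*v) :: complex^'n^'n \<Rightarrow> complex^'n \<Rightarrow> complex^'n)"
    by (simp add: bilinear_conv_bounded_bilinear)
  from bounded_bilinear.pos_bounded[OF this] obtain K where K: "K > 0"
    "\<And>(M :: complex^'n^'n) x. norm (M *v x) \<le> norm M * norm x * K" by blast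
  have "cmod c \<le> norm A * K" if c: "c \<in> spectrum A" for A :: "real^'n^'n" and c
  proof -
    obtain x where x: "x \<noteq> 0" "complex_matrix A *v x = c *s x" using c by (auto simp: spectrum_def)
    have "norm (complex_matrix A) = norm A"
      by (simp add: norm_vec_def complex_matrix_def)
    then have "cmod c * norm x \<le> (norm A * K) * norm x"
      using K(2)[of "complex_matrix A" x] by (simp add: x(2) norm_vector_scalar_mult mult_ac)
    then show ?thesis using x(1) by simp
  qed
  then show ?thesis using that K(1) by blast
qed

lemma tendsto_poly_charpoly:
  assumes "a \<longlonglongrightarrow> (A :: real^'n^'n)"
  shows "(\<lambda>k. poly (charpoly (complex_matrix (a k))) c) \<longlonglongrightarrow> poly (charpoly (complex_matrix A)) c"
  unfolding poly_charpoly det_def complex_matrix_def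
  by (simp, intro tendsto_intros assms)

lemma charpoly_eq_limit_roots:
  fixes A :: "real^'n^'n"
  assumes a: "a \<longlonglongrightarrow> A" and r: "r \<longlonglongrightarrow> (R :: complex^'n)"
    and f: "\<And>k. charpoly (complex_matrix (a k)) = (\<Prod>i\<in>UNIV. [:- (r k $ i), 1:])"
  shows "charpoly (complex_matrix A) = (\<Prod>i\<in>UNIV. [:- (R $ i), 1:])"
proof -
  have "poly (charpoly (complex_matrix A)) c = poly (\<Prod>i\<in>UNIV. [:- (R $ i), 1:]) c" for c
  proof (rule LIMSEQ_unique[OF tendsto_poly_charpoly[OF a]])
    show "(\<lambda>k. poly (charpoly (complex_matrix (a k))) c) \<longlonglongrightarrow> poly (\<Prod>i\<in>UNIV. [:- (R $ i), 1:]) c"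
      unfolding f poly_prod by (simp, intro tendsto_intros r)
  qed
  then show ?thesis by (simp add: poly_eq_poly_eq_iff[symmetric] fun_eq_iff)
qed

text \<open>One copy of \<open>t\<close> is set apart and may lie on or off the circle; only the
  remaining roots are constrained. The condition can therefore persist while \<open>t\<close>
  crosses 1.\<close>

definition split_spectrum :: "real^'n^'n \<Rightarrow> real \<Rightarrow> nat \<Rightarrow> bool" where
  "split_spectrum A t s \<longleftrightarrow> (\<exists>R. proots (charpoly (complex_matrix A)) = add_mset (complex_of_real t) R \<and>
     (\<forall>c\<in>#R. cmod c \<noteq> 1) \<and> size (filter_mset (\<lambda>c. cmod c < 1) R) = s)"

text \<open>Along a sequence of counterexamples tending to \<open>A0\<close> the root vectors have a
  subsequence converging to a root vector of \<open>A0\<close>. The modulus conditions are strict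
  for every index except the single one with limit 1, and that index must carry the branch
  \<open>ev\<close>, because all other roots stay away from it.\<close>

lemma eventually_split_spectrum:
  fixes A0 :: "real^'n^'n"
  assumes ord: "order 1 (charpoly (complex_matrix A0)) = 1" and circle: "spectrum A0 \<inter> sphere 0 1 = {1}"
    and ev: "continuous (at A0) ev" "ev A0 = 1"
    and root: "eventually (\<lambda>A. poly (charpoly (complex_matrix A)) (complex_of_real (ev A)) = 0) (nhds A0)"
  shows "eventually (\<lambda>A. split_spectrum A (ev A)
    (size (filter_mset (\<lambda>c. cmod c < 1) (proots (charpoly (complex_matrix A0)))))) (nhds A0)"
proof (rule ccontr)
  let ?s = "size (filter_mset (\<lambda>c. cmod c < 1) (proots (charpoly (complex_matrix A0))))"
  assume no: "\<not> eventually (\<lambda>A. split_spectrum A (ev A) ?s) (nhds A0)"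
  have ex: "\<exists>A. dist A A0 < inverse (real (Suc k)) \<and> \<not> split_spectrum A (ev A) ?s" for k
  proof (rule ccontr)
    assume "\<nexists>A. dist A A0 < inverse (real (Suc k)) \<and> \<not> split_spectrum A (ev A) ?s"
    then have "eventually (\<lambda>A. split_spectrum A (ev A) ?s) (nhds A0)"
      unfolding eventually_nhds_metric by (intro exI[of _ "inverse (real (Suc k))"]) auto
    then show False using no by blast
  qed
  have "\<exists>a. \<forall>k. dist (a k) A0 < inverse (real (Suc k)) \<and> \<not> split_spectrum (a k) (ev (a k)) ?s"
    by (rule choice, rule allI, rule ex)
  then obtain a where a0: "\<forall>k. dist (a k) A0 < inverse (real (Suc k)) \<and> \<not> split_spectrum (a k) (ev (a k)) ?s"
    by (elim exE) (rule that)
  have a: "dist (a k) A0 < inverse (real (Suc k))" "\<not> split_spectrum (a k) (ev (a k)) ?s" for k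
    by (rule a0[THEN spec, THEN conjunct1], rule a0[THEN spec, THEN conjunct2])
  have alim: "a \<longlonglongrightarrow> A0"
  proof (rule tendsto_dist_iff[THEN iffD2],
      rule real_tendsto_sandwich[where f = "\<lambda>_. 0" and h = "\<lambda>k. inverse (real (Suc k))"])
    show "eventually (\<lambda>k. dist (a k) A0 \<le> inverse (real (Suc k))) sequentially"
      by (intro always_eventually allI less_imp_le a(1))
    show "(\<lambda>k. inverse (real (Suc k))) \<longlonglongrightarrow> 0" by (rule LIMSEQ_inverse_real_of_nat)
  qed (rule always_eventually, simp, rule tendsto_const)
  have exr: "\<exists>r :: complex^'n. charpoly (complex_matrix (a k)) = (\<Prod>i\<in>UNIV. [:- (r $ i), 1:])" for k
    by (rule charpoly_roots[of "complex_matrix (a k)"], rule exI)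
  have "\<exists>r. \<forall>k. charpoly (complex_matrix (a k)) = (\<Prod>i\<in>UNIV. [:- ((r k :: complex^'n) $ i), 1:])"
    by (rule choice, rule allI, rule exr)
  then obtain r :: "nat \<Rightarrow> complex^'n" where "\<forall>k. charpoly (complex_matrix (a k)) = (\<Prod>i\<in>UNIV. [:- (r k $ i), 1:])"
    by (elim exE) (rule that)
  then have r: "charpoly (complex_matrix (a k)) = (\<Prod>i\<in>UNIV. [:- (r k $ i), 1:])" for k by simp
  obtain K where K: "K > 0" "\<forall>A :: real^'n^'n. \<forall>c\<in>spectrum A. cmod c \<le> norm A * K"
    using complex_eigenvalue_bound .
  obtain B where B: "\<And>k. norm (a k) \<le> B" using convergent_imp_Bseq[of a] alim unfolding convergent_def Bseq_def by blast
  have "norm (r k) \<le> real CARD('n) * (B * K)" for k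
  proof -
    have "cmod (r k $ i) \<le> B * K" for i
    proof -
      have "r k $ i \<in> spectrum (a k)" unfolding mem_spectrum_iff r poly_prod by (auto intro!: prod_zero)
      then have "cmod (r k $ i) \<le> norm (a k) * K" using K(2) by blast
      also have "\<dots> \<le> B * K" using B[of k] K(1) by (intro mult_right_mono) auto
      finally show ?thesis .
    qed
    then have "(\<Sum>i\<in>UNIV. cmod (r k $ i)) \<le> (\<Sum>i\<in>(UNIV :: 'n set). B * K)" by (intro sum_mono)
    then show ?thesis using norm_le_l1_cart[of "\<chi> i. cmod (r k $ i)"] by (simp add: norm_vec_def)
  qed
  then have "\<forall>k. r k \<in> cball 0 (real CARD('n) * (B * K))" by simp
  then obtain R \<phi> where \<phi>: "strict_mono \<phi>" and R: "(r \<circ> \<phi>) \<longlonglongrightarrow> R"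
    using compact_cball unfolding compact_def by metis
  have a\<phi>: "(a \<circ> \<phi>) \<longlonglongrightarrow> A0" using alim \<phi> by (rule LIMSEQ_subseq_LIMSEQ)
  have chi0: "charpoly (complex_matrix A0) = (\<Prod>i\<in>UNIV. [:- (R $ i), 1:])"
    by (rule charpoly_eq_limit_roots[OF a\<phi> R]) (simp add: r)
  have pr0: "proots (charpoly (complex_matrix A0)) = image_mset (($) R) (mset_set UNIV)"
    unfolding chi0 by (rule proots_linear_factors)
  have "count (image_mset (($) R) (mset_set UNIV)) 1 = 1" using ord pr0 by (metis charpoly_monic(3) count_proots)
  then have "card {i. R $ i = 1} = 1"
    by (simp add: count_image_mset vimage_def Int_def eq_commute[of 1] conj_commute)
  then obtain i0 where i0: "{i. R $ i = 1} = {i0}" using card_1_singletonE by blast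
  have Rspec: "R $ i \<in> spectrum A0" for i unfolding mem_spectrum_iff chi0 poly_prod by (auto intro!: prod_zero)
  have off: "cmod (R $ i) \<noteq> 1" if "i \<noteq> i0" for i
  proof
    assume "cmod (R $ i) = 1"
    then have "R $ i \<in> spectrum A0 \<inter> sphere 0 1" using Rspec by simp
    then have "R $ i = 1" using circle by blast
    then show False using i0 that by blast
  qed
  have Ri: "(\<lambda>k. (r \<circ> \<phi>) k $ i) \<longlonglongrightarrow> R $ i" for i by (intro tendsto_intros R)
  have evlim: "(\<lambda>k. complex_of_real (ev ((a \<circ> \<phi>) k))) \<longlonglongrightarrow> 1"
  proof -
    have "(\<lambda>k. ev ((a \<circ> \<phi>) k)) \<longlonglongrightarrow> ev A0" using isCont_tendsto_compose[OF ev(1) a\<phi>] .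
    from tendsto_of_real[OF this] show ?thesis using ev(2) by simp
  qed
  have e1: "eventually (\<lambda>k. poly (charpoly (complex_matrix ((a \<circ> \<phi>) k))) (complex_of_real (ev ((a \<circ> \<phi>) k))) = 0) sequentially"
    using eventually_compose_filterlim[OF root a\<phi>] .
  have e2: "eventually (\<lambda>k. \<forall>i\<in>UNIV - {i0}. complex_of_real (ev ((a \<circ> \<phi>) k)) - (r \<circ> \<phi>) k $ i \<noteq> 0) sequentially"
  proof (rule eventually_ball_finite, simp, rule ballI)
    fix i assume "i \<in> UNIV - {i0}"
    then have "1 - R $ i \<noteq> 0" using i0 by auto
    then show "eventually (\<lambda>k. complex_of_real (ev ((a \<circ> \<phi>) k)) - (r \<circ> \<phi>) k $ i \<noteq> 0) sequentially"
      by (rule tendsto_imp_eventually_ne[OF tendsto_diff[OF evlim Ri]])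
  qed
  have e3: "eventually (\<lambda>k. \<forall>i\<in>UNIV - {i0}. cmod ((r \<circ> \<phi>) k $ i) \<noteq> 1 \<and> (cmod ((r \<circ> \<phi>) k $ i) < 1 \<longleftrightarrow> cmod (R $ i) < 1)) sequentially"
  proof (rule eventually_ball_finite, simp, rule ballI)
    fix i assume "i \<in> UNIV - {i0}"
    then have "cmod (R $ i) < 1 \<or> cmod (R $ i) > 1" using off[of i] by auto
    then show "eventually (\<lambda>k. cmod ((r \<circ> \<phi>) k $ i) \<noteq> 1 \<and> (cmod ((r \<circ> \<phi>) k $ i) < 1 \<longleftrightarrow> cmod (R $ i) < 1)) sequentially"
    proof
      assume lt: "cmod (R $ i) < 1"
      from order_tendstoD(2)[OF tendsto_norm[OF Ri] this] show ?thesis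
        by (rule eventually_mono) (use lt in auto)
    next
      assume gt: "cmod (R $ i) > 1"
      from order_tendstoD(1)[OF tendsto_norm[OF Ri] this] show ?thesis
        by (rule eventually_mono) (use gt in auto)
    qed
  qed
  obtain k where k: "poly (charpoly (complex_matrix ((a \<circ> \<phi>) k))) (complex_of_real (ev ((a \<circ> \<phi>) k))) = 0"
    "\<forall>i\<in>UNIV - {i0}. complex_of_real (ev ((a \<circ> \<phi>) k)) - (r \<circ> \<phi>) k $ i \<noteq> 0"
    "\<forall>i\<in>UNIV - {i0}. cmod ((r \<circ> \<phi>) k $ i) \<noteq> 1 \<and> (cmod ((r \<circ> \<phi>) k $ i) < 1 \<longleftrightarrow> cmod (R $ i) < 1)"
    using eventually_happens'[OF _ eventually_conj[OF e1 eventually_conj[OF e2 e3]]] by auto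
  let ?A = "a (\<phi> k)" and ?r = "r (\<phi> k)"
  have "\<exists>i. complex_of_real (ev ?A) - ?r $ i = 0"
    using k(1) by (simp add: r poly_prod)
  \<comment> \<open>The branch is one of the roots, and for this \<open>k\<close> every index other
    than \<open>i0\<close> has been excluded.\<close>
  then have ri0: "?r $ i0 = complex_of_real (ev ?A)" using k(2) by (metis Diff_iff UNIV_I comp_apply eq_iff_diff_eq_0 singletonD)
  have ms: "mset_set (UNIV :: 'n set) = add_mset i0 (mset_set (UNIV - {i0}))"
    by (rule mset_set.remove) auto
  let ?R = "image_mset (($) ?r) (mset_set (UNIV - {i0}))"
  have "proots (charpoly (complex_matrix ?A)) = add_mset (complex_of_real (ev ?A)) ?R"
    unfolding r proots_linear_factors ms by (simp add: ri0)
  moreover have "\<forall>c\<in>#?R. cmod c \<noteq> 1" using k(3) by auto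
  moreover have "size (filter_mset (\<lambda>c. cmod c < 1) ?R) = ?s"
  proof -
    have "size (filter_mset (\<lambda>c. cmod c < 1) ?R) = card {i \<in> UNIV - {i0}. cmod (?r $ i) < 1}"
      by (simp add: filter_mset_image_mset)
    also have "{i \<in> UNIV - {i0}. cmod (?r $ i) < 1} = {i. cmod (R $ i) < 1}"
    proof (rule Collect_cong)
      fix i
      have "R $ i0 = 1" using i0 by blast
      then show "(i \<in> UNIV - {i0} \<and> cmod (?r $ i) < 1) = (cmod (R $ i) < 1)"
        using k(3) by (cases "i = i0") auto
    qed
    also have "card \<dots> = ?s" unfolding pr0 by (simp add: filter_mset_image_mset)
    finally show ?thesis .
  qed
  ultimately have "split_spectrum ?A (ev ?A) ?s" unfolding split_spectrum_def by blast
  then show False using a(2) by blast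
qed

section \<open>Neighbourhood of a regular drift pair\<close>

lemma continuous_on_det:
  fixes f :: "'a::topological_space \<Rightarrow> real^'n^'n"
  assumes "continuous_on S f"
  shows "continuous_on S (\<lambda>x. det (f x))"
  unfolding det_def by (intro continuous_intros assms)

definition outer :: "real^'n \<Rightarrow> real^'n \<Rightarrow> real^'n^'n" where
  "outer v l = (\<chi> i j. v $ i * l $ j)"

lemma outer_vec: "outer v l *v x = (l \<bullet> x) *\<^sub>R v"
  by (simp add: outer_def vec_eq_iff matrix_vector_mult_def inner_vec_def sum_distrib_left sum_distrib_right mult_ac)

lemma matrix_mult_outer: "M ** outer v l = outer (M *v v) l"
  by (simp add: outer_def vec_eq_iff matrix_matrix_mult_def matrix_vector_mult_def sum_distrib_left sum_distrib_right mult_ac)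

text \<open>If v = (1 - A) z, then 1 - A + v l^T factors as (1 - A)(1 + z l^T) and is singular. The
  determinant thus certifies the drift condition wherever 1 is an eigenvalue, and its non-vanishing
  is an open condition on the pair.\<close>

lemma not_in_range_if_det:
  fixes A :: "real^'n^'n"
  assumes "det (mat 1 - A) = 0" "det (mat 1 - A + outer v l) \<noteq> 0"
  shows "v \<notin> range (\<lambda>x. (mat 1 - A) *v x)"
proof
  assume "v \<in> range (\<lambda>x. (mat 1 - A) *v x)"
  then obtain z where "v = (mat 1 - A) *v z" by blast
  then have "mat 1 - A + outer v l = (mat 1 - A) ** (mat 1 + outer z l)"
    by (simp add: matrix_mult_add matrix_mult_outer)
  then show False using assms by (simp add: det_mul)
qed

text \<open>The left eigenvector works: applied to a kernel vector x it gives l(x) l(v) = 0, so l(x)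
  = 0 and x is fixed by \<open>A\<close>. If x were nonzero, then x and the range of 1 - A would
  span everything, and l, vanishing on both, would contradict l(e) = 1.\<close>

lemma det_if_not_in_range:
  fixes A :: "real^'n^'n"
  assumes ord: "order 1 (charpoly (complex_matrix A)) = 1" and v: "v \<notin> range (\<lambda>x. (mat 1 - A) *v x)"
  obtains l where "det (mat 1 - A + outer v l) \<noteq> 0"
proof -
  obtain e l where e: "A *v e = e" and lA: "\<forall>x. l \<bullet> (A *v x) = l \<bullet> x" and le: "l \<bullet> e = 1"
    and ker: "\<forall>x. l \<bullet> x = 0 \<longrightarrow> (\<exists>z. A *v z - z = x)"
    using simple_eigenvalue_vectors[OF ord] .
  have lv: "l \<bullet> v \<noteq> 0"
  proof
    assume "l \<bullet> v = 0"
    then obtain z where z: "A *v z - z = v" using ker by blast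
    have "v = (mat 1 - A) *v (- z)"
      by (simp add: z[symmetric] matrix_vector_mult_diff_rdistrib linear_neg[OF matrix_vector_mul_linear])
    then show False using v by blast
  qed
  have "x = 0" if x: "(mat 1 - A + outer v l) *v x = 0" for x
  proof -
    have 1: "x - A *v x + (l \<bullet> x) *\<^sub>R v = 0"
      using x by (simp add: matrix_vector_mult_add_rdistrib matrix_vector_mult_diff_rdistrib outer_vec)
    then have "l \<bullet> (x - A *v x + (l \<bullet> x) *\<^sub>R v) = 0" by (simp only: inner_zero_right)
    then have lx: "l \<bullet> x = 0" using lA lv by (simp add: inner_add_right inner_diff_right)
    then have Ax: "A *v x = x" using 1 by simp
    show "x = 0"
    proof (rule ccontr)
      assume x0: "x \<noteq> 0"
      from simple_eigenvalue_complement[OF Ax x0 ord, of e] obtain a u where "e = a *\<^sub>R x + (u - A *v u)" by blast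
      then have "l \<bullet> e = a * (l \<bullet> x) + (l \<bullet> u - l \<bullet> (A *v u))" by (simp add: inner_add_right inner_diff_right)
      then show False using le lx lA by simp
    qed
  qed
  then have "det (mat 1 - A + outer v l) \<noteq> 0" using det_eq_0_iff_kernel by blast
  then show ?thesis using that by blast
qed

text \<open>Positivity of \<open>t\<close> makes its modulus equal to \<open>t\<close>, so
  comparison with 1 decides whether this root lies inside, on or outside the circle, and hence
  whether it is counted in addition to \<open>s\<close>.\<close>

lemma index_spectrum_split:
  fixes A :: "real^'n^'n"
  assumes n: "CARD('n) \<ge> 2" and A: "invertible A" and sp: "split_spectrum A t s" and t: "t > 0"
    and v: "det (mat 1 - A + outer v l) \<noteq> 0"
  shows "(A, v) \<in> anosov_pairs \<and> index_spectrum (affine_map A v)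
    = (if t < 1 then {s + 1} else if t = 1 then {1..CARD('n) - 1} else {s})"
proof -
  let ?chi = "charpoly (complex_matrix A)"
  obtain R where R: "proots ?chi = add_mset (complex_of_real t) R" "\<forall>c\<in>#R. cmod c \<noteq> 1"
    "size (filter_mset (\<lambda>c. cmod c < 1) R) = s"
    using sp unfolding split_spectrum_def by blast
  show ?thesis
  proof (cases "t = 1")
    case False
    have unit: "cmod c \<noteq> 1" if "c \<in> spectrum A" for c
    proof -
      have "c \<in># proots ?chi" using that by (simp add: mem_spectrum_iff charpoly_monic(3))
      then have "c = complex_of_real t \<or> c \<in># R" by (simp add: R(1))
      then show ?thesis using R(2) False t by auto
    qed
    have "dim (stab ((*v) A)) = size (filter_mset (\<lambda>c. norm c < 1) (proots ?chi))"
      by (rule dim_stab[OF A]) (rule unit)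
    then have "dim (stab ((*v) A)) = (if t < 1 then s + 1 else s)"
      using R(3) t by (simp add: R(1))
    moreover have "hyperbolic_splitting A (stab ((*v) A)) (stab ((*v) (matrix_inv A)))"
      by (rule hyperbolic_splitting_stab[OF A]) (rule unit)
    ultimately show ?thesis
      using index_spectrum_hyperbolic[OF A, of _ _ v] False by auto
  next
    case True
    \<comment> \<open>The other roots avoid the circle, so the eigenvalue 1 of the present matrix is
      again simple and the drift case applies.\<close>
    have "count R 1 = 0" using R(2) by (metis count_eq_zero_iff norm_one)
    then have "count (proots ?chi) 1 = 1" by (simp add: R(1) True)
    then have ord: "order 1 ?chi = 1" by (simp add: charpoly_monic(3))
    then have "poly ?chi 1 = 0" by (metis order_root zero_neq_one)
    then have "det (mat 1 - A) = 0" using poly_charpoly_of_real[of A 1] by simp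
    then have "v \<notin> range (\<lambda>x. (mat 1 - A) *v x)" using v by (rule not_in_range_if_det)
    then show ?thesis using index_spectrum_drift[OF n A ord] True by simp
  qed
qed

lemma sum_alg_mult_inside:
  "(\<Sum>c\<in>{c \<in> spectrum A. c \<noteq> 1 \<and> norm c < 1}. alg_mult A c)
    = size (filter_mset (\<lambda>c. norm c < 1) (proots (charpoly (complex_matrix A))))"
proof -
  let ?M = "filter_mset (\<lambda>c. norm c < 1) (proots (charpoly (complex_matrix A)))"
  have "set_mset ?M = {c \<in> spectrum A. c \<noteq> 1 \<and> norm c < 1}"
    by (auto simp: mem_spectrum_iff charpoly_monic(3))
  then show ?thesis
    unfolding size_multiset_overloaded_eq by (intro sum.cong) (auto simp: alg_mult_def charpoly_monic(3))
qed

theorem corollary5p2: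
  fixes A0 :: "real^'n^'n" and v0 :: "real^'n" and s :: nat
  assumes "CARD('n) \<ge> 2"
    and "regular_drift_pair A0 v0"
    and "s = (\<Sum>c\<in>{c \<in> spectrum A0. c \<noteq> 1 \<and> norm c < 1}. alg_mult A0 c)"
  shows "\<exists>(U :: ((real^'n^'n) \<times> (real^'n)) set) (ev :: real^'n^'n \<Rightarrow> real).
    open U \<and> (A0, v0) \<in> U \<and> U \<subseteq> anosov_pairs \<and>
    smooth_on (fst ` U) ev \<and> ev A0 = 1 \<and>
    (\<forall>A\<in>fst ` U. complex_of_real (ev A) \<in> spectrum A) \<and>
    (\<forall>(A, v)\<in>U. index_spectrum (affine_map A v) =
       (if ev A < 1 then {s + 1}
        else if ev A = 1 then {1..CARD('n) - 1}
        else {s}))"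
proof -
  have A0: "invertible A0" and circle: "spectrum A0 \<inter> sphere 0 1 = {1}"
    and ord: "order 1 (charpoly (complex_matrix A0)) = 1" and v0: "v0 \<notin> range (\<lambda>x. (mat 1 - A0) *v x)"
    using assms(2) by (auto simp: regular_drift_pair_def alg_mult_def)
  obtain W and ev :: "real^'n^'n \<Rightarrow> real" where W: "open W" "A0 \<in> W" and ev: "smooth_on W ev" "ev A0 = 1"
    and root: "\<forall>A\<in>W. poly (charpoly (complex_matrix A)) (complex_of_real (ev A)) = 0"
    using eigenvalue_branch[OF ord] .
  obtain l where l: "det (mat 1 - A0 + outer v0 l) \<noteq> 0" using det_if_not_in_range[OF ord v0] .
  have cont: "continuous (at A0) ev"
    using smooth_on_imp_continuous_on[OF ev(1)] W continuous_on_eq_continuous_at by blast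
  have "eventually (\<lambda>A. A \<in> W) (nhds A0)" using W by (rule eventually_nhds_in_open)
  then have "eventually (\<lambda>A. poly (charpoly (complex_matrix A)) (complex_of_real (ev A)) = 0) (nhds A0)"
    by (rule eventually_mono) (use root in blast)
  then have e1: "eventually (\<lambda>A. split_spectrum A (ev A) s) (nhds A0)"
    unfolding assms(3) sum_alg_mult_inside by (rule eventually_split_spectrum[OF ord circle cont ev(2)])
  then obtain V1 where V1: "open V1" "A0 \<in> V1" "\<forall>A\<in>V1. split_spectrum A (ev A) s"
    unfolding eventually_nhds by blast
  have V2: "open (W \<inter> ev -` {0<..})"
    using continuous_open_preimage[OF smooth_on_imp_continuous_on[OF ev(1)] W(1), of "{0<..}"] by simp
  \<comment> \<open>Positivity of the branch is imposed so that it can meet the unit circle only at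
    1.\<close>
  define V where "V = V1 \<inter> (W \<inter> ev -` {0<..})"
  define U where "U = {z. fst z \<in> V \<and> det (fst z) \<noteq> 0 \<and> det (mat 1 - fst z + outer (snd z) l) \<noteq> 0}"
  have "open (fst -` V :: ((real^'n^'n) \<times> (real^'n)) set)"
    unfolding V_def by (intro open_vimage open_Int V1 V2 continuous_on_fst continuous_on_id)
  moreover have "open {z :: (real^'n^'n) \<times> (real^'n). det (fst z) \<noteq> 0}"
    by (intro open_Collect_neq continuous_on_det continuous_on_fst continuous_on_id continuous_on_const)
  moreover have "open {z :: (real^'n^'n) \<times> (real^'n). det (mat 1 - fst z + outer (snd z) l) \<noteq> 0}"
    unfolding outer_def
    by (intro open_Collect_neq continuous_on_det continuous_intros)
  ultimately have "open (fst -` V \<inter> ({z. det (fst z) \<noteq> 0} \<inter> {z. det (mat 1 - fst z + outer (snd z) l) \<noteq> 0}))"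
    by (intro open_Int)
  moreover have "U = fst -` V \<inter> ({z. det (fst z) \<noteq> 0} \<inter> {z. det (mat 1 - fst z + outer (snd z) l) \<noteq> 0})"
    by (auto simp: U_def)
  ultimately have "open U" by simp
  moreover have "(A0, v0) \<in> U"
    using V1(2) W(2) ev(2) A0 l by (simp add: U_def V_def invertible_det_nz)
  moreover have idx: "(A, v) \<in> anosov_pairs \<and> index_spectrum (affine_map A v)
      = (if ev A < 1 then {s + 1} else if ev A = 1 then {1..CARD('n) - 1} else {s})" if "(A, v) \<in> U" for A v
    by (rule index_spectrum_split[OF assms(1)])
      (use that V1(3) in \<open>auto simp: U_def V_def invertible_det_nz\<close>)
  moreover have sub: "fst ` U \<subseteq> W" by (auto simp: U_def V_def)
  then have "smooth_on (fst ` U) ev" by (rule smooth_on_subset[OF ev(1)])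
  moreover have "\<forall>A\<in>fst ` U. complex_of_real (ev A) \<in> spectrum A"
    using sub root mem_spectrum_iff by blast
  ultimately show ?thesis
    using ev(2) by (intro exI[of _ U] exI[of _ ev]) auto
qed

end
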